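(* There are absolute constants $c,C>0$ such that the following holds for every integer $n>1$. Let $X$ be the closed unit ball in $\mathbb{R}^n$, let $Y=\partial X$ be the unit sphere, let $x=0$ be the center of the ball, and for $0<\delta\le 2$ let $A_\delta\subset Y$ be a closed spherical cap of radius $\delta$ (of dimension $n-1$), i.e. $A_\delta=\{y\in Y:|y-p|\le\delta\}$ for some $p\in Y$. Then $$c\,\delta^{1/3}\le\omega_\infty(A_\delta)\le C\,\delta^{1/3},$$ where $\omega_\infty(A_\delta)=\omega_\infty^{(x,Y,X)}(A_\delta)$ is the $\infty$-harmonic measure of $A_\delta$ from $x$. (In particular $c,C$ do not depend on $n$ or $\delta$.)
   Context: Let $X$ be a length space with metric $d$ (here the ball with the Euclidean metric). For $W\subset X$, $\mathrm{Lip}_W u=\sup\{|u(y)-u(x)|/d(x,y):x,y\in W,\ x\neq y\}$. A function $u:X\to\mathbb{R}$ that is Lipschitz on $X$ is AM (absolutely minimal) in $X\setminus Y$ if $\mathrm{Lip}_U u=\mathrm{Lip}_{\partial U}u$ for every open $U\subset X\setminus Y$. For $A\subset Y\subset X$ with $A$ closed, $Y\neq\emptyset$, and $x\in X$, the $\infty$-harmonic measure of $A$ from $x$, denoted $\omega_\infty^{(x,Y,X)}(A)$, is the infimum of $u(x)$ over all functions $u:X\to[0,\infty)$ that are Lipschitz on $X$, AM in $X\setminus Y$, and satisfy $u\ge1$ on $A$. *)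

theory Defs
  imports "HOL-Analysis.Analysis"
begin

text \<open>
  Values in \<^typ>\<open>ennreal\<close>: the supremum over an empty set of pairs is \<open>0\<close>, and a
  function that is not Lipschitz on \<open>W\<close> gets constant \<open>\<infinity>\<close>.
\<close>

definition Lip_const :: "'a metric \<Rightarrow> 'a set \<Rightarrow> ('a \<Rightarrow> real) \<Rightarrow> ennreal" where
  "Lip_const m W u =
     Sup {ennreal (\<bar>u y - u x\<bar> / mdist m x y) | x y. x \<in> W \<and> y \<in> W \<and> x \<noteq> y}"

text \<open>
  Openness and boundary are taken relative to the space \<open>m\<close> itself.
\<close>

definition absolutely_minimal :: "'a metric \<Rightarrow> 'a set \<Rightarrow> ('a \<Rightarrow> real) \<Rightarrow> bool" where
  "absolutely_minimal m Y u \<longleftrightarrow>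
     Lipschitz_continuous_map m euclidean_metric u \<and>
     (\<forall>U. openin (mtopology_of m) U \<and> U \<subseteq> mspace m - Y \<longrightarrow>
        Lip_const m U u = Lip_const m (mtopology_of m frontier_of U) u)"

text \<open>
  The \<open>\<infinity>\<close>-harmonic measure of \<open>A\<close> from \<open>x\<close>, with arguments in the order \<open>x\<close>, \<open>Y\<close>, \<open>m\<close>, \<open>A\<close>;
  it is meant for closed \<open>A \<subseteq> Y\<close>, nonempty \<open>Y\<close> and \<open>x\<close> in the space. The real infimum is over a
  set that is bounded below by \<open>0\<close> and contains \<open>1\<close> (constant function).
\<close>

definition infharm :: "'a \<Rightarrow> 'a set \<Rightarrow> 'a metric \<Rightarrow> 'a set \<Rightarrow> real" where
  "infharm x Y m A =
     Inf {u x | u. (\<forall>z\<in>mspace m. 0 \<le> u z) \<and> absolutely_minimal m Y u \<and> (\<forall>a\<in>A. 1 \<le> u a)}"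

text \<open>
  The dimension must be an ordinary number here, since the constants are chosen before it. So
  \<open>n\<close>-space is \<^term>\<open>topspace (Euclidean_space n)\<close>, the real sequences vanishing from index \<open>n\<close> on.
\<close>

definition euclid_metric :: "nat \<Rightarrow> (nat \<Rightarrow> real) metric" where
  "euclid_metric n =
     metric (topspace (Euclidean_space n), \<lambda>x y. L2_set (\<lambda>i. x i - y i) {..<n})"

lemma Metric_space_euclid:
  "Metric_space (topspace (Euclidean_space n)) (\<lambda>x y. L2_set (\<lambda>i. x i - y i) {..<n})"
proof
  fix x y z :: "nat \<Rightarrow> real"
  show "0 \<le> L2_set (\<lambda>i. x i - y i) {..<n}"
    by simp
  show "L2_set (\<lambda>i. x i - y i) {..<n} = L2_set (\<lambda>i. y i - x i) {..<n}"
    by (simp add: L2_set_def power2_commute)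
  show "L2_set (\<lambda>i. x i - y i) {..<n} = 0 \<longleftrightarrow> x = y"
    if "x \<in> topspace (Euclidean_space n)" "y \<in> topspace (Euclidean_space n)"
  proof -
    have "x = y" if eq: "\<forall>i\<in>{..<n}. x i = y i"
    proof
      show "x i = y i" for i
        using that \<open>x \<in> _\<close> \<open>y \<in> _\<close> unfolding topspace_Euclidean_space
        by (cases "i < n") auto
    qed
    then show ?thesis
      by (auto simp: L2_set_eq_0_iff)
  qed
  show "L2_set (\<lambda>i. x i - z i) {..<n} \<le>
        L2_set (\<lambda>i. x i - y i) {..<n} + L2_set (\<lambda>i. y i - z i) {..<n}"
    using L2_set_triangle_ineq[of "\<lambda>i. x i - y i" "\<lambda>i. y i - z i" "{..<n}"] by simp
qed

lemma mspace_euclid_metric [simp]: "mspace (euclid_metric n) = {x. \<forall>i\<ge>n. x i = 0}"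
  unfolding euclid_metric_def Metric_space.mspace_metric[OF Metric_space_euclid]
  by (rule topspace_Euclidean_space)

lemma mdist_euclid_metric [simp]:
  "mdist (euclid_metric n) x y = L2_set (\<lambda>i. x i - y i) {..<n}"
  unfolding euclid_metric_def Metric_space.mdist_metric[OF Metric_space_euclid] ..

abbreviation origin :: "nat \<Rightarrow> real" where
  "origin \<equiv> \<lambda>_. 0"

definition ball_metric :: "nat \<Rightarrow> (nat \<Rightarrow> real) metric" where
  "ball_metric n = submetric (euclid_metric n) (mcball_of (euclid_metric n) origin 1)"

definition unit_sphere :: "nat \<Rightarrow> (nat \<Rightarrow> real) set" where
  "unit_sphere n = {y \<in> mspace (euclid_metric n). mdist (euclid_metric n) origin y = 1}"

definition spherical_cap :: "nat \<Rightarrow> (nat \<Rightarrow> real) \<Rightarrow> real \<Rightarrow> (nat \<Rightarrow> real) set" where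
  "spherical_cap n p \<delta> = {y \<in> unit_sphere n. mdist (euclid_metric n) y p \<le> \<delta>}"

end

theory Submission
  imports Defs
begin

text \<open>
  The function \<open>M\<^sup>-\<^sup>1\<^sup>/\<^sup>3\<close> with \<open>M (X, Y) = max\<^sub>t (X (1 - t\<^sup>4) + 2 Y (t + t\<^sup>3))\<close> is Aronsson's
  infinity-harmonic function on the half plane \<open>X > 0\<close>: homogeneous of degree \<open>-1/3\<close>, with a pole at
  the origin and zero on the rest of the boundary. Since \<open>M\<close> is a maximum of linear forms, its slope
  is explicit, and so are its gradient lines, along which the slope is constant up to the axis and
  increases on the axis. Following a gradient line out of an open set \<open>U\<close> in both directions bounds
  the slope in \<open>U\<close> by the Lipschitz constant on the boundary, so the function is absolutely minimal,
  in any dimension after composition with cylindrical coordinates, which are \<open>1\<close>-Lipschitz; no second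
  derivatives (which do not exist on the axis) are needed.

  For the upper bound the pole is put at distance \<open>\<delta>\<close> outside the ball behind the cap. For the lower
  bound a function that is at least \<open>1\<close> on the cap is at least \<open>1/2\<close> at distance \<open>\<delta>/2\<close> from its center, by
  comparison with a cone. Away from there it is compared with \<open>c \<delta>\<^sup>1\<^sup>/\<^sup>3 (M\<^sup>-\<^sup>1\<^sup>/\<^sup>3 - K)\<close>, the pole being within
  \<open>O (\<delta>\<^sup>2)\<close> of the cap: on the rest of the sphere \<open>M\<close> is at least \<open>3/2\<close>, while it is about \<open>1\<close> at
  the center of the ball, so a constant \<open>K\<close> in between serves. The comparison principle is proved by
  the finite difference argument of Armstrong and Smart.
\<close>

section \<open>Absolutely minimal functions on geodesic spaces\<close>

text \<open>The exponent is homogeneity: between distance \<delta> and distance 1 from the pole a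
  function of degree -1/3 loses a factor of order \<open>\<delta> powr (1/3)\<close>. The dimension
  disappears because the comparison functions see only two coordinates of a point. The equation
  behind absolute minimality is nonlinear, so barriers cannot be superposed; only
  \<open>c * u + k\<close> is available to fit boundary values. Hence M must be larger on the sphere
  off the cap than at the center. For a pole on the sphere, M is at least 4 / (1 - a) at a point of
  the sphere whose inner product with the pole is a, so never below 2, against 1 at the center. But
  such a pole destroys the Lipschitz property, and a pole outside spoils the bound where the depth 1
  - a below the tangent hyperplane is comparable with the displacement. At distance \<delta> the
  depth is of order \<delta>^2, whence the position of the pole in the lower bound. The finite
  difference argument needs one of the two functions to increase at a definite rate towards nearby
  points. Gradient lines supply this too: their parameter k is bounded on the ball, so the slope 1 /
  (3 k^4) is bounded below.\<close>

lemma openin_mtopology_of_iff: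
  "openin (mtopology_of m) U \<longleftrightarrow> U \<subseteq> mspace m \<and>
     (\<forall>x\<in>U. \<exists>r>0. \<forall>y\<in>mspace m. mdist m x y < r \<longrightarrow> y \<in> U)"
proof -
  interpret Metric_space "mspace m" "mdist m" by simp
  show ?thesis
    unfolding mtopology_of_def openin_mtopology subset_iff in_mball by meson
qed

lemma closure_mtopology_of_iff:
  "x \<in> mtopology_of m closure_of S \<longleftrightarrow>
     x \<in> mspace m \<and> (\<forall>r>0. \<exists>y\<in>S. y \<in> mspace m \<and> mdist m x y < r)"
proof -
  interpret Metric_space "mspace m" "mdist m" by simp
  show ?thesis
    unfolding mtopology_of_def metric_closure_of mem_Collect_eq in_mball by blast
qed

lemma openin_mball_of: "openin (mtopology_of m) (mball_of m x r)"
  unfolding mtopology_of_def mball_of_def by (simp add: Metric_space.openin_mball)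

lemma closedin_mcball_of: "closedin (mtopology_of m) (mcball_of m x r)"
  unfolding mtopology_of_def mcball_of_def by (simp add: Metric_space.closedin_mcball)

lemma frontier_of_openin_iff:
  assumes "openin (mtopology_of m) U"
  shows "x \<in> mtopology_of m frontier_of U \<longleftrightarrow>
     x \<in> mspace m \<and> x \<notin> U \<and> (\<forall>r>0. \<exists>y\<in>U. mdist m x y < r)"
proof -
  have "U \<subseteq> mspace m" using assms by (simp add: openin_mtopology_of_iff)
  then show ?thesis
    unfolding frontier_of_openin[OF assms] Diff_iff closure_mtopology_of_iff by blast
qed

lemma frontier_dist_le:
  assumes "openin (mtopology_of m) U" "z \<in> mspace m" "\<And>y. y \<in> U \<Longrightarrow> mdist m z y \<le> r"
    and "x \<in> mtopology_of m frontier_of U"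
  shows "mdist m z x \<le> r"
proof (rule field_le_epsilon)
  fix e :: real assume "e > 0"
  then obtain y where y: "y \<in> U" "mdist m x y < e"
    using assms(4) frontier_of_openin_iff[OF assms(1)] by blast
  have "y \<in> mspace m" "x \<in> mspace m"
    using y assms(1,4) frontier_of_openin_iff[OF assms(1)] by (auto simp: openin_mtopology_of_iff)
  then show "mdist m z x \<le> r + e"
    using mdist_triangle[of z m y x] y assms(2) assms(3)[OF y(1)] mdist_commute[of m y x] by linarith
qed

lemma frontier_dist_ge:
  assumes "openin (mtopology_of m) U" "z \<in> mspace m" "\<And>y. y \<in> U \<Longrightarrow> r \<le> mdist m z y"
    and "x \<in> mtopology_of m frontier_of U"
  shows "r \<le> mdist m z x"
proof (rule field_le_epsilon)
  fix e :: real assume "e > 0"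
  then obtain y where y: "y \<in> U" "mdist m x y < e"
    using assms(4) frontier_of_openin_iff[OF assms(1)] by blast
  have "y \<in> mspace m" "x \<in> mspace m"
    using y assms(1,4) frontier_of_openin_iff[OF assms(1)] by (auto simp: openin_mtopology_of_iff)
  then show "r \<le> mdist m z x + e"
    using mdist_triangle[of z m x y] y assms(2) assms(3)[OF y(1)] by linarith
qed

section \<open>Lipschitz constants and affine changes of absolutely minimal functions\<close>

lemma Lipschitz_real_iff:
  "Lipschitz_continuous_map m euclidean_metric u \<longleftrightarrow>
     (\<exists>B>0. \<forall>x\<in>mspace m. \<forall>y\<in>mspace m. \<bar>u x - u y\<bar> \<le> B * mdist m x y)"
  unfolding Lipschitz_continuous_map_pos by (simp add: dist_real_def)

lemma Lip_const_le_iff: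
  assumes "W \<subseteq> mspace m" "0 \<le> L"
  shows "Lip_const m W u \<le> ennreal L \<longleftrightarrow> (\<forall>x\<in>W. \<forall>y\<in>W. \<bar>u y - u x\<bar> \<le> L * mdist m x y)"
proof -
  have *: "ennreal (\<bar>u y - u x\<bar> / mdist m x y) \<le> ennreal L \<longleftrightarrow> \<bar>u y - u x\<bar> \<le> L * mdist m x y"
    if "x \<in> W" "y \<in> W" "x \<noteq> y" for x y
  proof -
    have "mdist m x y > 0"
      using that assms mdist_zero[of x m y] mdist_nonneg[of m x y] by (metis less_eq_real_def subsetD)
    then show ?thesis using assms by (simp add: pos_divide_le_eq)
  qed
  have "\<bar>u y - u x\<bar> \<le> L * mdist m x y" if "x = y" "x \<in> W" for x y
    using that assms by simp
  with * show ?thesis unfolding Lip_const_def Sup_le_iff by blast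
qed

text \<open>Multiplication by a constant passes through suprema in \<open>ennreal\<close> without
  exception: an empty set of pairs, and \<open>c = 0\<close> against an infinite constant, both give
  0. The case \<open>c = 0\<close> settles constant functions, \<open>c = -1\<close> exchanges
  bounds from above and below.\<close>

lemma Lip_const_affine:
  "Lip_const m W (\<lambda>x. c * u x + k) = ennreal \<bar>c\<bar> * Lip_const m W u"
proof -
  let ?P = "{(x, y). x \<in> W \<and> y \<in> W \<and> x \<noteq> y}"
  have set_eq: "{ennreal (\<bar>w y - w x\<bar> / mdist m x y) | x y. x \<in> W \<and> y \<in> W \<and> x \<noteq> y} =
    (\<lambda>(x, y). ennreal (\<bar>w y - w x\<bar> / mdist m x y)) ` ?P" for w
    by auto
  have *: "ennreal (\<bar>c * u y + k - (c * u x + k)\<bar> / mdist m x y) =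
      ennreal \<bar>c\<bar> * ennreal (\<bar>u y - u x\<bar> / mdist m x y)" for x y
  proof -
    have "c * u y + k - (c * u x + k) = c * (u y - u x)" by (simp add: algebra_simps)
    then have "\<bar>c * u y + k - (c * u x + k)\<bar> / mdist m x y = \<bar>c\<bar> * (\<bar>u y - u x\<bar> / mdist m x y)"
      by (simp add: abs_mult)
    then show ?thesis by (simp only: ennreal_mult' abs_ge_zero)
  qed
  have "Lip_const m W (\<lambda>x. c * u x + k) =
      (SUP p\<in>?P. ennreal \<bar>c\<bar> * (case p of (x, y) \<Rightarrow> ennreal (\<bar>u y - u x\<bar> / mdist m x y)))"
    unfolding Lip_const_def set_eq by (intro arg_cong[where f=Sup] image_cong) (auto simp only: * split: prod.splits)
  also have "\<dots> = ennreal \<bar>c\<bar> * Lip_const m W u"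
    unfolding Lip_const_def set_eq by (subst SUP_mult_left_ennreal) auto
  finally show ?thesis .
qed

lemma absolutely_minimal_affine:
  assumes "absolutely_minimal m Y u"
  shows "absolutely_minimal m Y (\<lambda>x. c * u x + k)"
proof -
  obtain B where B: "B > 0" "\<forall>x\<in>mspace m. \<forall>y\<in>mspace m. \<bar>u x - u y\<bar> \<le> B * mdist m x y"
    using assms unfolding absolutely_minimal_def Lipschitz_real_iff by blast
  \<comment> \<open>The summand 1 keeps the constant positive when \<open>c = 0\<close>.\<close>
  have "\<bar>(c * u x + k) - (c * u y + k)\<bar> \<le> ((\<bar>c\<bar> + 1) * B) * mdist m x y"
    if "x \<in> mspace m" "y \<in> mspace m" for x y
  proof -
    have "c * u x + k - (c * u y + k) = c * (u x - u y)" by (simp add: algebra_simps)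
    then have "\<bar>(c * u x + k) - (c * u y + k)\<bar> = \<bar>c\<bar> * \<bar>u x - u y\<bar>"
      by (simp add: abs_mult)
    also have "\<dots> \<le> (\<bar>c\<bar> + 1) * (B * mdist m x y)"
      using B that by (intro mult_mono) auto
    finally show ?thesis by (simp add: mult.assoc)
  qed
  then have "Lipschitz_continuous_map m euclidean_metric (\<lambda>x. c * u x + k)"
    unfolding Lipschitz_real_iff using B(1) by (intro exI[of _ "(\<bar>c\<bar> + 1) * B"]) auto
  with assms show ?thesis
    unfolding absolutely_minimal_def Lip_const_affine by auto
qed

lemma absolutely_minimal_const: "absolutely_minimal m Y (\<lambda>x. k)"
proof -
  have "Lip_const m W (\<lambda>x. k) = 0" for W
    using Lip_const_affine[of m W 0 "\<lambda>x. k" k] by simp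
  then show ?thesis
    unfolding absolutely_minimal_def Lipschitz_real_iff by (auto intro!: exI[of _ 1])
qed

section \<open>Geodesics and first exits from open sets\<close>

text \<open>Segments run at constant speed over the unit interval, so that distances between any two
  of their points are explicit. In a convex ball the straight segments qualify; a length space in
  general need not have any.\<close>

definition geodesic_metric :: "'a metric \<Rightarrow> bool" where
  "geodesic_metric m \<longleftrightarrow> (\<forall>x\<in>mspace m. \<forall>y\<in>mspace m. \<exists>g :: real \<Rightarrow> 'a.
     g 0 = x \<and> g 1 = y \<and> (\<forall>s\<in>{0..1}. g s \<in> mspace m) \<and>
     (\<forall>s\<in>{0..1}. \<forall>t\<in>{0..1}. mdist m (g s) (g t) = \<bar>s - t\<bar> * mdist m x y))"

lemma geodesicE:
  assumes "geodesic_metric m" "x \<in> mspace m" "y \<in> mspace m"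
  obtains g :: "real \<Rightarrow> 'a" where "g 0 = x" "g 1 = y" "\<And>s. s \<in> {0..1} \<Longrightarrow> g s \<in> mspace m"
    "\<And>s t. s \<in> {0..1} \<Longrightarrow> t \<in> {0..1} \<Longrightarrow> mdist m (g s) (g t) = \<bar>s - t\<bar> * mdist m x y"
proof -
  have "\<forall>y\<in>mspace m. \<exists>g :: real \<Rightarrow> 'a. g 0 = x \<and> g 1 = y \<and> (\<forall>s\<in>{0..1}. g s \<in> mspace m) \<and>
     (\<forall>s\<in>{0..1}. \<forall>t\<in>{0..1}. mdist m (g s) (g t) = \<bar>s - t\<bar> * mdist m x y)"
    by (rule bspec[OF assms(1)[unfolded geodesic_metric_def] assms(2)])
  from bspec[OF this assms(3)] obtain g :: "real \<Rightarrow> 'a" where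
    "g 0 = x \<and> g 1 = y \<and> (\<forall>s\<in>{0..1}. g s \<in> mspace m) \<and>
     (\<forall>s\<in>{0..1}. \<forall>t\<in>{0..1}. mdist m (g s) (g t) = \<bar>s - t\<bar> * mdist m x y)" ..
  then show thesis by (intro that[of g]) simp_all
qed

text \<open>The exit time is the infimum of the times spent outside U. Openness of U keeps the limit
  of outside points outside, and continuity makes it a limit of points of U. As \<open>L\<close> may
  be 0, divisions are by \<open>L + 1\<close>.\<close>

lemma first_exit:
  fixes \<gamma> :: "real \<Rightarrow> 'a"
  assumes U: "openin (mtopology_of m) U" and ab: "a \<le> b" and L: "0 \<le> L"
    and in_m: "\<And>t. t \<in> {a..b} \<Longrightarrow> \<gamma> t \<in> mspace m"
    and lip: "\<And>s t. s \<in> {a..b} \<Longrightarrow> t \<in> {a..b} \<Longrightarrow> mdist m (\<gamma> s) (\<gamma> t) \<le> L * \<bar>s - t\<bar>"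
    and ends: "\<gamma> a \<in> U" "\<gamma> b \<notin> U"
  obtains \<tau> where "a < \<tau>" "\<tau> \<le> b" "\<gamma> \<tau> \<in> mtopology_of m frontier_of U" "\<And>t. a \<le> t \<Longrightarrow> t < \<tau> \<Longrightarrow> \<gamma> t \<in> U"
proof -
  define S where "S = {t \<in> {a..b}. \<gamma> t \<notin> U}"
  define \<tau> where "\<tau> = Inf S"
  have S: "b \<in> S" "bdd_below S" using ab ends by (auto simp: S_def)
  have le: "\<tau> \<le> t" if "t \<in> S" for t unfolding \<tau>_def using S that by (simp add: cInf_lower)
  have "a \<le> \<tau>" unfolding \<tau>_def using S by (intro cInf_greatest) (auto simp: S_def)
  have tb: "\<tau> \<le> b" using le S by blast
  have before: "\<gamma> t \<in> U" if "a \<le> t" "t < \<tau>" for t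
    using le[of t] that tb by (auto simp: S_def)
  have out: "\<gamma> \<tau> \<notin> U"
  proof
    assume "\<gamma> \<tau> \<in> U"
    then obtain r where r: "r > 0" "\<And>y. y \<in> mspace m \<Longrightarrow> mdist m (\<gamma> \<tau>) y < r \<Longrightarrow> y \<in> U"
      using U unfolding openin_mtopology_of_iff by blast
    have "r / (L + 1) > 0" using r L by simp
    then obtain t where t: "t \<in> S" "t < \<tau> + r / (L + 1)"
      using cInf_lessD[of S "\<tau> + r / (L + 1)"] S unfolding \<tau>_def by force
    have "mdist m (\<gamma> \<tau>) (\<gamma> t) \<le> L * \<bar>\<tau> - t\<bar>"
      using lip \<open>a \<le> \<tau>\<close> tb t by (auto simp: S_def)
    also have "\<dots> \<le> (L + 1) * \<bar>\<tau> - t\<bar>" by (simp add: algebra_simps)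
    also have "\<dots> < (L + 1) * (r / (L + 1))"
      using le[OF t(1)] t(2) L by (intro mult_strict_left_mono) auto
    also have "\<dots> = r" using L by (auto simp: field_simps)
    finally have "\<gamma> t \<in> U" using r(2) in_m t by (auto simp: S_def)
    then show False using t by (auto simp: S_def)
  qed
  then have "a < \<tau>" using \<open>a \<le> \<tau>\<close> ends by (cases "a = \<tau>") auto
  have "\<exists>y\<in>U. mdist m (\<gamma> \<tau>) y < r" if "r > 0" for r
  proof -
    define t where "t = max a (\<tau> - r / (L + 1) / 2)"
    have p: "r / (L + 1) / 2 > 0" using that L by simp
    have t: "a \<le> t" "t < \<tau>" "\<tau> - t \<le> r / (L + 1) / 2"
      using \<open>a < \<tau>\<close> p by (auto simp: t_def)
    have "mdist m (\<gamma> \<tau>) (\<gamma> t) \<le> L * \<bar>\<tau> - t\<bar>"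
      using lip[of \<tau> t] \<open>a \<le> \<tau>\<close> tb t by simp
    also have "\<dots> \<le> (L + 1) * (r / (L + 1) / 2)"
      using t L by (intro mult_mono) auto
    also have "\<dots> = r / 2" using L by (auto simp: field_simps)
    also have "\<dots> < r" using that by simp
    finally show ?thesis using before[OF t(1,2)] by blast
  qed
  then have "\<gamma> \<tau> \<in> mtopology_of m frontier_of U"
    unfolding frontier_of_openin_iff[OF U] using out in_m tb \<open>a \<le> \<tau>\<close> by auto
  with that \<open>a < \<tau>\<close> tb before show thesis by blast
qed

section \<open>Comparison with cones\<close>

text \<open>The definition compares two points of U. Here y is replaced by a nearby point of U, at a
  cost controlled by the global Lipschitz constant of u.\<close>

lemma absolutely_minimal_slope_le:
  assumes am: "absolutely_minimal m Y u" and U: "openin (mtopology_of m) U" "U \<subseteq> mspace m - Y"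
    and b: "0 \<le> b"
    and front: "\<And>x y. x \<in> mtopology_of m frontier_of U \<Longrightarrow> y \<in> mtopology_of m frontier_of U \<Longrightarrow>
      \<bar>u y - u x\<bar> \<le> b * mdist m x y"
    and xy: "x \<in> U" "y \<in> mtopology_of m frontier_of U"
  shows "\<bar>u y - u x\<bar> \<le> b * mdist m x y"
proof (rule field_le_epsilon)
  fix e :: real assume "e > 0"
  obtain B where B: "B > 0" "\<And>x y. x\<in>mspace m \<Longrightarrow> y\<in>mspace m \<Longrightarrow> \<bar>u x - u y\<bar> \<le> B * mdist m x y"
    using am unfolding absolutely_minimal_def Lipschitz_real_iff by blast
  have F: "mtopology_of m frontier_of U \<subseteq> mspace m"
    using frontier_of_subset_topspace by fastforce
  have "Lip_const m (mtopology_of m frontier_of U) u \<le> ennreal b"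
    using Lip_const_le_iff[OF F b] front by blast
  then have "Lip_const m U u \<le> ennreal b"
    using am U unfolding absolutely_minimal_def by auto
  then have *: "\<bar>u y - u x\<bar> \<le> b * mdist m x y" if "x \<in> U" "y \<in> U" for x y
    using Lip_const_le_iff[of U m b u] U b that by blast
  have "e / (B + b + 1) > 0" using \<open>e > 0\<close> B b by simp
  then obtain z where z: "z \<in> U" "mdist m y z < e / (B + b + 1)"
    using xy frontier_of_openin_iff[OF U(1)] by blast
  have in_m: "x \<in> mspace m" "y \<in> mspace m" "z \<in> mspace m"
    using z xy U F by auto
  have "\<bar>u y - u x\<bar> \<le> \<bar>u y - u z\<bar> + \<bar>u z - u x\<bar>" by simp
  also have "\<dots> \<le> B * mdist m y z + b * mdist m x z"
    using B(2) in_m *[OF xy(1) z(1)] by (intro add_mono) auto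
  also have "\<dots> \<le> B * mdist m y z + b * (mdist m x y + mdist m y z)"
    using b mdist_triangle in_m by (intro add_left_mono mult_left_mono) auto
  also have "\<dots> = b * mdist m x y + (B + b) * mdist m y z" by (simp add: algebra_simps)
  also have "\<dots> \<le> b * mdist m x y + (B + b + 1) * (e / (B + b + 1))"
    using z(2) B b by (intro add_left_mono mult_mono) auto
  also have "\<dots> = b * mdist m x y + e" using B b by (auto simp: field_simps)
  finally show "\<bar>u y - u x\<bar> \<le> b * mdist m x y + e" .
qed

text \<open>On the frontier of the set where u falls below the cone, u equals the cone and so has
  slope at most b. The geodesic from x to the vertex leaves that set, since u is at least a at the
  vertex. Along it the cone climbs at the full rate b, so u, starting below and catching up, would
  have to climb faster than b. The vertex may lie in Y.\<close>

lemma absolutely_minimal_cone_below: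
  assumes geo: "geodesic_metric m" and am: "absolutely_minimal m Y u"
    and V: "openin (mtopology_of m) V" "V \<subseteq> mspace m - Y"
    and b: "0 \<le> b" and z: "z \<in> mspace m" "a \<le> u z"
    and front: "\<And>y. y \<in> mtopology_of m frontier_of V \<Longrightarrow> a - b * mdist m z y \<le> u y"
    and x: "x \<in> V"
  shows "a - b * mdist m z x \<le> u x"
proof (rule ccontr)
  assume neg: "\<not> ?thesis"
  define C where "C y = a - b * mdist m z y" for y
  define W where "W = {y \<in> V. u y < C y}"
  have VX: "V \<subseteq> mspace m" using V by auto
  obtain B where B: "B > 0" "\<And>x y. x\<in>mspace m \<Longrightarrow> y\<in>mspace m \<Longrightarrow> \<bar>u x - u y\<bar> \<le> B * mdist m x y"
    using am unfolding absolutely_minimal_def Lipschitz_real_iff by blast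
  have C: "\<bar>C x - C y\<bar> \<le> b * mdist m x y" if "x\<in>mspace m" "y\<in>mspace m" for x y
  proof -
    have "C x - C y = b * (mdist m z y - mdist m z x)" by (simp add: C_def algebra_simps)
    then have "\<bar>C x - C y\<bar> = b * \<bar>mdist m z y - mdist m z x\<bar>"
      using b by (simp add: abs_mult)
    also have "\<dots> \<le> b * mdist m x y"
      using mdist_triangle[of z m x y] mdist_triangle[of z m y x] mdist_commute[of m x y] z that b
      by (intro mult_left_mono) auto
    finally show ?thesis .
  qed
  have near: "\<bar>(C y - u y) - (C x - u x)\<bar> \<le> (B + b) * mdist m x y"
    if "x\<in>mspace m" "y\<in>mspace m" for x y
    using C[OF that] B(2)[OF that] by (simp add: algebra_simps abs_le_iff)
  have W: "openin (mtopology_of m) W"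
    unfolding openin_mtopology_of_iff
  proof safe
    fix x assume "x \<in> W" then show "x \<in> mspace m" using VX by (auto simp: W_def)
  next
    fix x assume "x \<in> W"
    then have xw: "x \<in> V" "C x - u x > 0" by (auto simp: W_def)
    then obtain r where r: "r > 0" "\<And>y. y \<in> mspace m \<Longrightarrow> mdist m x y < r \<Longrightarrow> y \<in> V"
      using V(1) unfolding openin_mtopology_of_iff by blast
    define s where "s = (C x - u x) / (B + b)"
    have s: "s > 0" "(B + b) * s = C x - u x" using xw B b by (auto simp: s_def)
    have "y \<in> W" if y: "y \<in> mspace m" "mdist m x y < min r s" for y
    proof -
      have "(B + b) * mdist m x y < C x - u x"
        using mult_strict_left_mono[of "mdist m x y" s "B + b"] y B b s by simp
      moreover have "x \<in> mspace m" using xw VX by auto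
      ultimately have "C y - u y > 0" using near[of x y] y by linarith
      then show ?thesis using r(2) y by (auto simp: W_def)
    qed
    then show "\<exists>r>0. \<forall>y\<in>mspace m. mdist m x y < r \<longrightarrow> y \<in> W"
      using r s by (intro exI[of _ "min r s"]) auto
  qed
  have WV: "W \<subseteq> mspace m - Y" using V by (auto simp: W_def)
  have eq: "u y = C y" if "y \<in> mtopology_of m frontier_of W" for y
  proof (rule antisym)
    have y: "y \<in> mspace m" "y \<notin> W" "\<And>r. r > 0 \<Longrightarrow> \<exists>x\<in>W. mdist m y x < r"
      using that frontier_of_openin_iff[OF W] by auto
    show "u y \<le> C y"
    proof (rule field_le_epsilon)
      fix e :: real assume "e > 0"
      then have "e / (B + b) > 0" using B b by simp
      then obtain x where x: "x \<in> W" "mdist m y x < e / (B + b)" using y(3) by blast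
      have "(B + b) * mdist m y x \<le> (B + b) * (e / (B + b))"
        using x(2) B b by (intro mult_left_mono) auto
      also have "\<dots> = e" using B b by auto
      finally have "(B + b) * mdist m y x \<le> e" .
      moreover have "C x - u x > 0" "x \<in> mspace m" using x VX by (auto simp: W_def)
      ultimately show "u y \<le> C y + e" using near[of y x] y(1) by linarith
    qed
    show "C y \<le> u y"
    proof (cases "y \<in> V")
      case True then show ?thesis using y by (auto simp: W_def)
    next
      case False
      then have "y \<in> mtopology_of m frontier_of V"
        using y unfolding frontier_of_openin_iff[OF V(1)] by (auto simp: W_def)
      then show ?thesis using front by (simp add: C_def)
    qed
  qed
  have F: "mtopology_of m frontier_of W \<subseteq> mspace m"
    using frontier_of_subset_topspace by fastforce
  have xW: "x \<in> W" "x \<in> mspace m" using neg x VX by (auto simp: W_def C_def)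
  have "mdist m z z = 0" using z by simp
  from z(2) have zW: "z \<notin> W" by (auto simp: W_def C_def \<open>mdist m z z = 0\<close>)
  obtain g where g: "g 0 = x" "g 1 = z" "\<And>s. s \<in> {0..1} \<Longrightarrow> g s \<in> mspace m"
    "\<And>s t. s \<in> {0..1} \<Longrightarrow> t \<in> {0..1} \<Longrightarrow> mdist m (g s) (g t) = \<bar>s - t\<bar> * mdist m x z"
    using geodesicE[OF geo xW(2) z(1)] by blast
  obtain \<tau> where \<tau>: "0 < \<tau>" "\<tau> \<le> 1" "g \<tau> \<in> mtopology_of m frontier_of W"
    by (rule first_exit[OF W, of 0 1 "mdist m x z" g]) (use g xW zW in \<open>auto simp: mult.commute\<close>)
  have "\<bar>u (g \<tau>) - u x\<bar> \<le> b * mdist m x (g \<tau>)"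
  proof (rule absolutely_minimal_slope_le[OF am W WV b _ xW(1) \<tau>(3)])
    fix x y assume "x \<in> mtopology_of m frontier_of W" "y \<in> mtopology_of m frontier_of W"
    then show "\<bar>u y - u x\<bar> \<le> b * mdist m x y"
      using C[of y x] F eq mdist_commute[of m x y] by auto
  qed
  moreover have "C (g \<tau>) - C x = b * mdist m x (g \<tau>)"
  proof -
    have 1: "mdist m x (g \<tau>) = \<tau> * mdist m x z"
      using g(4)[of 0 \<tau>] g(1) \<tau> by simp
    have 2: "mdist m z (g \<tau>) = (1 - \<tau>) * mdist m x z"
      using g(4)[of 1 \<tau>] g(2) \<tau> by simp
    have 3: "mdist m z x = mdist m x z" by (rule mdist_commute)
    show ?thesis unfolding C_def 1 2 3 by (simp add: algebra_simps)
  qed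
  moreover have "u x < C x" using xW by (simp add: W_def)
  ultimately show False using eq[OF \<tau>(3)] by linarith
qed

lemma absolutely_minimal_cone_above:
  assumes geo: "geodesic_metric m" and am: "absolutely_minimal m Y u"
    and V: "openin (mtopology_of m) V" "V \<subseteq> mspace m - Y"
    and b: "0 \<le> b" and z: "z \<in> mspace m" "u z \<le> a"
    and front: "\<And>y. y \<in> mtopology_of m frontier_of V \<Longrightarrow> u y \<le> a + b * mdist m z y"
    and x: "x \<in> V"
  shows "u x \<le> a + b * mdist m z x"
proof -
  have am': "absolutely_minimal m Y (\<lambda>x. - u x)"
    using absolutely_minimal_affine[OF am, of "-1" 0] by simp
  have "- a - b * mdist m z x \<le> - u x"
    by (rule absolutely_minimal_cone_below[OF geo am' V b z(1) _ _ x]) (use z front in force)+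
  then show ?thesis by simp
qed

section \<open>A slope criterion for absolute minimality\<close>

text \<open>Slope bounds just to the right of every time add up to a bound for the whole piece. The
  hypothesis stops short of \<tau>, where the segment may already touch a frontier; continuity, from
  the crude constant \<open>B\<close>, covers the endpoint.\<close>

lemma segment_local_slope_le:
  assumes path: "\<And>s. s \<in> {0..1} \<Longrightarrow> g s \<in> mspace m"
    "\<And>s t. s \<in> {0..1} \<Longrightarrow> t \<in> {0..1} \<Longrightarrow> mdist m (g s) (g t) = \<bar>s - t\<bar> * D"
    and D: "0 \<le> D" and L: "0 \<le> L" and B: "0 \<le> B"
    and lip: "\<And>x y. x \<in> mspace m \<Longrightarrow> y \<in> mspace m \<Longrightarrow> \<bar>v x - v y\<bar> \<le> B * mdist m x y"
    and loc: "\<And>t e. 0 \<le> t \<Longrightarrow> t < \<tau> \<Longrightarrow> 0 < e \<Longrightarrow> \<exists>r>0. \<forall>y\<in>mspace m. mdist m (g t) y < r \<longrightarrow>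
       \<bar>v y - v (g t)\<bar> \<le> (L + e) * mdist m (g t) y"
    and \<tau>: "0 \<le> \<tau>" "\<tau> \<le> 1"
  shows "\<bar>v (g \<tau>) - v (g 0)\<bar> \<le> L * (\<tau> * D)"
proof -
  have main: "\<bar>v (g \<tau>) - v (g 0)\<bar> \<le> ((L + e) * D) * \<tau>" if e: "e > 0" for e
  proof -
    have "((L + e) * D)-lipschitz_on {0..\<tau>} (\<lambda>t. v (g t))"
    proof (rule locally_lipschitz_imp_lipschitz)
      have "(B * D)-lipschitz_on {0..\<tau>} (\<lambda>t. v (g t))"
      proof (rule lipschitz_onI)
        fix s t assume st: "s \<in> {0..\<tau>}" "t \<in> {0..\<tau>}"
        then have "\<bar>v (g s) - v (g t)\<bar> \<le> B * mdist m (g s) (g t)"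
          using \<tau> by (intro lip path) auto
        also have "\<dots> = (B * D) * \<bar>s - t\<bar>" using st \<tau> by (simp add: path)
        finally show "dist (v (g s)) (v (g t)) \<le> B * D * dist s t" by (simp add: dist_real_def)
      qed (use B D in simp)
      then show "continuous_on {0..\<tau>} (\<lambda>t. v (g t))" by (rule lipschitz_on_continuous_on)
    next
      fix x y assume xy: "x \<in> {0..<\<tau>}" "x < y"
      then obtain r where r: "r > 0" "\<And>y. y\<in>mspace m \<Longrightarrow> mdist m (g x) y < r \<Longrightarrow>
         \<bar>v y - v (g x)\<bar> \<le> (L + e) * mdist m (g x) y"
        using loc[of x e] e by auto
      define q where "q = r / (D + 1) / 2"
      have p: "q > 0" using r D by (simp add: q_def)
      define z where "z = min (min y \<tau>) (x + q)"
      have z: "x < z" "z \<le> y" "z \<le> \<tau>" "z - x \<le> q"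
        using xy p by (auto simp: z_def)
      have d: "mdist m (g x) (g z) = (z - x) * D" using path(2)[of x z] xy z \<tau> by auto
      have "(z - x) * D \<le> q * (D + 1)" using z D p by (intro mult_mono) auto
      also have "\<dots> = r / 2" using D by (auto simp: q_def field_simps)
      also have "\<dots> < r" using r by simp
      finally have "\<bar>v (g z) - v (g x)\<bar> \<le> (L + e) * mdist m (g x) (g z)"
        using r(2)[of "g z"] path(1)[of z] d xy z \<tau> by auto
      then show "\<exists>z\<in>{x<..y}. dist (v (g z)) (v (g x)) \<le> (L + e) * D * (z - x)"
        using z d by (intro bexI[of _ z]) (auto simp: dist_real_def mult_ac)
    qed (use L D e in simp)
    from lipschitz_onD[OF this, of \<tau> 0] \<tau> show ?thesis by (simp add: dist_real_def)
  qed
  show ?thesis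
  proof (rule field_le_epsilon)
    fix e :: real assume "e > 0"
    then have "\<bar>v (g \<tau>) - v (g 0)\<bar> \<le> ((L + e / (D + 1)) * D) * \<tau>" using D by (intro main) simp
    also have "\<dots> = L * (\<tau> * D) + e * ((D / (D + 1)) * \<tau>)" by (simp add: algebra_simps)
    also have "\<dots> \<le> L * (\<tau> * D) + e * (1 * 1)"
      using \<tau> D \<open>e > 0\<close> by (intro add_left_mono mult_left_mono mult_mono) auto
    finally show "\<bar>v (g \<tau>) - v (g 0)\<bar> \<le> L * (\<tau> * D) + e" by simp
  qed
qed

text \<open>
  The hypothesis \<open>chord\<close> is what following the gradient line through \<open>x\<close> in both directions
  provides, when the slope does not decrease along the ascent nor along the descent.
\<close>

theorem absolutely_minimal_slopeI:
  assumes geo: "geodesic_metric m"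
    and lip: "Lipschitz_continuous_map m euclidean_metric v"
    and loc: "\<And>x e. x \<in> mspace m - Y \<Longrightarrow> 0 < e \<Longrightarrow> \<exists>r>0. \<forall>y\<in>mspace m. mdist m x y < r \<longrightarrow>
       \<bar>v y - v x\<bar> \<le> (\<rho> x + e) * mdist m x y"
    and chord: "\<And>U x. openin (mtopology_of m) U \<Longrightarrow> U \<subseteq> mspace m - Y \<Longrightarrow> x \<in> U \<Longrightarrow>
       \<exists>a\<in>mtopology_of m frontier_of U. \<exists>b\<in>mtopology_of m frontier_of U.
         a \<noteq> b \<and> \<rho> x * mdist m a b \<le> v b - v a"
  shows "absolutely_minimal m Y v"
  unfolding absolutely_minimal_def
proof (intro conjI allI impI lip)
  fix U assume "openin (mtopology_of m) U \<and> U \<subseteq> mspace m - Y"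
  then have U: "openin (mtopology_of m) U" "U \<subseteq> mspace m - Y" and UX: "U \<subseteq> mspace m" by auto
  define F where "F = mtopology_of m frontier_of U"
  have F: "F \<subseteq> mspace m" unfolding F_def using frontier_of_subset_topspace by fastforce
  obtain B where B: "B > 0" "\<And>x y. x\<in>mspace m \<Longrightarrow> y\<in>mspace m \<Longrightarrow> \<bar>v x - v y\<bar> \<le> B * mdist m x y"
    using lip unfolding Lipschitz_real_iff by blast
  have finite: "Lip_const m W v \<le> ennreal B" if "W \<subseteq> mspace m" for W
    using Lip_const_le_iff[OF that, of B v] B that by (simp add: abs_minus_commute subset_iff)
  have "\<exists>L\<ge>0. Lip_const m W v = ennreal L" if "W \<subseteq> mspace m" for W
  proof -
    have "Lip_const m W v < top" using finite[OF that] ennreal_less_top le_less_trans by blast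
    then show ?thesis using enn2real_nonneg ennreal_enn2real by metis
  qed
  then obtain K L where KL: "0 \<le> K" "Lip_const m U v = ennreal K" "0 \<le> L" "Lip_const m F v = ennreal L"
    using UX F by metis
  have K: "\<bar>v y - v x\<bar> \<le> K * mdist m x y" if "x \<in> U" "y \<in> U" for x y
    using Lip_const_le_iff[OF UX KL(1), of v] KL that by simp
  have L: "\<bar>v y - v x\<bar> \<le> L * mdist m x y" if "x \<in> F" "y \<in> F" for x y
    using Lip_const_le_iff[OF F KL(3), of v] KL that by simp
  \<comment> \<open>Frontier points are limits of points of U, so this half holds for every
    Lipschitz function.\<close>
  have "Lip_const m F v \<le> ennreal K"
    unfolding Lip_const_le_iff[OF F KL(1)]
  proof (intro ballI)
    fix x y assume xy: "x \<in> F" "y \<in> F"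
    show "\<bar>v y - v x\<bar> \<le> K * mdist m x y"
    proof (rule field_le_epsilon)
      fix e :: real assume "e > 0"
      define r where "r = e / (2 * (B + K))"
      have r: "r > 0" "2 * (B + K) * r = e" using \<open>e > 0\<close> B KL by (auto simp: r_def)
      obtain x' y' where x': "x' \<in> U" "mdist m x x' < r" and y': "y' \<in> U" "mdist m y y' < r"
        using xy r unfolding F_def frontier_of_openin_iff[OF U(1)] by blast
      have in_m: "x \<in> mspace m" "y \<in> mspace m" "x' \<in> mspace m" "y' \<in> mspace m"
        using xy x' y' F UX by auto
      have "\<bar>v y - v x\<bar> \<le> \<bar>v y - v y'\<bar> + \<bar>v y' - v x'\<bar> + \<bar>v x - v x'\<bar>" by simp
      also have "\<dots> \<le> B * mdist m y y' + K * mdist m x' y' + B * mdist m x x'"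
        using in_m x' y' by (intro add_mono B K) auto
      also have "\<dots> \<le> B * r + K * (mdist m x y + 2 * r) + B * r"
      proof (intro add_mono mult_left_mono)
        show "mdist m x' y' \<le> mdist m x y + 2 * r"
          using mdist_triangle[of x' m x y'] mdist_triangle[of x m y y'] mdist_commute[of m x' x] in_m x' y'
          by linarith
      qed (use x' y' B KL in auto)
      also have "\<dots> = K * mdist m x y + 2 * (B + K) * r" by (simp add: algebra_simps)
      finally show "\<bar>v y - v x\<bar> \<le> K * mdist m x y + e" using r by simp
    qed
  qed
  moreover have "Lip_const m U v \<le> ennreal L"
    unfolding Lip_const_le_iff[OF UX KL(3)]
  proof (intro ballI)
    \<comment> \<open>The chord joins two frontier points, so its slope is at most
      \<open>L\<close>.\<close>
    have \<rho>: "\<rho> x \<le> L" if x: "x \<in> U" for x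
    proof -
      obtain a b where ab: "a \<in> F" "b \<in> F" "a \<noteq> b" "\<rho> x * mdist m a b \<le> v b - v a"
        using chord[OF U x] unfolding F_def by blast
      have "mdist m a b > 0"
        using ab F mdist_zero[of a m b] mdist_nonneg[of m a b] by (metis less_eq_real_def subsetD)
      moreover have "\<rho> x * mdist m a b \<le> L * mdist m a b" using ab(4) L[OF ab(1,2)] by linarith
      ultimately show ?thesis by simp
    qed
    have loc': "\<exists>r>0. \<forall>y\<in>mspace m. mdist m x y < r \<longrightarrow> \<bar>v y - v x\<bar> \<le> (L + e) * mdist m x y"
      if x: "x \<in> U" and e: "e > 0" for x e
    proof -
      obtain r where r: "r > 0" "\<forall>y\<in>mspace m. mdist m x y < r \<longrightarrow> \<bar>v y - v x\<bar> \<le> (\<rho> x + e) * mdist m x y"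
        using loc[of x e] x U e by blast
      have "(\<rho> x + e) * d \<le> (L + e) * d" if "0 \<le> d" for d
        using \<rho>[OF x] that by (intro mult_right_mono) auto
      then show ?thesis using r by (meson mdist_nonneg order.trans)
    qed
    fix x y assume xy: "x \<in> U" "y \<in> U"
    then have xym: "x \<in> mspace m" "y \<in> mspace m" using UX by auto
    define D where "D = mdist m x y"
    obtain g where g: "g 0 = x" "g 1 = y" "\<And>s. s \<in> {0..1} \<Longrightarrow> g s \<in> mspace m"
      "\<And>s t. s \<in> {0..1} \<Longrightarrow> t \<in> {0..1} \<Longrightarrow> mdist m (g s) (g t) = \<bar>s - t\<bar> * D"
      using geodesicE[OF geo xym] unfolding D_def by metis
    define h where "h s = g (1 - s)" for s
    have h: "h 0 = y" "h 1 = x" "\<And>s. s \<in> {0..1} \<Longrightarrow> h s \<in> mspace m"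
      "\<And>s t. s \<in> {0..1} \<Longrightarrow> t \<in> {0..1} \<Longrightarrow> mdist m (h s) (h t) = \<bar>s - t\<bar> * D"
      using g by (auto simp: h_def abs_minus_commute)
    have D: "D \<ge> 0" by (simp add: D_def)
    have Bn: "0 \<le> B" using B by simp
    have slope: "\<bar>v (k \<tau>) - v (k 0)\<bar> \<le> L * (\<tau> * D)"
      if "\<And>s. s \<in> {0..1} \<Longrightarrow> k s \<in> mspace m"
        "\<And>s t. s \<in> {0..1} \<Longrightarrow> t \<in> {0..1} \<Longrightarrow> mdist m (k s) (k t) = \<bar>s - t\<bar> * D"
        "\<And>t. 0 \<le> t \<Longrightarrow> t < \<tau> \<Longrightarrow> k t \<in> U" "0 \<le> \<tau>" "\<tau> \<le> 1" for k \<tau>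
      by (rule segment_local_slope_le[OF that(1,2) D KL(3) Bn B(2) loc'[OF that(3)] that(4,5)])
    show "\<bar>v y - v x\<bar> \<le> L * mdist m x y"
    proof (cases "\<forall>t\<in>{0..1}. g t \<in> U")
      case True
      have "\<bar>v (g 1) - v (g 0)\<bar> \<le> L * (1 * D)" by (rule slope[OF g(3,4)]) (use True in auto)
      then show ?thesis using g by (simp add: D_def)
    next
      case False
      \<comment> \<open>The segment is cut at its first exit from either end, \<open>h\<close> being
        \<open>g\<close> reversed. The outer pieces run in U, where the local slope is at most
        \<open>L\<close>; the middle piece joins two frontier points.\<close>
      then obtain s where s: "s \<in> {0..1}" "g s \<notin> U" by blast
      obtain \<tau> where \<tau>: "0 < \<tau>" "\<tau> \<le> s" "g \<tau> \<in> F" "\<And>t. 0 \<le> t \<Longrightarrow> t < \<tau> \<Longrightarrow> g t \<in> U"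
        unfolding F_def
        by (rule first_exit[OF U(1), of 0 s D g]) (use s D xy g in \<open>auto simp: mult.commute\<close>)
      obtain \<sigma> where \<sigma>: "0 < \<sigma>" "\<sigma> \<le> 1 - s" "h \<sigma> \<in> F" "\<And>t. 0 \<le> t \<Longrightarrow> t < \<sigma> \<Longrightarrow> h t \<in> U"
        unfolding F_def
        by (rule first_exit[OF U(1), of 0 "1 - s" D h])
          (use s D xy h in \<open>auto simp: mult.commute h_def[of "1 - s"]\<close>)
      have "\<bar>v (g \<tau>) - v (g 0)\<bar> \<le> L * (\<tau> * D)" by (rule slope[OF g(3,4) \<tau>(4)]) (use \<tau> s in auto)
      moreover have "\<bar>v (h \<sigma>) - v (h 0)\<bar> \<le> L * (\<sigma> * D)" by (rule slope[OF h(3,4) \<sigma>(4)]) (use \<sigma> s in auto)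
      moreover have "\<bar>v (h \<sigma>) - v (g \<tau>)\<bar> \<le> L * ((1 - \<sigma> - \<tau>) * D)"
      proof -
        have "mdist m (g \<tau>) (h \<sigma>) = (1 - \<sigma> - \<tau>) * D"
          unfolding h_def using g(4)[of \<tau> "1 - \<sigma>"] \<tau> \<sigma> s by auto
        then show ?thesis using L[OF \<tau>(3) \<sigma>(3)] by simp
      qed
      ultimately have "\<bar>v y - v x\<bar> \<le> L * (\<tau> * D) + L * (\<sigma> * D) + L * ((1 - \<sigma> - \<tau>) * D)"
        unfolding g(1) h(1) by linarith
      also have "\<dots> = L * D" by (simp add: algebra_simps)
      finally show ?thesis by (simp add: D_def)
    qed
  qed
  ultimately show "Lip_const m U v = Lip_const m (mtopology_of m frontier_of U) v"
    using KL unfolding F_def by auto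
qed


section \<open>Finite differences and the comparison principle\<close>

text \<open>The supremum need not be attained, hence the approximating points below. It turns
  comparison with cones into an inequality between the radii 0, e and 2 e.\<close>

definition sup_cball :: "'a metric \<Rightarrow> ('a \<Rightarrow> real) \<Rightarrow> real \<Rightarrow> 'a \<Rightarrow> real" where
  "sup_cball m f e x = (SUP y\<in>{y \<in> mspace m. mdist m x y \<le> e}. f y)"

context
  fixes m :: "'a metric" and f :: "'a \<Rightarrow> real" and B :: real
  assumes bound: "\<And>x. x \<in> mspace m \<Longrightarrow> \<bar>f x\<bar> \<le> B"
begin

lemma sup_cball_upper: "y \<in> mspace m \<Longrightarrow> mdist m x y \<le> e \<Longrightarrow> f y \<le> sup_cball m f e x"
  unfolding sup_cball_def using bound by (intro cSUP_upper bdd_aboveI2[of _ _ B]) (auto simp: abs_le_iff)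

lemma sup_cball_least:
  assumes "x \<in> mspace m" "0 \<le> e" "\<And>y. y \<in> mspace m \<Longrightarrow> mdist m x y \<le> e \<Longrightarrow> f y \<le> c"
  shows "sup_cball m f e x \<le> c"
proof -
  have "mdist m x x = 0" using assms(1) by simp
  then have "x \<in> {y \<in> mspace m. mdist m x y \<le> e}" using assms(1,2) by (simp del: mdist_zero)
  then show ?thesis unfolding sup_cball_def using assms(3) by (intro cSUP_least) auto
qed

lemma sup_cball_approx:
  assumes "x \<in> mspace m" "0 \<le> e" "c < sup_cball m f e x"
  obtains y where "y \<in> mspace m" "mdist m x y \<le> e" "c < f y"
  using sup_cball_least[OF assms(1,2), of c] assms(3) that by force

end

lemma geodesic_midpoint:
  assumes "geodesic_metric m" "x \<in> mspace m" "z \<in> mspace m" "mdist m x z \<le> 2 * e"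
  obtains y where "y \<in> mspace m" "mdist m x y \<le> e" "mdist m y z \<le> e"
proof -
  obtain g where g: "g 0 = x" "g 1 = z" "\<And>s. s \<in> {0..1} \<Longrightarrow> g s \<in> mspace m"
    "\<And>s t. s \<in> {0..1} \<Longrightarrow> t \<in> {0..1} \<Longrightarrow> mdist m (g s) (g t) = \<bar>s - t\<bar> * mdist m x z"
    using geodesicE[OF assms(1-3)] by blast
  show thesis
    using that[of "g (1/2)"] g(3)[of "1/2"] g(4)[of 0 "1/2"] g(4)[of "1/2" 1] g(1,2) assms(4) by simp
qed

text \<open>Comparison with the cone of vertex \<open>x\<close> that dominates \<open>w\<close> at distance \<open>2 e\<close>.\<close>

lemma absolutely_minimal_sup_cball:
  assumes geo: "geodesic_metric m" and am: "absolutely_minimal m Y w"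
    and bound: "\<And>x. x \<in> mspace m \<Longrightarrow> \<bar>w x\<bar> \<le> B"
    and x: "x \<in> mspace m" and e: "0 < e"
    and sub: "\<And>y. y \<in> mspace m \<Longrightarrow> mdist m x y \<le> 2 * e \<Longrightarrow> y \<notin> Y"
  shows "2 * sup_cball m w e x \<le> w x + sup_cball m w (2 * e) x"
proof -
  define S where "S = sup_cball m w (2 * e) x"
  have up: "w y \<le> S" if "y \<in> mspace m" "mdist m x y \<le> 2 * e" for y
    unfolding S_def using sup_cball_upper[of m w B] bound that by blast
  have x0: "mdist m x x = 0" using x by simp
  have Sx: "w x \<le> S" using up[OF x] x0 e by simp
  define b where "b = (S - w x) / (2 * e)"
  have b: "0 \<le> b" "b * (2 * e) = S - w x" using Sx e by (auto simp: b_def)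
  define V where "V = {y \<in> mspace m. mdist m x y < 2 * e}"
  have "V = mball_of m x (2 * e)" using x by (auto simp: V_def)
  then have V: "openin (mtopology_of m) V" by (simp add: openin_mball_of)
  have VY: "V \<subseteq> mspace m - Y" using sub by (auto simp: V_def)
  have front: "w y \<le> w x + b * mdist m x y" if "y \<in> mtopology_of m frontier_of V" for y
  proof -
    have y: "y \<in> mspace m" "y \<notin> V" using that frontier_of_openin_iff[OF V] by auto
    have "mdist m x y \<le> 2 * e" by (rule frontier_dist_le[OF V x _ that]) (simp add: V_def)
    then have "mdist m x y = 2 * e" using y by (simp add: V_def)
    then show ?thesis using b up[OF y(1)] by simp
  qed
  \<comment> \<open>At distance e the cone is the average of \<open>w x\<close> and the supremum
    over radius 2 e.\<close>
  have "sup_cball m w e x \<le> w x + b * e"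
  proof (rule sup_cball_least[of m w B, OF bound x])
    fix y assume y: "y \<in> mspace m" "mdist m x y \<le> e"
    have "w y \<le> w x + b * mdist m x y"
      by (rule absolutely_minimal_cone_above[OF geo am V VY b(1) x order_refl front])
        (use y e in \<open>auto simp: V_def\<close>)
    also have "\<dots> \<le> w x + b * e" using y b by (intro add_left_mono mult_left_mono) auto
    finally show "w y \<le> w x + b * e" .
  qed (use e in auto)
  then show ?thesis using b(2) unfolding S_def by linarith
qed

text \<open>The convexity defect of \<psi> at a midpoint, which measures the strictness gained by
  composing with it.\<close>

lemma quadratic_midpoint:
  fixes a b k :: real
  defines "\<psi> \<equiv> \<lambda>s. s + k * s\<^sup>2"
  shows "\<psi> a + \<psi> b - 2 * \<psi> ((a + b) / 2) = k / 2 * (b - a)\<^sup>2"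
  unfolding \<psi>_def by (simp add: power2_eq_square field_simps)

text \<open>
  Composing \<open>v\<close> with the strictly convex \<open>\<psi>\<close> makes its discrete subsolution inequality strict, which
  a near-maximiser of \<open>\<psi> \<circ> sup_cball v + sup_cball w\<close> contradicts.
\<close>

lemma absolutely_minimal_comparison_aux:
  assumes geo: "geodesic_metric m" and v: "absolutely_minimal m Y v" and w: "absolutely_minimal m Y w"
    and D: "openin (mtopology_of m) D" "D \<subseteq> mspace m - Y"
    and bound: "\<And>x. x \<in> mspace m \<Longrightarrow> \<bar>v x\<bar> \<le> B" "\<And>x. x \<in> mspace m \<Longrightarrow> \<bar>w x\<bar> \<le> B"
    and front: "\<And>y. y \<in> mtopology_of m frontier_of D \<Longrightarrow> v y + w y \<le> 0"
    and \<kappa>: "0 < \<kappa>"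
    and growth: "\<And>x e. x \<in> D \<Longrightarrow> 0 < e \<Longrightarrow> (\<And>y. y \<in> mspace m \<Longrightarrow> mdist m x y \<le> e \<Longrightarrow> y \<in> D) \<Longrightarrow>
       \<exists>y\<in>mspace m. mdist m x y \<le> e \<and> v x + \<kappa> * e \<le> v y"
    and x1: "x1 \<in> D"
  shows "v x1 + w x1 \<le> 0"
proof (rule ccontr)
  define \<gamma> where "\<gamma> = v x1 + w x1"
  assume "\<not> ?thesis"
  then have \<gamma>: "\<gamma> > 0" by (simp add: \<gamma>_def)
  have DM: "D \<subseteq> mspace m" using D by auto
  then have x1m: "x1 \<in> mspace m" using x1 by auto
  have B: "0 \<le> B" using bound(1)[OF x1m] by linarith
  obtain Lv where Lv: "Lv > 0" "\<And>x y. x\<in>mspace m \<Longrightarrow> y\<in>mspace m \<Longrightarrow> \<bar>v x - v y\<bar> \<le> Lv * mdist m x y"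
    using v unfolding absolutely_minimal_def Lipschitz_real_iff by blast
  obtain Lw where Lw: "Lw > 0" "\<And>x y. x\<in>mspace m \<Longrightarrow> y\<in>mspace m \<Longrightarrow> \<bar>w x - w y\<bar> \<le> Lw * mdist m x y"
    using w unfolding absolutely_minimal_def Lipschitz_real_iff by blast
  \<comment> \<open>The first bound keeps the slope of \<psi> between 1/2 and 3/2 on the range of v,
    the second keeps \<psi> within \<gamma>/4 of the identity there. The summands 1 avoid division
    by 0.\<close>
  define k where "k = min (1 / (4 * (B + 1))) (\<gamma> / (4 * (B\<^sup>2 + 1)))"
  have B2: "B\<^sup>2 + 1 > 0" by (simp add: add_nonneg_pos)
  have k: "k > 0" using B B2 \<gamma> by (simp add: k_def)
  have "k * (4 * (B + 1)) \<le> 1 / (4 * (B + 1)) * (4 * (B + 1))"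
    using B by (intro mult_right_mono) (auto simp: k_def)
  then have k1: "4 * (k * B) \<le> 1" using B k by (simp add: algebra_simps)
  have "k * (4 * (B\<^sup>2 + 1)) \<le> \<gamma> / (4 * (B\<^sup>2 + 1)) * (4 * (B\<^sup>2 + 1))"
    using B2 by (intro mult_right_mono) (auto simp: k_def)
  then have "k * (4 * (B\<^sup>2 + 1)) \<le> \<gamma>" using B2 by simp
  then have k2: "4 * (k * B\<^sup>2) \<le> \<gamma>" using k by (simp add: algebra_simps)
  define \<psi> where "\<psi> s = s + k * s\<^sup>2" for s
  have \<psi>_diff: "\<psi> b - \<psi> a = (b - a) * (1 + k * (a + b))" for a b
    by (simp add: \<psi>_def power2_eq_square algebra_simps)
  have \<psi>_factor: "\<bar>k * (a + b)\<bar> \<le> 1 / 2" if "\<bar>a\<bar> \<le> B" "\<bar>b\<bar> \<le> B" for a b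
  proof -
    have "\<bar>k * (a + b)\<bar> \<le> k * (2 * B)" using k that by (simp add: abs_mult)
    then show ?thesis using k1 by simp
  qed
  have \<psi>_mono: "\<psi> a \<le> \<psi> b" if "a \<le> b" "\<bar>a\<bar> \<le> B" "\<bar>b\<bar> \<le> B" for a b
    using \<psi>_diff[of b a] \<psi>_factor[OF that(2,3)] that(1) mult_nonneg_nonneg[of "b - a" "1 + k * (a + b)"]
    by linarith
  have \<psi>_lip: "\<psi> b \<le> \<psi> a + 2 * (b - a)" if "a \<le> b" "\<bar>a\<bar> \<le> B" "\<bar>b\<bar> \<le> B" for a b
    using \<psi>_diff[of b a] \<psi>_factor[OF that(2,3)] that(1) mult_left_mono[of "1 + k * (a + b)" 2 "b - a"]
    by linarith
  have \<psi>_ge: "s \<le> \<psi> s" for s using k by (simp add: \<psi>_def)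
  have \<psi>_le: "\<psi> s \<le> s + k * B\<^sup>2" if "\<bar>s\<bar> \<le> B" for s
    using k that B by (simp add: \<psi>_def abs_le_square_iff[symmetric])
  obtain r1 where r1: "r1 > 0" "\<And>y. y \<in> mspace m \<Longrightarrow> mdist m x1 y < r1 \<Longrightarrow> y \<in> D"
    using D x1 unfolding openin_mtopology_of_iff by blast
  \<comment> \<open>The closed ball of radius e about \<open>x1\<close> stays in D, and over a
    distance 3 e the variations of v and w add up to at most \<gamma>/8.\<close>
  define e where "e = min (r1 / 2) (\<gamma> / (24 * (Lv + Lw)))"
  have e: "e > 0" "e < r1" using r1 \<gamma> Lv Lw by (auto simp: e_def)
  have "(24 * (Lv + Lw)) * e \<le> 24 * (Lv + Lw) * (\<gamma> / (24 * (Lv + Lw)))"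
    using Lv Lw by (intro mult_left_mono) (auto simp: e_def)
  also have "\<dots> = \<gamma>" using Lv(1) Lw(1) by simp
  finally have e2: "Lv * (3 * e) + Lw * (3 * e) \<le> \<gamma> / 8" by (simp add: algebra_simps)
  define vE where "vE = sup_cball m v e"
  define wE where "wE = sup_cball m w e"
  note v_up = sup_cball_upper[of m v B, OF bound(1)] and v_least = sup_cball_least[of m v B, OF bound(1)]
  note w_up = sup_cball_upper[of m w B, OF bound(2)] and w_least = sup_cball_least[of m w B, OF bound(2)]
  have refl: "mdist m x x \<le> e" if "x \<in> mspace m" for x
    using that e mdist_zero[OF that that] by (simp del: mdist_zero)
  have vE_ge: "v x \<le> vE x" and wE_ge: "w x \<le> wE x" if "x \<in> mspace m" for x
    unfolding vE_def wE_def using v_up w_up refl that by blast+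
  have vE_B: "\<bar>vE x\<bar> \<le> B" if "x \<in> mspace m" for x
  proof -
    have "vE x \<le> B" unfolding vE_def using bound(1) that e by (intro v_least) (auto simp: abs_le_iff)
    then show ?thesis using vE_ge[OF that] bound(1)[OF that] by linarith
  qed
  have wE_B: "wE x \<le> B" if "x \<in> mspace m" for x
    unfolding wE_def using bound(2) that e by (intro w_least) (auto simp: abs_le_iff)
  define K where "K = {x \<in> D. \<forall>y\<in>mspace m. mdist m x y \<le> e \<longrightarrow> y \<in> D}"
  define \<Phi> where "\<Phi> x = \<psi> (vE x) + wE x" for x
  have KM: "K \<subseteq> mspace m" using DM by (auto simp: K_def)
  have x1K: "x1 \<in> K" using x1 r1 e by (auto simp: K_def)
  define \<sigma> where "\<sigma> = (SUP x\<in>K. \<Phi> x)"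
  have "\<Phi> x \<le> 2 * B + k * B\<^sup>2" if "x \<in> K" for x
    using \<psi>_le[of "vE x"] vE_B[of x] wE_B[of x] that KM unfolding \<Phi>_def by fastforce
  then have \<sigma>: "\<Phi> x \<le> \<sigma>" if "x \<in> K" for x
    unfolding \<sigma>_def using that by (intro cSUP_upper bdd_aboveI2)
  have "\<gamma> \<le> \<Phi> x1"
    using vE_ge[OF x1m] wE_ge[OF x1m] \<psi>_ge[of "vE x1"] by (simp add: \<gamma>_def \<Phi>_def)
  then have \<gamma>\<sigma>: "\<gamma> \<le> \<sigma>" using \<sigma>[OF x1K] by linarith
  \<comment> \<open>Five errors \<theta> accumulate below, three in the step towards a
    near-maximiser of v and two in the one for w, while the convexity gain is at least 2 k
    \<kappa>^2 e^2.\<close>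
  define \<theta> where "\<theta> = min (\<gamma> / 4) (k * \<kappa>\<^sup>2 * e\<^sup>2 / 5)"
  have \<theta>: "\<theta> > 0" "\<theta> \<le> \<gamma> / 4" "5 * \<theta> \<le> k * \<kappa>\<^sup>2 * e\<^sup>2"
    using \<gamma> k \<kappa> e by (auto simp: \<theta>_def)
  obtain x0 where x0: "x0 \<in> K" "\<sigma> - \<theta> < \<Phi> x0"
    using less_cSUP_iff[of K \<Phi> "\<sigma> - \<theta>"] x1K \<sigma> \<theta>(1) unfolding \<sigma>_def
    by (metis bdd_aboveI2 diff_less_eq empty_iff less_add_same_cancel1)
  have x0D: "x0 \<in> D" "x0 \<in> mspace m" using x0 DM by (auto simp: K_def)
  \<comment> \<open>A frontier point within 2 e of \<open>x0\<close> is within 3 e of the whole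
    closed e-ball about \<open>x0\<close>. It would force \<Phi> at \<open>x0\<close> down to
    \<gamma>/8 + \<gamma>/4, while near-maximality gives more than 3 \<gamma>/4.\<close>
  have inner: "y \<in> D" if y: "y \<in> mspace m" "mdist m x0 y \<le> 2 * e" for y
  proof (rule ccontr)
    assume "y \<notin> D"
    obtain g where g: "g 0 = x0" "g 1 = y" "\<And>s. s \<in> {0..1} \<Longrightarrow> g s \<in> mspace m"
      "\<And>s t. s \<in> {0..1} \<Longrightarrow> t \<in> {0..1} \<Longrightarrow> mdist m (g s) (g t) = \<bar>s - t\<bar> * mdist m x0 y"
      using geodesicE[OF geo x0D(2) y(1)] by blast
    obtain \<tau> where \<tau>: "0 < \<tau>" "\<tau> \<le> 1" "g \<tau> \<in> mtopology_of m frontier_of D"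
      by (rule first_exit[OF D(1), of 0 1 "mdist m x0 y" g])
        (use g x0D \<open>y \<notin> D\<close> in \<open>auto simp: mult.commute\<close>)
    define z where "z = g \<tau>"
    have z: "z \<in> mspace m" "v z + w z \<le> 0" using g(3) \<tau> front unfolding z_def by auto
    have "mdist m x0 z = \<tau> * mdist m x0 y" unfolding z_def using g(4)[of 0 \<tau>] g(1) \<tau> by simp
    also have "\<dots> \<le> 1 * (2 * e)" using \<tau> y by (intro mult_mono) auto
    finally have "mdist m z x0 \<le> 2 * e" by (simp add: mdist_commute)
    then have near: "mdist m y z \<le> 3 * e" if "y \<in> mspace m" "mdist m x0 y \<le> e" for y
      using mdist_triangle[of z m x0 y] that z x0D mdist_commute[of m y z] by linarith
    have "vE x0 \<le> v z + Lv * (3 * e)"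
      unfolding vE_def
    proof (rule v_least)
      fix y assume y: "y \<in> mspace m" "mdist m x0 y \<le> e"
      have "v y \<le> v z + Lv * mdist m y z" using Lv(2)[OF y(1) z(1)] by linarith
      then show "v y \<le> v z + Lv * (3 * e)"
        using mult_left_mono[OF near[OF y], of Lv] Lv(1) by linarith
    qed (use x0D e in auto)
    moreover have "wE x0 \<le> w z + Lw * (3 * e)"
      unfolding wE_def
    proof (rule w_least)
      fix y assume y: "y \<in> mspace m" "mdist m x0 y \<le> e"
      have "w y \<le> w z + Lw * mdist m y z" using Lw(2)[OF y(1) z(1)] by linarith
      then show "w y \<le> w z + Lw * (3 * e)"
        using mult_left_mono[OF near[OF y], of Lw] Lw(1) by linarith
    qed (use x0D e in auto)
    ultimately have "\<Phi> x0 \<le> \<gamma> / 8 + k * B\<^sup>2"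
      using \<psi>_le[OF vE_B[OF x0D(2)]] z(2) e2 unfolding \<Phi>_def by linarith
    then show False using x0(2) \<theta>(2) \<gamma>\<sigma> k2 \<gamma> by linarith
  qed
  have near_max: "\<Phi> y < \<Phi> x0 + \<theta>" if y: "y \<in> mspace m" "mdist m x0 y \<le> e" for y
  proof -
    have "z \<in> D" if "z \<in> mspace m" "mdist m y z \<le> e" for z
      using mdist_triangle[of x0 m y z] that y x0D inner[of z] by simp
    then have "y \<in> K" using inner[OF y(1)] y e by (auto simp: K_def)
    then show ?thesis using \<sigma> x0(2) by fastforce
  qed
  have e2pos: "0 \<le> 2 * e" "0 < 2 * e" using e by auto
  define S where "S = sup_cball m v (2 * e) x0"
  define T where "T = sup_cball m w (2 * e) x0"
  have S_B: "\<bar>S\<bar> \<le> B"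
  proof -
    have "S \<le> B" unfolding S_def using bound(1) x0D e by (intro v_least) (auto simp: abs_le_iff)
    moreover have "v x0 \<le> S" unfolding S_def using refl[OF x0D(2)] e x0D by (intro v_up) auto
    ultimately show ?thesis using bound(1)[OF x0D(2)] by linarith
  qed
  have Hv: "2 * vE x0 \<le> v x0 + S"
    unfolding vE_def S_def
    by (rule absolutely_minimal_sup_cball[OF geo v bound(1) x0D(2) e(1)]) (use inner D in auto)
  have Hw: "2 * wE x0 \<le> w x0 + T"
    unfolding wE_def T_def
    by (rule absolutely_minimal_sup_cball[OF geo w bound(2) x0D(2) e(1)]) (use inner D in auto)
  have "S - \<theta> < sup_cball m v (2 * e) x0" using \<theta> by (simp add: S_def)
  then obtain z where z: "z \<in> mspace m" "mdist m x0 z \<le> 2 * e" "S - \<theta> < v z"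
    using sup_cball_approx[of m v B, OF bound(1) x0D(2) e2pos(1)] by blast
  \<comment> \<open>The midpoint y has both z and \<open>x0\<close> within distance e, so its
    suprema dominate \<open>v z\<close> and \<open>w x0\<close> at once.\<close>
  obtain y where y: "y \<in> mspace m" "mdist m x0 y \<le> e" "mdist m y z \<le> e"
    using geodesic_midpoint[OF geo x0D(2) z(1,2)] by blast
  have "T - \<theta> < sup_cball m w (2 * e) x0" using \<theta> by (simp add: T_def)
  then obtain z' where z': "z' \<in> mspace m" "mdist m x0 z' \<le> 2 * e" "T - \<theta> < w z'"
    using sup_cball_approx[of m w B, OF bound(2) x0D(2) e2pos(1)] by blast
  obtain y' where y': "y' \<in> mspace m" "mdist m x0 y' \<le> e" "mdist m y' z' \<le> e"
    using geodesic_midpoint[OF geo x0D(2) z'(1,2)] by blast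
  have up1: "v z \<le> vE y" "w x0 \<le> wE y"
    unfolding vE_def wE_def using y z x0D by (auto intro!: v_up w_up simp: mdist_commute)
  have zS: "v z \<le> S" unfolding S_def using z by (intro v_up)
  have 1: "\<psi> S - 2 * \<theta> + w x0 < \<Phi> x0 + \<theta>"
  proof -
    have "2 * (S - v z) \<le> 2 * \<theta>" using z(3) by (intro mult_left_mono) auto
    then have "\<psi> S - 2 * \<theta> \<le> \<psi> (v z)"
      using \<psi>_lip[OF zS bound(1)[OF z(1)] S_B] by simp
    also have "\<dots> \<le> \<psi> (vE y)" by (rule \<psi>_mono[OF up1(1) bound(1)[OF z(1)] vE_B[OF y(1)]])
    finally have "\<psi> S - 2 * \<theta> + w x0 \<le> \<Phi> y" unfolding \<Phi>_def using up1(2) by linarith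
    then show ?thesis using near_max[OF y(1,2)] by linarith
  qed
  have up2: "w z' \<le> wE y'" "v x0 \<le> vE y'"
    unfolding vE_def wE_def using y' z' x0D by (auto intro!: v_up w_up simp: mdist_commute)
  have 2: "\<psi> (v x0) + T - \<theta> < \<Phi> x0 + \<theta>"
    using near_max[OF y'(1,2)] \<psi>_mono[OF up2(2) bound(1)[OF x0D(2)] vE_B[OF y'(1)]] z'(3) up2(1)
    unfolding \<Phi>_def by linarith
  have 3: "\<psi> (vE x0) \<le> \<psi> ((v x0 + S) / 2)"
    using Hv vE_B[OF x0D(2)] S_B bound(1)[OF x0D(2)] by (intro \<psi>_mono) (auto simp: abs_le_iff)
  have 4: "\<psi> (v x0) + \<psi> S - 2 * \<psi> ((v x0 + S) / 2) = k / 2 * (S - v x0)\<^sup>2"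
    unfolding \<psi>_def by (rule quadratic_midpoint)
  \<comment> \<open>Growth over the radius 2 e bounds the convexity defect from below.\<close>
  obtain y2 where y2: "y2 \<in> mspace m" "mdist m x0 y2 \<le> 2 * e" "v x0 + \<kappa> * (2 * e) \<le> v y2"
    using growth[OF x0D(1) e2pos(2) inner] by blast
  have "v y2 \<le> S" unfolding S_def using y2 by (intro v_up)
  then have "(\<kappa> * (2 * e))\<^sup>2 \<le> (S - v x0)\<^sup>2" using y2 \<kappa> e by (intro power_mono) auto
  then have "k / 2 * (\<kappa> * (2 * e))\<^sup>2 \<le> k / 2 * (S - v x0)\<^sup>2" using k by (intro mult_left_mono) auto
  moreover have "k / 2 * (\<kappa> * (2 * e))\<^sup>2 = 2 * (k * \<kappa>\<^sup>2 * e\<^sup>2)" by (simp add: power2_eq_square)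
  moreover have "0 < k * \<kappa>\<^sup>2 * e\<^sup>2" using k \<kappa> e by simp
  ultimately show False using 1 2 3 4 Hw \<theta>(3) unfolding \<Phi>_def by linarith
qed

text \<open>Taken with w = - u, the growth condition falls on v alone. In the application v is the
  explicit function and u an arbitrary competitor.\<close>

theorem absolutely_minimal_comparison:
  assumes geo: "geodesic_metric m" and u: "absolutely_minimal m Y u" and v: "absolutely_minimal m Y v"
    and D: "openin (mtopology_of m) D" "D \<subseteq> mspace m - Y"
    and bound: "\<And>x. x \<in> mspace m \<Longrightarrow> \<bar>u x\<bar> \<le> B" "\<And>x. x \<in> mspace m \<Longrightarrow> \<bar>v x\<bar> \<le> B"
    and front: "\<And>y. y \<in> mtopology_of m frontier_of D \<Longrightarrow> v y \<le> u y"
    and \<kappa>: "0 < \<kappa>"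
    and growth: "\<And>x e. x \<in> D \<Longrightarrow> 0 < e \<Longrightarrow> (\<And>y. y \<in> mspace m \<Longrightarrow> mdist m x y \<le> e \<Longrightarrow> y \<in> D) \<Longrightarrow>
       \<exists>y\<in>mspace m. mdist m x y \<le> e \<and> v x + \<kappa> * e \<le> v y"
    and x: "x \<in> D"
  shows "v x \<le> u x"
proof -
  have "absolutely_minimal m Y (\<lambda>x. - u x)" using absolutely_minimal_affine[OF u, of "-1" 0] by simp
  then have "v x + - u x \<le> 0"
    by (rule absolutely_minimal_comparison_aux[OF geo v _ D bound(2) _ _ \<kappa> growth x])
      (use bound(1) front in auto)
  then show ?thesis by simp
qed

section \<open>Aronsson's function on the half plane\<close>

text \<open>Half of the half plane, by symmetry: Re is the distance from the boundary line, Im the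
  distance from the axis. The axis is included, the boundary line is not.\<close>

definition quadrant :: "complex set" where
  "quadrant = {z. 0 < Re z \<and> 0 \<le> Im z}"

text \<open>The half-angle tangent of the gradient of the function \<open>aronsson\<close> below.\<close>

definition slope_param :: "complex \<Rightarrow> real" where
  "slope_param z = (THE t. 0 \<le> t \<and> 2 * Re z * t ^ 3 = Im z * (1 + 3 * t\<^sup>2))"

text \<open>This is the monotonicity of t^3 / (1 + 3 t^2) with denominators cleared, which makes the
  slope equation uniquely solvable.\<close>

lemma slope_ratio_strict:
  assumes "0 \<le> s" "s < (t :: real)"
  shows "s ^ 3 * (1 + 3 * t\<^sup>2) < t ^ 3 * (1 + 3 * s\<^sup>2)"
proof -
  have "s ^ 3 < t ^ 3" using assms by (intro power_strict_mono) auto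
  moreover have "s\<^sup>2 * t\<^sup>2 * s \<le> s\<^sup>2 * t\<^sup>2 * t" using assms by (intro mult_left_mono) auto
  ultimately show ?thesis by (simp add: power3_eq_cube power2_eq_square algebra_simps)
qed

text \<open>The equation says that t^3 / (1 + 3 t^2) equals Im z / (2 Re z), and the former
  increases with t. A root t is given explicitly because uniqueness is still to be derived from
  this. The criterion is linear in z, hence an open condition.\<close>

lemma slope_param_less_aux:
  assumes z: "z \<in> quadrant" and t: "0 \<le> t" "2 * Re z * t ^ 3 = Im z * (1 + 3 * t\<^sup>2)" and T: "0 \<le> T"
  shows "t < T \<longleftrightarrow> Im z * (1 + 3 * T\<^sup>2) < 2 * Re z * T ^ 3"
proof -
  have p: "1 + 3 * t\<^sup>2 > 0" "2 * Re z > 0" using z by (auto simp: quadrant_def intro: add_pos_nonneg)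
  have "Im z * (1 + 3 * T\<^sup>2) < 2 * Re z * T ^ 3 \<longleftrightarrow>
      (1 + 3 * t\<^sup>2) * (Im z * (1 + 3 * T\<^sup>2)) < (1 + 3 * t\<^sup>2) * (2 * Re z * T ^ 3)"
    using p by (simp only: mult_less_cancel_left_pos)
  also have "(1 + 3 * t\<^sup>2) * (Im z * (1 + 3 * T\<^sup>2)) = 2 * Re z * (t ^ 3 * (1 + 3 * T\<^sup>2))"
    using t(2) by algebra
  also have "(1 + 3 * t\<^sup>2) * (2 * Re z * T ^ 3) = 2 * Re z * (T ^ 3 * (1 + 3 * t\<^sup>2))"
    by (simp add: mult_ac)
  also have "2 * Re z * (t ^ 3 * (1 + 3 * T\<^sup>2)) < 2 * Re z * (T ^ 3 * (1 + 3 * t\<^sup>2)) \<longleftrightarrow>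
      t ^ 3 * (1 + 3 * T\<^sup>2) < T ^ 3 * (1 + 3 * t\<^sup>2)"
    using p by (simp only: mult_less_cancel_left_pos)
  also have "\<dots> \<longleftrightarrow> t < T"
    using slope_ratio_strict[OF t(1), of T] slope_ratio_strict[OF T, of t] by (cases t T rule: linorder_cases) auto
  finally show ?thesis by blast
qed

lemma slope_param_ex1:
  assumes z: "z \<in> quadrant"
  shows "\<exists>!t. 0 \<le> t \<and> 2 * Re z * t ^ 3 = Im z * (1 + 3 * t\<^sup>2)"
proof -
  define f where "f t = 2 * Re z * t ^ 3 - Im z * (1 + 3 * t\<^sup>2)" for t
  \<comment> \<open>N is at least 1, so 1 + 3 N^2 is at most 4 N^2; with 2 Im z \<le> N Re z this
    makes \<open>f N\<close> nonnegative.\<close>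
  define N where "N = 1 + 2 * Im z / Re z"
  have z': "Re z > 0" "Im z \<ge> 0" using z by (auto simp: quadrant_def)
  have N: "1 \<le> N" "2 * Im z \<le> Re z * N" using z' by (auto simp: N_def field_simps)
  have "Im z * (1 + 3 * N\<^sup>2) \<le> Im z * (4 * N\<^sup>2)"
    using z' N power_mono[of 1 N 2] by (intro mult_left_mono) auto
  also have "\<dots> = 2 * (2 * Im z) * N\<^sup>2" by simp
  also have "\<dots> \<le> 2 * (Re z * N) * N\<^sup>2" by (rule mult_right_mono) (use N(2) in linarith, simp)
  also have "\<dots> = 2 * Re z * N ^ 3" by (simp add: power3_eq_cube power2_eq_square)
  finally have "0 \<le> f N" by (simp add: f_def)
  moreover have "f 0 \<le> 0" using z' by (simp add: f_def)
  moreover have "continuous_on {0..N} f" unfolding f_def by (intro continuous_intros)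
  ultimately obtain t where t: "0 \<le> t" "f t = 0"
    using IVT'[of f 0 0 N] N by auto
  then have t': "2 * Re z * t ^ 3 = Im z * (1 + 3 * t\<^sup>2)" by (simp add: f_def)
  show ?thesis
  proof (rule ex1I[of _ t])
    fix s assume s: "0 \<le> s \<and> 2 * Re z * s ^ 3 = Im z * (1 + 3 * s\<^sup>2)"
    then show "s = t"
      using slope_param_less_aux[OF z t(1) t', of s] slope_param_less_aux[OF z, of s t] t t' by force
  qed (use t t' in blast)
qed

lemma slope_param:
  assumes "z \<in> quadrant"
  shows "0 \<le> slope_param z"
    and "2 * Re z * slope_param z ^ 3 = Im z * (1 + 3 * (slope_param z)\<^sup>2)"
  using theI'[OF slope_param_ex1[OF assms]] unfolding slope_param_def by auto

lemma slope_param_eqI: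
  assumes "z \<in> quadrant" "0 \<le> t" "2 * Re z * t ^ 3 = Im z * (1 + 3 * t\<^sup>2)"
  shows "slope_param z = t"
  using slope_param_ex1[OF assms(1)] slope_param[OF assms(1)] assms(2,3) by blast

lemma slope_param_less_iff:
  assumes "z \<in> quadrant" "0 \<le> T"
  shows "slope_param z < T \<longleftrightarrow> Im z * (1 + 3 * T\<^sup>2) < 2 * Re z * T ^ 3"
  by (rule slope_param_less_aux[OF assms(1) slope_param[OF assms(1)] assms(2)])

section \<open>The envelope of linear forms\<close>

text \<open>For t = tan (\<phi>/2) the coefficient vector is (1 + t^2)^2 times the unit vector of
  angle \<phi>. The derivative in t vanishes exactly when t satisfies the equation of
  \<open>slope_param\<close>.\<close>

definition support_form :: "real \<Rightarrow> complex \<Rightarrow> real" where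
  "support_form t z = Re z * (1 - t ^ 4) + 2 * Im z * (t + t ^ 3)"

text \<open>
  \<open>envelope\<close> is the \<open>M\<close> of the introduction, \<open>support_form\<close> being maximal at \<open>slope_param\<close>. The formulas
  come from the solution \<open>r powr (1/4) * cos (\<phi> / 2)\<close> of the linear hodograph equation, \<open>t = tan (\<phi> / 2)\<close>.
\<close>

definition envelope :: "complex \<Rightarrow> real" where
  "envelope z = support_form (slope_param z) z"

definition aronsson :: "complex \<Rightarrow> real" where
  "aronsson z = 1 / root 3 (envelope z)"

text \<open>The length of the gradient of M^(-1/3): the gradient of M has length (1 + t^2)^2, and
  the power contributes M^(-4/3) / 3, where M^(-4/3) is \<open>aronsson z ^ 4\<close>.\<close>

definition aronsson_slope :: "complex \<Rightarrow> real" where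
  "aronsson_slope z = aronsson z ^ 4 * (1 + (slope_param z)\<^sup>2)\<^sup>2 / 3"

text \<open>The slope equation eliminates \<open>Im z\<close>. Both coordinates become explicit
  multiples of the envelope, and later identities reduce to polynomial ones in t.\<close>

lemma envelope_param:
  assumes z: "z \<in> quadrant"
  defines "t \<equiv> slope_param z"
  shows "envelope z * (1 + 3 * t\<^sup>2) = Re z * (1 + t\<^sup>2) ^ 3"
proof -
  have "envelope z * (1 + 3 * t\<^sup>2) = Re z * (1 - t ^ 4) * (1 + 3 * t\<^sup>2) + 2 * (t + t ^ 3) * (Im z * (1 + 3 * t\<^sup>2))"
    by (simp add: envelope_def support_form_def t_def algebra_simps)
  also have "Im z * (1 + 3 * t\<^sup>2) = 2 * Re z * t ^ 3"
    using slope_param(2)[OF z] by (simp add: t_def)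
  also have "Re z * (1 - t ^ 4) * (1 + 3 * t\<^sup>2) + 2 * (t + t ^ 3) * (2 * Re z * t ^ 3) = Re z * (1 + t\<^sup>2) ^ 3"
    by algebra
  finally show ?thesis .
qed

lemma envelope_ge_Re:
  assumes z: "z \<in> quadrant"
  shows "Re z \<le> envelope z"
proof -
  let ?t = "slope_param z"
  have "Re z * (1 + 3 * ?t\<^sup>2) \<le> Re z * (1 + ?t\<^sup>2) ^ 3"
  proof (rule mult_left_mono)
    have "(1 + ?t\<^sup>2) ^ 3 = (1 + 3 * ?t\<^sup>2) + (3 * ?t ^ 4 + (?t ^ 3)\<^sup>2)" by algebra
    then show "1 + 3 * ?t\<^sup>2 \<le> (1 + ?t\<^sup>2) ^ 3" by simp
  qed (use z in \<open>auto simp: quadrant_def\<close>)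
  then have "Re z * (1 + 3 * ?t\<^sup>2) \<le> envelope z * (1 + 3 * ?t\<^sup>2)" using envelope_param[OF z] by simp
  moreover have "1 + 3 * ?t\<^sup>2 > 0" by (intro add_pos_nonneg) auto
  ultimately show ?thesis by simp
qed

lemma envelope_pos: "z \<in> quadrant \<Longrightarrow> 0 < envelope z"
  using envelope_ge_Re[of z] by (auto simp: quadrant_def)

text \<open>After multiplication by q^3 both coordinates are multiples of \<open>envelope z\<close>,
  and the difference of the two sides factors into (s - t)^2 times nonnegative quadratic forms. So
  the critical point is a maximum over all real s.\<close>

lemma support_form_le_envelope:
  assumes z: "z \<in> quadrant"
  shows "support_form s z \<le> envelope z"
proof -
  let ?t = "slope_param z"
  define q where "q = 1 + ?t\<^sup>2"
  have q: "q > 0" unfolding q_def by (intro add_pos_nonneg) auto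
  have u: "1 + 3 * ?t\<^sup>2 > 0" by (intro add_pos_nonneg) auto
  have X: "Re z * q ^ 3 = envelope z * (1 + 3 * ?t\<^sup>2)" using envelope_param[OF z] by (simp add: q_def)
  have "(1 + 3 * ?t\<^sup>2) * (Im z * q ^ 3) = 2 * ?t ^ 3 * (Re z * q ^ 3)"
    using slope_param(2)[OF z] by algebra
  also have "\<dots> = (1 + 3 * ?t\<^sup>2) * (envelope z * (2 * ?t ^ 3))" unfolding X by (simp add: mult_ac)
  finally have Y: "Im z * q ^ 3 = envelope z * (2 * ?t ^ 3)" using u by simp
  have nn: "0 \<le> s\<^sup>2 + 2 * s * ?t + 3 * ?t\<^sup>2" "0 \<le> 3 * s\<^sup>2 + 2 * s * ?t + ?t\<^sup>2"
    using zero_le_power2[of "s + ?t"] zero_le_power2[of s] zero_le_power2[of ?t] unfolding power2_sum by linarith+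
  have "support_form s z * q ^ 3 = (Re z * q ^ 3) * (1 - s ^ 4) + 2 * (Im z * q ^ 3) * (s + s ^ 3)"
    by (simp add: support_form_def algebra_simps)
  also have "\<dots> = envelope z * ((1 + 3 * ?t\<^sup>2) * (1 - s ^ 4) + 4 * ?t ^ 3 * (s + s ^ 3))"
    unfolding X Y by (simp add: algebra_simps)
  also have "(1 + 3 * ?t\<^sup>2) * (1 - s ^ 4) + 4 * ?t ^ 3 * (s + s ^ 3) = q ^ 3 -
     ((s - ?t)\<^sup>2 * (s\<^sup>2 + 2 * s * ?t + 3 * ?t\<^sup>2) + ?t\<^sup>2 * (s - ?t)\<^sup>2 * (3 * s\<^sup>2 + 2 * s * ?t + ?t\<^sup>2))"
    unfolding q_def by algebra
  also have "envelope z * \<dots> \<le> envelope z * q ^ 3"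
    using mult_nonneg_nonneg[OF zero_le_power2[of "s - ?t"] nn(1)]
      mult_nonneg_nonneg[OF mult_nonneg_nonneg[OF zero_le_power2[of ?t] zero_le_power2[of "s - ?t"]] nn(2)]
      envelope_pos[OF z] by (intro mult_left_mono) linarith+
  finally show ?thesis using q by simp
qed

text \<open>Cauchy-Schwarz through Lagrange's identity, the coefficient vector having length (1 +
  t^2)^2.\<close>

lemma support_form_lipschitz:
  "\<bar>support_form t z - support_form t w\<bar> \<le> (1 + t\<^sup>2)\<^sup>2 * cmod (z - w)"
proof (rule power2_le_imp_le)
  have "(support_form t z - support_form t w)\<^sup>2 \<le>
      ((1 - t ^ 4)\<^sup>2 + (2 * (t + t ^ 3))\<^sup>2) * ((Re z - Re w)\<^sup>2 + (Im z - Im w)\<^sup>2)"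
  proof -
    have "((1 - t ^ 4)\<^sup>2 + (2 * (t + t ^ 3))\<^sup>2) * ((Re z - Re w)\<^sup>2 + (Im z - Im w)\<^sup>2) -
      (support_form t z - support_form t w)\<^sup>2 =
      ((1 - t ^ 4) * (Im z - Im w) - (2 * (t + t ^ 3)) * (Re z - Re w))\<^sup>2"
      unfolding support_form_def by algebra
    then show ?thesis by (metis zero_le_power2 diff_ge_0_iff_ge)
  qed
  also have "(1 - t ^ 4)\<^sup>2 + (2 * (t + t ^ 3))\<^sup>2 = ((1 + t\<^sup>2)\<^sup>2)\<^sup>2" by algebra
  finally show "\<bar>support_form t z - support_form t w\<bar>\<^sup>2 \<le> ((1 + t\<^sup>2)\<^sup>2 * cmod (z - w))\<^sup>2"
    by (simp add: power_mult_distrib cmod_power2)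
qed simp

text \<open>The form active at z bounds the envelope at w from below, so the difference is at most
  that of a single form; \<open>T\<close> limits which forms can be active.\<close>

lemma envelope_lipschitz:
  assumes "z \<in> quadrant" "w \<in> quadrant" "slope_param z \<le> T" "slope_param w \<le> T"
  shows "\<bar>envelope z - envelope w\<bar> \<le> (1 + T\<^sup>2)\<^sup>2 * cmod (z - w)"
proof -
  have *: "envelope z - envelope w \<le> (1 + T\<^sup>2)\<^sup>2 * cmod (z - w)"
    if z: "z \<in> quadrant" "w \<in> quadrant" "slope_param z \<le> T" for z w
  proof -
    let ?t = "slope_param z"
    have "envelope z - envelope w \<le> support_form ?t z - support_form ?t w"
      using support_form_le_envelope[OF z(2), of ?t] by (simp add: envelope_def)
    also have "\<dots> \<le> (1 + ?t\<^sup>2)\<^sup>2 * cmod (z - w)"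
      using support_form_lipschitz[of ?t z w] by linarith
    also have "\<dots> \<le> (1 + T\<^sup>2)\<^sup>2 * cmod (z - w)"
      using z slope_param(1)[OF z(1)] by (intro mult_right_mono power_mono add_left_mono) auto
    finally show ?thesis .
  qed
  show ?thesis
    using *[of z w] *[of w z] assms by (simp add: abs_le_iff norm_minus_commute)
qed

section \<open>The negative cube root of the envelope and its slope\<close>

lemma aronsson_pos: "z \<in> quadrant \<Longrightarrow> 0 < aronsson z"
  by (simp add: aronsson_def envelope_pos)

lemma aronsson_cube: "z \<in> quadrant \<Longrightarrow> aronsson z ^ 3 * envelope z = 1"
  using envelope_pos[of z] by (simp add: aronsson_def power_divide)

lemma aronsson_eqI:
  assumes "z \<in> quadrant" "0 < g" "g ^ 3 * envelope z = 1"
  shows "aronsson z = g"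
proof -
  have "aronsson z ^ 3 * envelope z = g ^ 3 * envelope z" using assms aronsson_cube by simp
  then have "aronsson z ^ 3 = g ^ 3" using envelope_pos[OF assms(1)] by simp
  then show ?thesis using aronsson_pos[OF assms(1)] assms(2) by (simp add: power_eq_iff_eq_base)
qed

lemma aronsson_antimono:
  assumes "z \<in> quadrant" "0 < g" "1 \<le> g ^ 3 * envelope z"
  shows "aronsson z \<le> g"
proof (rule power_le_imp_le_base[of _ 2])
  have "aronsson z ^ 3 * envelope z \<le> g ^ 3 * envelope z" using assms aronsson_cube by simp
  then have "aronsson z ^ 3 \<le> g ^ 3" using envelope_pos[OF assms(1)] by simp
  then show "aronsson z ^ Suc 2 \<le> g ^ Suc 2" by (simp add: eval_nat_numeral)
qed (use assms in simp)

lemma aronsson_antimono':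
  assumes "z \<in> quadrant" "0 < g" "g ^ 3 * envelope z \<le> 1"
  shows "g \<le> aronsson z"
proof (rule power_le_imp_le_base[of _ 2])
  have "g ^ 3 * envelope z \<le> aronsson z ^ 3 * envelope z" using assms aronsson_cube by simp
  then have "g ^ 3 \<le> aronsson z ^ 3" using envelope_pos[OF assms(1)] by simp
  then show "g ^ Suc 2 \<le> aronsson z ^ Suc 2" by (simp add: eval_nat_numeral)
qed (use assms aronsson_pos[OF assms(1)] in simp)

text \<open>For cube roots a and b of the reciprocal envelopes, a^3 - b^3 is up to sign (a b)^3
  times the difference of the envelopes, and its cofactor a^2 + a b + b^2 is at least 3 a b.\<close>

lemma aronsson_diff_le:
  assumes z: "z \<in> quadrant" and w: "w \<in> quadrant"
  shows "\<bar>aronsson z - aronsson w\<bar> \<le> (aronsson z * aronsson w)\<^sup>2 / 3 * \<bar>envelope z - envelope w\<bar>"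
proof -
  define a where "a = aronsson z"
  define b where "b = aronsson w"
  have ab: "a > 0" "b > 0" "a ^ 3 * envelope z = 1" "b ^ 3 * envelope w = 1"
    using aronsson_pos aronsson_cube z w by (auto simp: a_def b_def)
  have "3 * (a * b) \<le> a\<^sup>2 + a * b + b\<^sup>2"
    using zero_le_power2[of "a - b"] unfolding power2_diff by linarith
  then have "\<bar>a - b\<bar> * (3 * (a * b)) \<le> \<bar>a - b\<bar> * (a\<^sup>2 + a * b + b\<^sup>2)" by (intro mult_left_mono) auto
  also have "\<dots> = \<bar>(a - b) * (a\<^sup>2 + a * b + b\<^sup>2)\<bar>"
    using ab by (simp add: abs_mult)
  also have "(a - b) * (a\<^sup>2 + a * b + b\<^sup>2) = a ^ 3 * (b ^ 3 * envelope w) - b ^ 3 * (a ^ 3 * envelope z)"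
    unfolding ab(3,4) by algebra
  also have "\<dots> = (a * b) ^ 3 * (envelope w - envelope z)" by algebra
  also have "\<bar>\<dots>\<bar> = (3 * (a * b)) * ((a * b)\<^sup>2 / 3 * \<bar>envelope z - envelope w\<bar>)"
    using ab by (simp add: abs_mult power3_eq_cube power2_eq_square abs_minus_commute)
  finally show ?thesis using ab by (simp add: a_def b_def mult.commute[of "\<bar>_ - _\<bar>"])
qed

text \<open>For T above the slope parameter t of z the condition \<open>slope_param w < T\<close> is
  open in w, so near z the envelope departs from its value there at rate at most (1 + T^2)^2. Taking
  T close to t costs less than e; continuity at z comes from the same estimate.\<close>

lemma aronsson_local_slope:
  assumes z: "z \<in> quadrant" and e: "0 < e"
  shows "\<exists>r>0. \<forall>w\<in>quadrant. cmod (w - z) < r \<longrightarrow>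
    \<bar>aronsson w - aronsson z\<bar> \<le> (aronsson_slope z + e) * cmod (w - z)"
proof -
  define g where "g = aronsson z"
  define t where "t = slope_param z"
  have g: "g > 0" and t: "t \<ge> 0" using aronsson_pos slope_param z by (auto simp: g_def t_def)
  have "((\<lambda>T. (g * g)\<^sup>2 / 3 * (1 + T\<^sup>2)\<^sup>2) \<longlongrightarrow> (g * g)\<^sup>2 / 3 * (1 + t\<^sup>2)\<^sup>2) (at_right t)"
    by (intro tendsto_intros)
  moreover have "(g * g)\<^sup>2 / 3 * (1 + t\<^sup>2)\<^sup>2 = aronsson_slope z"
    by (simp add: aronsson_slope_def g_def t_def power2_eq_square power4_eq_xxxx)
  ultimately have "\<forall>\<^sub>F T in at_right t. (g * g)\<^sup>2 / 3 * (1 + T\<^sup>2)\<^sup>2 < aronsson_slope z + e"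
    using e by (intro order_tendstoD(2)) auto
  then obtain b where b: "t < b" "\<And>T. t < T \<Longrightarrow> T < b \<Longrightarrow> (g * g)\<^sup>2 / 3 * (1 + T\<^sup>2)\<^sup>2 < aronsson_slope z + e"
    unfolding eventually_at_right_field by blast
  obtain T where T: "t < T" "(g * g)\<^sup>2 / 3 * (1 + T\<^sup>2)\<^sup>2 < aronsson_slope z + e"
    using dense[OF b(1)] b(2) by blast
  let ?F = "at z within quadrant"
  have in_q: "\<forall>\<^sub>F w in ?F. w \<in> quadrant" by (simp add: eventually_at_filter)
  have "((\<lambda>w. 2 * Re w * T ^ 3 - Im w * (1 + 3 * T\<^sup>2)) \<longlongrightarrow> 2 * Re z * T ^ 3 - Im z * (1 + 3 * T\<^sup>2)) ?F"
    by (intro tendsto_intros)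
  moreover have "2 * Re z * T ^ 3 - Im z * (1 + 3 * T\<^sup>2) > 0"
    using slope_param_less_iff[OF z, of T] T t by (simp add: t_def)
  ultimately have "\<forall>\<^sub>F w in ?F. 0 < 2 * Re w * T ^ 3 - Im w * (1 + 3 * T\<^sup>2)"
    by (rule order_tendstoD(1))
  then have near: "\<forall>\<^sub>F w in ?F. w \<in> quadrant \<and> slope_param w \<le> T"
    using in_q
  proof eventually_elim
    case (elim w)
    then have "slope_param w < T" using slope_param_less_iff[of w T] T t by simp
    then show ?case using elim by simp
  qed
  then have lip: "\<forall>\<^sub>F w in ?F. \<bar>envelope w - envelope z\<bar> \<le> (1 + T\<^sup>2)\<^sup>2 * cmod (w - z)"
    by eventually_elim (use envelope_lipschitz z T t_def in auto)
  have "((\<lambda>w. (1 + T\<^sup>2)\<^sup>2 * cmod (w - z)) \<longlongrightarrow> (1 + T\<^sup>2)\<^sup>2 * cmod (z - z)) ?F"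
    by (intro tendsto_intros)
  then have "((\<lambda>w. (1 + T\<^sup>2)\<^sup>2 * cmod (w - z)) \<longlongrightarrow> 0) ?F" by simp
  then have "((\<lambda>w. envelope w - envelope z) \<longlongrightarrow> 0) ?F"
    by (rule Lim_null_comparison[rotated]) (use lip in simp)
  then have "(envelope \<longlongrightarrow> envelope z) ?F" by (simp add: LIM_zero_iff)
  then have "(aronsson \<longlongrightarrow> aronsson z) ?F"
    unfolding aronsson_def using envelope_pos[OF z] by (intro tendsto_intros) auto
  then have "((\<lambda>w. (aronsson w * g)\<^sup>2 / 3 * (1 + T\<^sup>2)\<^sup>2) \<longlongrightarrow> (g * g)\<^sup>2 / 3 * (1 + T\<^sup>2)\<^sup>2) ?F"
    unfolding g_def by (intro tendsto_intros) auto
  then have "\<forall>\<^sub>F w in ?F. (aronsson w * g)\<^sup>2 / 3 * (1 + T\<^sup>2)\<^sup>2 < aronsson_slope z + e"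
    using T(2) by (rule order_tendstoD(2))
  then have "\<forall>\<^sub>F w in ?F. \<bar>aronsson w - aronsson z\<bar> \<le> (aronsson_slope z + e) * cmod (w - z)"
    using near lip
  proof eventually_elim
    case (elim w)
    have "\<bar>aronsson w - aronsson z\<bar> \<le> (aronsson w * g)\<^sup>2 / 3 * \<bar>envelope w - envelope z\<bar>"
      using aronsson_diff_le[of w z] elim z by (simp add: g_def)
    also have "\<dots> \<le> (aronsson w * g)\<^sup>2 / 3 * ((1 + T\<^sup>2)\<^sup>2 * cmod (w - z))"
      using elim by (intro mult_left_mono) auto
    also have "\<dots> = ((aronsson w * g)\<^sup>2 / 3 * (1 + T\<^sup>2)\<^sup>2) * cmod (w - z)" by simp
    also have "\<dots> \<le> (aronsson_slope z + e) * cmod (w - z)"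
      using elim by (intro mult_right_mono) auto
    finally show ?case .
  qed
  then obtain r where "r > 0" "\<forall>w\<in>quadrant. w \<noteq> z \<and> dist w z < r \<longrightarrow>
      \<bar>aronsson w - aronsson z\<bar> \<le> (aronsson_slope z + e) * cmod (w - z)"
    unfolding eventually_at by blast
  then show ?thesis by (metis abs_zero cancel_comm_monoid_add_class.diff_cancel dist_norm mult_zero_right norm_zero order_refl)
qed

lemma aronsson_lipschitz:
  assumes "0 < \<eta>" "0 \<le> R"
  obtains L where "0 < L" "\<And>z w. z \<in> quadrant \<Longrightarrow> w \<in> quadrant \<Longrightarrow> \<eta> \<le> Re z \<Longrightarrow> \<eta> \<le> Re w \<Longrightarrow>
    Im z \<le> R \<Longrightarrow> Im w \<le> R \<Longrightarrow> \<bar>aronsson z - aronsson w\<bar> \<le> L * cmod (z - w)"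
proof -
  \<comment> \<open>\<open>T\<close> exceeds the slope parameters in the region, for the reason that
    made \<open>N\<close> an upper end in the existence proof; \<open>G\<close> bounds
    \<open>aronsson\<close> there because the envelope is at least \<eta>.\<close>
  define T where "T = 1 + 2 * R / \<eta> + 1"
  define G where "G = 1 / root 3 \<eta>"
  have G: "G > 0" "G ^ 3 * \<eta> = 1" using assms by (auto simp: G_def power_divide)
  have T: "1 \<le> T" "2 * R < \<eta> * T" using assms by (auto simp: T_def field_simps)
  have slope: "slope_param z \<le> T" if z: "z \<in> quadrant" "\<eta> \<le> Re z" "Im z \<le> R" for z
  proof -
    have "Im z * (1 + 3 * T\<^sup>2) \<le> R * (4 * T\<^sup>2)"
      using z T power_mono[of 1 T 2] assms by (intro mult_mono) (auto simp: quadrant_def)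
    also have "\<dots> = 2 * (2 * R) * T\<^sup>2" by simp
    also have "\<dots> < 2 * (\<eta> * T) * T\<^sup>2" by (rule mult_strict_right_mono) (use T(2) in linarith, use T(1) in simp)
    also have "\<dots> = 2 * \<eta> * T ^ 3" by (simp add: power3_eq_cube power2_eq_square)
    also have "\<dots> \<le> 2 * Re z * T ^ 3" using z T by (intro mult_right_mono) auto
    finally show ?thesis using slope_param_less_iff[OF z(1), of T] T by simp
  qed
  have G_le: "aronsson z \<le> G" if z: "z \<in> quadrant" "\<eta> \<le> Re z" for z
  proof (rule aronsson_antimono[OF z(1) G(1)])
    have "G ^ 3 * \<eta> \<le> G ^ 3 * envelope z" using envelope_ge_Re[OF z(1)] z(2) G by (intro mult_left_mono) auto
    then show "1 \<le> G ^ 3 * envelope z" using G by simp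
  qed
  show thesis
  proof
    have "1 + T\<^sup>2 > 0" by (intro add_pos_nonneg) auto
    then show "0 < (G * G)\<^sup>2 / 3 * (1 + T\<^sup>2)\<^sup>2" using G by simp
    fix z w assume z: "z \<in> quadrant" "w \<in> quadrant" "\<eta> \<le> Re z" "\<eta> \<le> Re w" "Im z \<le> R" "Im w \<le> R"
    have "\<bar>aronsson z - aronsson w\<bar> \<le> (aronsson z * aronsson w)\<^sup>2 / 3 * \<bar>envelope z - envelope w\<bar>"
      using z by (intro aronsson_diff_le)
    also have "\<dots> \<le> (G * G)\<^sup>2 / 3 * ((1 + T\<^sup>2)\<^sup>2 * cmod (z - w))"
    proof (rule mult_mono)
      have "aronsson z * aronsson w \<le> G * G"
        using z G_le aronsson_pos[OF z(1)] aronsson_pos[OF z(2)] G by (intro mult_mono) auto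
      then show "(aronsson z * aronsson w)\<^sup>2 / 3 \<le> (G * G)\<^sup>2 / 3"
        using aronsson_pos[OF z(1)] aronsson_pos[OF z(2)] by (intro divide_right_mono power_mono) auto
      show "\<bar>envelope z - envelope w\<bar> \<le> (1 + T\<^sup>2)\<^sup>2 * cmod (z - w)"
        using z slope by (intro envelope_lipschitz) auto
    qed auto
    finally show "\<bar>aronsson z - aronsson w\<bar> \<le> (G * G)\<^sup>2 / 3 * (1 + T\<^sup>2)\<^sup>2 * cmod (z - w)" by simp
  qed
qed


section \<open>Gradient lines in the half plane\<close>

text \<open>
  Gradient lines of \<open>aronsson\<close>, parametrised by the value \<open>\<tau>\<close> of the function: an arc of slope
  \<open>1 / (3 * k ^ 4)\<close> that runs from the imaginary axis into the real axis, which is then followed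
  towards the pole.
\<close>

definition gradient_curve :: "real \<Rightarrow> real \<Rightarrow> complex" where
  "gradient_curve k \<tau> =
     (if \<tau> \<le> 1 / k then Complex (k ^ 3 * (k * \<tau> * (3 - 2 * (k * \<tau>)\<^sup>2))) (2 * k ^ 3 * sqrt (1 - (k * \<tau>)\<^sup>2) ^ 3)
      else Complex (1 / \<tau> ^ 3) 0)"

text \<open>With c = cos \<theta> this is half of (3 cos \<theta> - cos 3\<theta>, 3 sin \<theta> -
  sin 3\<theta>), an arc of a nephroid, and its derivative in c has constant length 3. The mean
  value inequality asks for derivatives only inside the interval, where the square root is
  smooth.\<close>

lemma nephroid_lipschitz:
  defines "\<gamma> \<equiv> \<lambda>c :: real. Complex (c * (3 - 2 * c\<^sup>2)) (2 * sqrt (1 - c\<^sup>2) ^ 3)"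
  assumes "0 \<le> a" "a \<le> b" "b \<le> 1"
  shows "cmod (\<gamma> b - \<gamma> a) \<le> 3 * (b - a)"
proof (cases "a = b")
  case False
  then have ab: "a < b" using assms by simp
  have \<gamma>: "\<gamma> = (\<lambda>c. of_real (c * (3 - 2 * c\<^sup>2)) + \<i> * of_real (2 * sqrt (1 - c\<^sup>2) ^ 3))"
    by (auto simp: \<gamma>_def complex_eq_iff)
  have "continuous_on {a..b} \<gamma>" unfolding \<gamma> by (intro continuous_intros)
  moreover have "(\<gamma> has_derivative (\<lambda>h. h *\<^sub>R Complex (3 - 6 * c\<^sup>2) (- 6 * c * sqrt (1 - c\<^sup>2)))) (at c)"
    if "a < c" "c < b" for c
  proof -
    have c: "0 < c" "c < 1" using that assms by auto
    then have c2: "c\<^sup>2 < 1" by (simp add: power_less_one_iff)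
    then have s: "sqrt (1 - c\<^sup>2) > 0" by simp
    have re: "((\<lambda>c. c * (3 - 2 * c\<^sup>2)) has_real_derivative 3 - 6 * c\<^sup>2) (at c)"
      by (auto intro!: derivative_eq_intros simp: power2_eq_square)
    have "((\<lambda>c. 2 * sqrt (1 - c\<^sup>2) ^ 3) has_real_derivative
        2 * (3 * sqrt (1 - c\<^sup>2) ^ 2 * (- (2 * c) * (inverse (sqrt (1 - c\<^sup>2)) / 2)))) (at c)"
      using c2 by (auto intro!: derivative_eq_intros simp: power2_eq_square)
    also have "2 * (3 * sqrt (1 - c\<^sup>2) ^ 2 * (- (2 * c) * (inverse (sqrt (1 - c\<^sup>2)) / 2))) = - 6 * c * sqrt (1 - c\<^sup>2)"
      using s by (simp add: field_simps power2_eq_square)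
    finally have im: "((\<lambda>c. 2 * sqrt (1 - c\<^sup>2) ^ 3) has_real_derivative - 6 * c * sqrt (1 - c\<^sup>2)) (at c)" .
    have "(\<gamma> has_vector_derivative Complex (3 - 6 * c\<^sup>2) (- 6 * c * sqrt (1 - c\<^sup>2))) (at c)"
      unfolding \<gamma>_def
      by (rule has_vector_derivative_complex_iff[THEN iffD2])
        (use re im in \<open>auto simp: has_real_derivative_iff_has_vector_derivative\<close>)
    then show ?thesis by (simp add: has_vector_derivative_def)
  qed
  ultimately obtain c where c: "c \<in> {a<..<b}"
    "cmod (\<gamma> b - \<gamma> a) \<le> cmod ((b - a) *\<^sub>R Complex (3 - 6 * c\<^sup>2) (- 6 * c * sqrt (1 - c\<^sup>2)))"
    using mvt_general[OF ab, of \<gamma> "\<lambda>c h. h *\<^sub>R Complex (3 - 6 * c\<^sup>2) (- 6 * c * sqrt (1 - c\<^sup>2))"]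
    by blast
  have "c\<^sup>2 \<le> 1" using c assms by (auto intro: power_le_one)
  then have "sqrt (1 - c\<^sup>2) ^ 2 = 1 - c\<^sup>2" by simp
  then have "(3 - 6 * c\<^sup>2)\<^sup>2 + (- 6 * c * sqrt (1 - c\<^sup>2))\<^sup>2 = 3\<^sup>2" by algebra
  then have "cmod (Complex (3 - 6 * c\<^sup>2) (- 6 * c * sqrt (1 - c\<^sup>2))) = 3" by (simp add: cmod_def)
  then show ?thesis using c(2) ab by (simp add: mult.commute)
qed simp

text \<open>On the arc the nephroid of speed 3 is scaled by k^3 and its parameter by k. On the axis
  the point 1 / \<tau>^3 moves at speed 3 / \<tau>^4, at most 3 k^4 once \<tau> is at least 1 / k,
  where the two parts meet.\<close>

lemma gradient_curve_lipschitz: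
  assumes k: "0 < k" and st: "0 \<le> \<sigma>" "0 \<le> \<tau>"
  shows "cmod (gradient_curve k \<tau> - gradient_curve k \<sigma>) \<le> 3 * k ^ 4 * \<bar>\<tau> - \<sigma>\<bar>"
proof -
  have arc: "cmod (gradient_curve k \<tau> - gradient_curve k \<sigma>) \<le> 3 * k ^ 4 * (\<tau> - \<sigma>)"
    if "0 \<le> \<sigma>" "\<sigma> \<le> \<tau>" "\<tau> \<le> 1 / k" for \<sigma> \<tau>
  proof -
    let ?g = "\<lambda>c :: real. Complex (c * (3 - 2 * c\<^sup>2)) (2 * sqrt (1 - c\<^sup>2) ^ 3)"
    have "gradient_curve k \<tau> - gradient_curve k \<sigma> = of_real (k ^ 3) * (?g (k * \<tau>) - ?g (k * \<sigma>))"
      using that by (simp add: gradient_curve_def complex_eq_iff algebra_simps)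
    then have "cmod (gradient_curve k \<tau> - gradient_curve k \<sigma>) = k ^ 3 * cmod (?g (k * \<tau>) - ?g (k * \<sigma>))"
      using k by (simp add: norm_mult norm_power)
    also have "\<dots> \<le> k ^ 3 * (3 * (k * \<tau> - k * \<sigma>))"
      using that k by (intro mult_left_mono nephroid_lipschitz) (auto simp: field_simps)
    also have "\<dots> = 3 * k ^ 4 * (\<tau> - \<sigma>)" by algebra
    finally show ?thesis .
  qed
  have corner: "gradient_curve k (1 / k) = Complex (1 / (1 / k) ^ 3) 0"
    using k by (simp add: gradient_curve_def power_divide)
  have axis: "cmod (gradient_curve k \<tau> - gradient_curve k \<sigma>) \<le> 3 * k ^ 4 * (\<tau> - \<sigma>)"
    if "1 / k \<le> \<sigma>" "\<sigma> \<le> \<tau>" for \<sigma> \<tau>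
  proof -
    have eq: "gradient_curve k s = Complex ((1 / s) ^ 3) 0" if "1 / k \<le> s" for s
      using that corner by (cases "s = 1 / k") (auto simp: gradient_curve_def power_divide)
    define a where "a = 1 / \<sigma>"
    define b where "b = 1 / \<tau>"
    have "0 < 1 / k" using k by simp
    then have pos: "0 < \<sigma>" "0 < \<tau>" using that by linarith+
    have ab: "0 < b" "b \<le> a" "a \<le> k" using that k pos by (auto simp: a_def b_def field_simps)
    have d: "a - b = a * b * (\<tau> - \<sigma>)" using pos by (simp add: a_def b_def field_simps)
    have "gradient_curve k \<tau> - gradient_curve k \<sigma> = of_real (b ^ 3 - a ^ 3)"
      using eq[OF that(1)] eq[of \<tau>] that by (simp add: a_def b_def complex_eq_iff)
    then have "cmod (gradient_curve k \<tau> - gradient_curve k \<sigma>) = \<bar>b ^ 3 - a ^ 3\<bar>"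
      by (simp only: norm_of_real)
    also have "b ^ 3 - a ^ 3 = - ((a\<^sup>2 + a * b + b\<^sup>2) * (a * b) * (\<tau> - \<sigma>))"
      using d by algebra
    also have "\<bar>\<dots>\<bar> = (a\<^sup>2 + a * b + b\<^sup>2) * (a * b) * (\<tau> - \<sigma>)"
      using ab that by (simp add: abs_mult)
    also have "\<dots> \<le> (k\<^sup>2 + k * k + k\<^sup>2) * (k * k) * (\<tau> - \<sigma>)"
      using ab k that by (intro mult_mono add_mono power_mono) auto
    also have "\<dots> = 3 * k ^ 4 * (\<tau> - \<sigma>)" by algebra
    finally show ?thesis .
  qed
  have ordered: "cmod (gradient_curve k \<tau> - gradient_curve k \<sigma>) \<le> 3 * k ^ 4 * (\<tau> - \<sigma>)"
    if "0 \<le> \<sigma>" "\<sigma> \<le> \<tau>" for \<sigma> \<tau>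
  proof -
    consider "\<tau> \<le> 1 / k" | "1 / k \<le> \<sigma>" | "\<sigma> \<le> 1 / k" "1 / k \<le> \<tau>" by linarith
    then show ?thesis
    proof cases
      case 3
      have "cmod (gradient_curve k \<tau> - gradient_curve k \<sigma>) \<le>
          cmod (gradient_curve k \<tau> - gradient_curve k (1 / k)) + cmod (gradient_curve k (1 / k) - gradient_curve k \<sigma>)"
        using norm_triangle_ineq[of "gradient_curve k \<tau> - gradient_curve k (1 / k)" "gradient_curve k (1 / k) - gradient_curve k \<sigma>"]
        by simp
      also have "\<dots> \<le> 3 * k ^ 4 * (\<tau> - 1 / k) + 3 * k ^ 4 * (1 / k - \<sigma>)"
        using 3 that by (intro add_mono axis arc) auto
      finally show ?thesis by (simp add: algebra_simps)
    qed (use arc axis that in auto)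
  qed
  show ?thesis
    using ordered[of \<sigma> \<tau>] ordered[of \<tau> \<sigma>] st by (cases "\<sigma> \<le> \<tau>") (auto simp: norm_minus_commute)
qed

lemma gradient_curve_Im_nonneg: "0 < k \<Longrightarrow> 0 \<le> \<tau> \<Longrightarrow> 0 \<le> Im (gradient_curve k \<tau>)"
proof -
  assume k: "0 < k" "0 \<le> \<tau>"
  have "(k * \<tau>)\<^sup>2 \<le> 1" if "\<tau> \<le> 1 / k"
    using k that by (intro power_le_one) (auto simp: field_simps)
  then show ?thesis using k by (auto simp: gradient_curve_def)
qed

lemma aronsson_gradient_curve:
  assumes k: "0 < k" and \<tau>: "0 < \<tau>"
  shows "gradient_curve k \<tau> \<in> quadrant" "aronsson (gradient_curve k \<tau>) = \<tau>"
proof -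
  define z where "z = gradient_curve k \<tau>"
  have "z \<in> quadrant \<and> aronsson z = \<tau>"
  proof (cases "\<tau> \<le> 1 / k")
    case True
    define c where "c = k * \<tau>"
    define s where "s = sqrt (1 - c\<^sup>2)"
    have c: "0 < c" "c \<le> 1" using True k \<tau> by (auto simp: c_def field_simps)
    then have c2: "c\<^sup>2 \<le> 1" by (simp add: power_le_one)
    have s: "0 \<le> s" "s\<^sup>2 = 1 - c\<^sup>2" using c2 by (auto simp: s_def)
    have z: "Re z = k ^ 3 * (c * (3 - 2 * c\<^sup>2))" "Im z = 2 * k ^ 3 * s ^ 3"
      using True by (auto simp: z_def gradient_curve_def c_def s_def)
    have "0 < Re z" unfolding z using c2 c k by (intro mult_pos_pos) auto
    moreover have "0 \<le> Im z" unfolding z using k s by simp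
    ultimately have zq: "z \<in> quadrant" by (simp add: quadrant_def)
    \<comment> \<open>c is the cosine of half the gradient angle, so this is its tangent.\<close>
    define t where "t = s / c"
    have ct: "c * t = s" using c by (simp add: t_def)
    have t: "0 \<le> t" using c s by (simp add: t_def)
    have t2: "c\<^sup>2 * (1 + 3 * t\<^sup>2) = 3 - 2 * c\<^sup>2"
    proof -
      have "c\<^sup>2 * (1 + 3 * t\<^sup>2) = c\<^sup>2 + 3 * (c * t)\<^sup>2" by algebra
      then show ?thesis unfolding ct s(2) by simp
    qed
    have t3: "c\<^sup>2 * (1 + t\<^sup>2) = 1"
    proof -
      have "c\<^sup>2 * (1 + t\<^sup>2) = c\<^sup>2 + (c * t)\<^sup>2" by algebra
      then show ?thesis unfolding ct s(2) by simp
    qed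
    have "c\<^sup>2 * (2 * Re z * t ^ 3) = 2 * k ^ 3 * (3 - 2 * c\<^sup>2) * (c * t) ^ 3" unfolding z by algebra
    also have "\<dots> = c\<^sup>2 * (Im z * (1 + 3 * t\<^sup>2))" unfolding z ct t2[symmetric] by algebra
    finally have "2 * Re z * t ^ 3 = Im z * (1 + 3 * t\<^sup>2)" using c by simp
    then have sp: "slope_param z = t" by (rule slope_param_eqI[OF zq t])
    have "(c\<^sup>2 * (1 + 3 * t\<^sup>2)) * (\<tau> ^ 3 * envelope z) = \<tau> ^ 3 * c\<^sup>2 * (envelope z * (1 + 3 * t\<^sup>2))"
      by (simp add: mult_ac)
    also have "envelope z * (1 + 3 * t\<^sup>2) = Re z * (1 + t\<^sup>2) ^ 3" using envelope_param[OF zq] sp by simp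
    also have "\<tau> ^ 3 * c\<^sup>2 * (Re z * (1 + t\<^sup>2) ^ 3) = (k * \<tau>) ^ 3 * c ^ 3 * (1 + t\<^sup>2) ^ 3 * (3 - 2 * c\<^sup>2)"
      unfolding z by algebra
    also have "\<dots> = (c\<^sup>2 * (1 + t\<^sup>2)) ^ 3 * (3 - 2 * c\<^sup>2)" unfolding c_def[symmetric] by algebra
    also have "\<dots> = c\<^sup>2 * (1 + 3 * t\<^sup>2)" using t2 t3 by simp
    finally have "\<tau> ^ 3 * envelope z = 1" using t2 c2 by simp
    then show ?thesis using aronsson_eqI[OF zq \<tau>] zq by simp
  next
    case False
    then have z: "Re z = 1 / \<tau> ^ 3" "Im z = 0" by (auto simp: z_def gradient_curve_def)
    have zq: "z \<in> quadrant" using z \<tau> by (simp add: quadrant_def)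
    have "slope_param z = 0" by (rule slope_param_eqI[OF zq]) (auto simp: z)
    then have "\<tau> ^ 3 * envelope z = 1" using z \<tau> by (simp add: envelope_def support_form_def)
    then show ?thesis using aronsson_eqI[OF zq \<tau>] zq by simp
  qed
  then show "gradient_curve k \<tau> \<in> quadrant" "aronsson (gradient_curve k \<tau>) = \<tau>" by (auto simp: z_def)
qed

text \<open>1 / q is the cosine of half the gradient angle at z, so the curve of parameter k = 1 /
  (g q) has that angle at the value g. From |z|^2 = k^6 (1 + 3 s^2) the distance to the pole bounds
  k, hence the slope from below.\<close>

lemma gradient_curve_through:
  assumes z: "z \<in> quadrant"
  obtains k where "0 < k" "gradient_curve k (aronsson z) = z" "aronsson_slope z * (3 * k ^ 4) = 1"
    "k ^ 3 \<le> cmod z"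
proof -
  define g where "g = aronsson z"
  define t where "t = slope_param z"
  define q where "q = sqrt (1 + t\<^sup>2)"
  define k where "k = 1 / (g * q)"
  define c where "c = 1 / q"
  define s where "s = t / q"
  have t: "0 \<le> t" using slope_param[OF z] by (simp add: t_def)
  have g: "0 < g" "g ^ 3 * envelope z = 1" using aronsson_pos aronsson_cube z by (auto simp: g_def)
  have "1 + t\<^sup>2 > 0" by (intro add_pos_nonneg) auto
  then have q: "q > 0" "q\<^sup>2 = 1 + t\<^sup>2" by (auto simp: q_def)
  have k: "k > 0" "k * g = c" using g q by (auto simp: k_def c_def)
  have "c\<^sup>2 + s\<^sup>2 = (1 + t\<^sup>2) / q\<^sup>2" by (simp add: c_def s_def power_divide add_divide_distrib)
  moreover have "(1 + t\<^sup>2) / q\<^sup>2 = 1" using q \<open>1 + t\<^sup>2 > 0\<close> by simp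
  ultimately have cs: "c > 0" "0 \<le> s" "c\<^sup>2 + s\<^sup>2 = 1" "c * t = s" "c * q = 1"
    using q t by (auto simp: c_def s_def)
  have c1: "c \<le> 1" using cs by (metis less_eq_real_def power2_le_imp_le add_increasing2 le_add_same_cancel1 one_power2 zero_le_one zero_le_power2)
  have sq: "sqrt (1 - c\<^sup>2) = s" using cs by (intro real_sqrt_unique) auto
  have kM: "k ^ 3 = envelope z * c ^ 3"
  proof -
    have "k ^ 3 = k ^ 3 * (g ^ 3 * envelope z)" using g by simp
    also have "\<dots> = envelope z * (k * g) ^ 3" by algebra
    finally show ?thesis using k by simp
  qed
  have "1 + 3 * t\<^sup>2 > 0" by (intro add_pos_nonneg) auto
  have env: "envelope z * (1 + 3 * t\<^sup>2) = Re z * (q\<^sup>2) ^ 3"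
    using envelope_param[OF z] q by (simp add: t_def)
  have "3 - 2 * c\<^sup>2 = c\<^sup>2 * (1 + 3 * t\<^sup>2)" using cs by algebra
  then have "k ^ 3 * (c * (3 - 2 * c\<^sup>2)) = c ^ 6 * (envelope z * (1 + 3 * t\<^sup>2))" unfolding kM by algebra
  also have "\<dots> = Re z * (c * q) ^ 6" unfolding env by algebra
  finally have Re: "k ^ 3 * (c * (3 - 2 * c\<^sup>2)) = Re z" using cs by simp
  have "(1 + 3 * t\<^sup>2) * (2 * k ^ 3 * s ^ 3) = 2 * t ^ 3 * c ^ 6 * (envelope z * (1 + 3 * t\<^sup>2))"
    unfolding kM cs(4)[symmetric] by algebra
  also have "\<dots> = (2 * Re z * t ^ 3) * (c * q) ^ 6" unfolding env by algebra
  also have "\<dots> = (1 + 3 * t\<^sup>2) * Im z" using slope_param(2)[OF z] cs by (simp add: t_def mult.commute)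
  finally have Im: "2 * k ^ 3 * s ^ 3 = Im z" using \<open>1 + 3 * t\<^sup>2 > 0\<close> by simp
  have "g \<le> 1 / k" using k c1 by (simp add: field_simps)
  then have curve: "gradient_curve k g = z"
    unfolding gradient_curve_def k(2) sq Re Im by (simp add: complex_eq_iff)
  have slope: "aronsson_slope z * (3 * k ^ 4) = 1"
  proof -
    have "aronsson_slope z * (3 * k ^ 4) = (k * g) ^ 4 * (q\<^sup>2)\<^sup>2"
      unfolding aronsson_slope_def q g_def[symmetric] t_def[symmetric] by (simp add: power_mult_distrib)
    also have "\<dots> = (c * q) ^ 4" unfolding k by algebra
    finally show ?thesis using cs by simp
  qed
  have "(k ^ 3)\<^sup>2 \<le> (cmod z)\<^sup>2"
  proof -
    have c2: "c\<^sup>2 \<le> 1" using cs(3) zero_le_power2[of s] by linarith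
    have "(cmod z)\<^sup>2 = (k ^ 3)\<^sup>2 * ((c * (3 - 2 * c\<^sup>2))\<^sup>2 + 4 * (s\<^sup>2) ^ 3)"
      unfolding cmod_power2 Re[symmetric] Im[symmetric] by algebra
    also have "s\<^sup>2 = 1 - c\<^sup>2" using cs by simp
    also have "(c * (3 - 2 * c\<^sup>2))\<^sup>2 + 4 * (1 - c\<^sup>2) ^ 3 = 1 + 3 * (1 - c\<^sup>2)" by algebra
    also have "(k ^ 3)\<^sup>2 * \<dots> \<ge> (k ^ 3)\<^sup>2 * 1"
      using c2 by (intro mult_left_mono) simp_all
    finally show ?thesis by simp
  qed
  then have "k ^ 3 \<le> cmod z" by (rule power2_le_imp_le) simp
  with that[of k] k curve slope show thesis by (simp add: g_def)
qed

section \<open>Cylindrical coordinates on the ball\<close>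

definition dotn :: "nat \<Rightarrow> (nat \<Rightarrow> real) \<Rightarrow> (nat \<Rightarrow> real) \<Rightarrow> real" where
  "dotn n x y = (\<Sum>i<n. x i * y i)"

lemma dotn_linear [simp]:
  "dotn n (\<lambda>i. x i + y i) z = dotn n x z + dotn n y z"
  "dotn n z (\<lambda>i. x i + y i) = dotn n z x + dotn n z y"
  "dotn n (\<lambda>i. x i - y i) z = dotn n x z - dotn n y z"
  "dotn n z (\<lambda>i. x i - y i) = dotn n z x - dotn n z y"
  "dotn n (\<lambda>i. c * x i) z = c * dotn n x z"
  "dotn n z (\<lambda>i. c * x i) = c * dotn n z x"
  "dotn n (\<lambda>i. 0) z = 0"
  "dotn n z (\<lambda>i. 0) = 0"
  by (simp_all add: dotn_def algebra_simps sum.distrib sum_subtractf sum_distrib_left)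

lemma dotn_commute: "dotn n x y = dotn n y x"
  by (simp add: dotn_def mult.commute)

lemma dotn_self_nonneg [simp]: "0 \<le> dotn n x x"
  by (simp add: dotn_def sum_nonneg)

lemma L2_set_dotn: "L2_set x {..<n} = sqrt (dotn n x x)"
  by (simp add: L2_set_def dotn_def power2_eq_square)

lemma dotn_le: "dotn n x y \<le> sqrt (dotn n x x) * sqrt (dotn n y y)"
proof -
  have "dotn n x y \<le> (\<Sum>i<n. \<bar>x i\<bar> * \<bar>y i\<bar>)"
    unfolding dotn_def by (intro sum_mono) (metis abs_ge_self abs_mult)
  also have "\<dots> \<le> L2_set x {..<n} * L2_set y {..<n}" by (rule L2_set_mult_ineq)
  finally show ?thesis by (simp add: L2_set_dotn)
qed

lemma euclid_dist_power2:
  "(mdist (euclid_metric n) x y)\<^sup>2 = dotn n x x - 2 * dotn n x y + dotn n y y"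
proof -
  have "(mdist (euclid_metric n) x y)\<^sup>2 = dotn n (\<lambda>i. x i - y i) (\<lambda>i. x i - y i)"
    unfolding mdist_euclid_metric L2_set_dotn by (rule real_sqrt_pow2) (rule dotn_self_nonneg)
  then show ?thesis by (simp add: dotn_commute[of n y x])
qed

lemma mdist_ball_metric [simp]: "mdist (ball_metric n) = mdist (euclid_metric n)"
  by (simp add: ball_metric_def del: mdist_euclid_metric)

lemma euclid_dist_origin: "mdist (euclid_metric n) origin x = sqrt (dotn n x x)"
  by (simp add: L2_set_def dotn_def power2_eq_square)

lemma mspace_ball_metric: "mspace (ball_metric n) = {x. (\<forall>i\<ge>n. x i = 0) \<and> dotn n x x \<le> 1}"
  unfolding ball_metric_def mspace_submetric
  by (auto simp: euclid_dist_origin simp del: mdist_euclid_metric)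

lemma unit_sphere_iff: "x \<in> unit_sphere n \<longleftrightarrow> (\<forall>i\<ge>n. x i = 0) \<and> dotn n x x = 1"
  unfolding unit_sphere_def by (auto simp: euclid_dist_origin simp del: mdist_euclid_metric)

lemma unit_sphere_subset: "unit_sphere n \<subseteq> mspace (ball_metric n)"
  by (auto simp: unit_sphere_iff mspace_ball_metric)

lemma origin_in_ball: "origin \<in> mspace (ball_metric n)"
  by (simp add: mspace_ball_metric)

declare mdist_euclid_metric [simp del]

lemma euclid_dist_affine:
  "mdist (euclid_metric n) (\<lambda>i. x i + s * (y i - x i)) (\<lambda>i. x i + t * (y i - x i)) =
    \<bar>s - t\<bar> * mdist (euclid_metric n) x y"
proof -
  have "(mdist (euclid_metric n) (\<lambda>i. x i + s * (y i - x i)) (\<lambda>i. x i + t * (y i - x i)))\<^sup>2 =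
      (\<bar>s - t\<bar> * mdist (euclid_metric n) x y)\<^sup>2"
    unfolding power_mult_distrib euclid_dist_power2 power2_abs
    by (simp add: dotn_commute[of n y x]) algebra
  then show ?thesis by (rule power2_eq_imp_eq) simp_all
qed

lemma geodesic_ball_metric: "geodesic_metric (ball_metric n)"
  unfolding geodesic_metric_def
proof (intro ballI)
  fix x y assume xy: "x \<in> mspace (ball_metric n)" "y \<in> mspace (ball_metric n)"
  let ?g = "\<lambda>s i. x i + s * (y i - x i)"
  have "dotn n (?g s) (?g s) \<le> 1" if s: "s \<in> {0..1}" for s
  proof -
    have "dotn n (?g s) (?g s) = (1 - s) * dotn n x x + s * dotn n y y
        - s * (1 - s) * (mdist (euclid_metric n) x y)\<^sup>2"
      unfolding euclid_dist_power2 by (simp add: dotn_commute[of n y x]) algebra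
    also have "\<dots> \<le> (1 - s) * 1 + s * 1 - 0"
      using s xy by (intro diff_mono add_mono mult_left_mono) (auto simp: mspace_ball_metric)
    finally show ?thesis by simp
  qed
  then show "\<exists>g. g 0 = x \<and> g 1 = y \<and> (\<forall>s\<in>{0..1}. g s \<in> mspace (ball_metric n)) \<and>
      (\<forall>s\<in>{0..1}. \<forall>t\<in>{0..1}. mdist (ball_metric n) (g s) (g t) = \<bar>s - t\<bar> * mdist (ball_metric n) x y)"
    using xy by (intro exI[of _ ?g]) (auto simp: mspace_ball_metric euclid_dist_affine)
qed

text \<open>Gradient lines leave the ball at both ends, so their exits from U are sought in the
  whole space. Off the sphere relative openness is genuine openness, and frontier points found in
  the whole space lie in the closed ball.\<close>

lemma openin_euclid_of_ball:
  assumes U: "openin (mtopology_of (ball_metric n)) U" "U \<subseteq> mspace (ball_metric n) - unit_sphere n"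
  shows "openin (mtopology_of (euclid_metric n)) U"
    and "mtopology_of (euclid_metric n) frontier_of U \<subseteq> mtopology_of (ball_metric n) frontier_of U"
proof -
  have sub: "mspace (ball_metric n) \<subseteq> mspace (euclid_metric n)" by (auto simp: mspace_ball_metric)
  have o: "origin \<in> mspace (euclid_metric n)" by simp
  have ball: "x \<in> mspace (ball_metric n) \<longleftrightarrow> x \<in> mspace (euclid_metric n) \<and> mdist (euclid_metric n) origin x \<le> 1" for x
    by (auto simp: mspace_ball_metric euclid_dist_origin)
  show op: "openin (mtopology_of (euclid_metric n)) U"
    unfolding openin_mtopology_of_iff
  proof (intro conjI ballI)
    show "U \<subseteq> mspace (euclid_metric n)" using U sub by auto
    fix x assume x: "x \<in> U"
    obtain r where r: "r > 0" "\<And>y. y \<in> mspace (ball_metric n) \<Longrightarrow> mdist (euclid_metric n) x y < r \<Longrightarrow> y \<in> U"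
      using U(1) x unfolding openin_mtopology_of_iff by force
    have xb: "x \<in> mspace (ball_metric n)" "x \<notin> unit_sphere n" using x U by auto
    then have "mdist (euclid_metric n) origin x < 1"
      by (auto simp: mspace_ball_metric unit_sphere_iff euclid_dist_origin less_le)
    moreover have "y \<in> U" if "y \<in> mspace (euclid_metric n)"
      "mdist (euclid_metric n) x y < min r (1 - mdist (euclid_metric n) origin x)" for y
      using r(2)[of y] that mdist_triangle[OF o, of x y] xb sub by (auto simp: ball)
    ultimately show "\<exists>r>0. \<forall>y\<in>mspace (euclid_metric n). mdist (euclid_metric n) x y < r \<longrightarrow> y \<in> U"
      using r by (intro exI[of _ "min r (1 - mdist (euclid_metric n) origin x)"]) auto
  qed
  show "mtopology_of (euclid_metric n) frontier_of U \<subseteq> mtopology_of (ball_metric n) frontier_of U"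
  proof
    fix x assume x: "x \<in> mtopology_of (euclid_metric n) frontier_of U"
    have "mdist (euclid_metric n) origin y \<le> 1" if "y \<in> U" for y using ball[of y] U(2) that by blast
    then have "mdist (euclid_metric n) origin x \<le> 1" using x by (rule frontier_dist_le[OF op o])
    then show "x \<in> mtopology_of (ball_metric n) frontier_of U"
      using x unfolding frontier_of_openin_iff[OF op] frontier_of_openin_iff[OF U(1)] by (auto simp: ball)
  qed
qed

text \<open>
  Cylindrical coordinates around the axis through \<open>p\<close>: distance to the hyperplane orthogonal to
  \<open>p\<close> through the pole \<open>(1 + \<eta>) p\<close>, and distance to the axis.
\<close>

definition axial :: "nat \<Rightarrow> (nat \<Rightarrow> real) \<Rightarrow> real \<Rightarrow> (nat \<Rightarrow> real) \<Rightarrow> complex" where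
  "axial n p \<eta> x = Complex (1 + \<eta> - dotn n x p) (sqrt (dotn n x x - (dotn n x p)\<^sup>2))"

text \<open>The embedding of the half plane spanned by the axis and a unit vector e orthogonal to p,
  where it inverts \<open>axial\<close>.\<close>

definition axial_point :: "(nat \<Rightarrow> real) \<Rightarrow> real \<Rightarrow> (nat \<Rightarrow> real) \<Rightarrow> complex \<Rightarrow> nat \<Rightarrow> real" where
  "axial_point p \<eta> e z = (\<lambda>i. (1 + \<eta> - Re z) * p i + Im z * e i)"

context
  fixes n :: nat and p :: "nat \<Rightarrow> real"
  assumes p: "p \<in> unit_sphere n"
begin

lemma dotn_pp: "dotn n p p = 1" and p_zero: "\<And>i. i \<ge> n \<Longrightarrow> p i = 0"
  using p by (simp_all add: unit_sphere_iff)

lemma dotn_reject: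
  "dotn n (\<lambda>i. x i - dotn n x p * p i) (\<lambda>i. y i - dotn n y p * p i) = dotn n x y - dotn n x p * dotn n y p"
  by (simp add: dotn_pp dotn_commute[of n p y])

lemma dotn_p_le: "(dotn n x p)\<^sup>2 \<le> dotn n x x"
  using dotn_self_nonneg[of n "\<lambda>i. x i - dotn n x p * p i"] unfolding dotn_reject by (simp add: power2_eq_square)

lemma dotn_p_ball: "x \<in> mspace (ball_metric n) \<Longrightarrow> \<bar>dotn n x p\<bar> \<le> 1"
proof -
  assume "x \<in> mspace (ball_metric n)"
  then have "(dotn n x p)\<^sup>2 \<le> 1" using dotn_p_le[of x] by (simp add: mspace_ball_metric)
  then show ?thesis by (simp only: abs_square_le_1)
qed

text \<open>The distance to the axis is the length of the component orthogonal to p; Cauchy-Schwarz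
  for the two orthogonal components bounds the difference of their lengths.\<close>

lemma axial_contraction: "cmod (axial n p \<eta> x - axial n p \<eta> y) \<le> mdist (euclid_metric n) x y"
proof (rule power2_le_imp_le)
  define a b where "a = dotn n x p" and "b = dotn n y p"
  define A B where "A = dotn n x x - a\<^sup>2" and "B = dotn n y y - b\<^sup>2"
  have AB: "A \<ge> 0" "B \<ge> 0" using dotn_p_le by (auto simp: A_def B_def a_def b_def)
  have le: "dotn n x y - a * b \<le> sqrt A * sqrt B"
    using dotn_le[of n "\<lambda>i. x i - dotn n x p * p i" "\<lambda>i. y i - dotn n y p * p i"]
    unfolding dotn_reject by (simp add: A_def B_def a_def b_def power2_eq_square)
  have "(cmod (axial n p \<eta> x - axial n p \<eta> y))\<^sup>2 = (b - a)\<^sup>2 + (sqrt A - sqrt B)\<^sup>2"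
    unfolding cmod_power2 by (simp add: axial_def a_def b_def A_def B_def)
  also have "(sqrt A - sqrt B)\<^sup>2 = A + B - 2 * (sqrt A * sqrt B)"
    using AB by (simp add: power2_diff)
  also have "(b - a)\<^sup>2 + \<dots> \<le> (b - a)\<^sup>2 + (A + B - 2 * (dotn n x y - a * b))"
    using le by simp
  also have "\<dots> = (mdist (euclid_metric n) x y)\<^sup>2"
    unfolding euclid_dist_power2 A_def B_def by algebra
  finally show "(cmod (axial n p \<eta> x - axial n p \<eta> y))\<^sup>2 \<le> (mdist (euclid_metric n) x y)\<^sup>2" .
qed simp

lemma axial_point_in_space:
  "\<forall>i\<ge>n. e i = 0 \<Longrightarrow> axial_point p \<eta> e z \<in> mspace (euclid_metric n)"
  by (simp add: axial_point_def p_zero)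

lemma axial_point_dist:
  assumes "dotn n e e = 1" "dotn n e p = 0"
  shows "mdist (euclid_metric n) (axial_point p \<eta> e z) (axial_point p \<eta> e w) = cmod (z - w)"
proof (rule power2_eq_imp_eq)
  show "(mdist (euclid_metric n) (axial_point p \<eta> e z) (axial_point p \<eta> e w))\<^sup>2 = (cmod (z - w))\<^sup>2"
    unfolding euclid_dist_power2 cmod_power2 axial_point_def
    using assms dotn_pp by (simp add: dotn_commute[of n p e] power2_eq_square algebra_simps)
qed simp_all

lemma axial_point_axial:
  assumes "dotn n e e = 1" "dotn n e p = 0" "0 \<le> Im z"
  shows "axial n p \<eta> (axial_point p \<eta> e z) = z" "dotn n (axial_point p \<eta> e z) p = 1 + \<eta> - Re z"
proof -
  show 1: "dotn n (axial_point p \<eta> e z) p = 1 + \<eta> - Re z"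
    using assms dotn_pp by (simp add: axial_point_def)
  have "dotn n (axial_point p \<eta> e z) (axial_point p \<eta> e z) = (1 + \<eta> - Re z)\<^sup>2 + (Im z)\<^sup>2"
    using assms dotn_pp by (simp add: axial_point_def dotn_commute[of n p e] power2_eq_square)
  then show "axial n p \<eta> (axial_point p \<eta> e z) = z"
    using assms unfolding axial_def 1 by (simp add: complex_eq_iff)
qed

text \<open>Off the axis e is the normalised component of x orthogonal to p. On the axis any unit
  vector orthogonal to p serves, and one exists because the dimension exceeds 1.\<close>

lemma axial_direction:
  assumes n: "1 < n" and x: "x \<in> mspace (euclid_metric n)"
  obtains e where "\<forall>i\<ge>n. e i = 0" "dotn n e e = 1" "dotn n e p = 0"
    "axial_point p \<eta> e (axial n p \<eta> x) = x"
proof -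
  have unit: "\<exists>e. (\<forall>i\<ge>n. e i = 0) \<and> dotn n e e = 1 \<and> dotn n e p = 0 \<and> (\<forall>i. f i = sqrt (dotn n f f) * e i)"
    if f: "\<forall>i\<ge>n. f i = 0" "dotn n f p = 0" "dotn n f f > 0" for f
  proof -
    define r where "r = sqrt (dotn n f f)"
    have r: "r > 0" "dotn n f f = r * r" using f(3) by (auto simp: r_def)
    define c where "c = 1 / r"
    have c: "r * c = 1" using r by (simp add: c_def)
    have "c * (c * (r * r)) = (r * c) * (r * c)" by (simp add: mult_ac)
    moreover have "r * (c * y) = y" for y using c by (simp flip: mult.assoc)
    ultimately show ?thesis
      unfolding r_def[symmetric] using f(1,2) r c
      by (intro exI[of _ "\<lambda>i. c * f i"]) auto
  qed
  define f where "f = (\<lambda>i. x i - dotn n x p * p i)"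
  have f: "\<forall>i\<ge>n. f i = 0" "dotn n f p = 0" "dotn n f f = dotn n x x - (dotn n x p)\<^sup>2"
    using x p_zero dotn_reject[of x x] by (auto simp: f_def dotn_pp power2_eq_square)
  have "\<exists>e. (\<forall>i\<ge>n. e i = 0) \<and> dotn n e e = 1 \<and> dotn n e p = 0 \<and> (\<forall>i. f i = sqrt (dotn n f f) * e i)"
  proof (cases "dotn n f f > 0")
    case True
    show ?thesis by (rule unit[OF f(1,2) True])
  next
    case False
    then have "dotn n f f = 0" using dotn_self_nonneg[of n f] by linarith
    then have f0: "f i = 0" for i
      using f(1) by (cases "i < n") (auto simp: dotn_def sum_nonneg_eq_0_iff)
    \<comment> \<open>A nonzero vector orthogonal to p: its first two coordinates turned by a right
      angle, or the first basis vector if both vanish.\<close>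
    define h :: "nat \<Rightarrow> real" where "h = (\<lambda>i. if p 0 = 0 \<and> p 1 = 0 then of_bool (i = 0)
      else if i = 0 then p 1 else if i = 1 then - p 0 else 0)"
    have split: "dotn n h g = h 0 * g 0 + h 1 * g 1" for g
    proof -
      have "dotn n h g = (\<Sum>i\<in>{0, 1}. h i * g i)"
        unfolding dotn_def using n by (intro sum.mono_neutral_right) (auto simp: h_def)
      then show ?thesis by simp
    qed
    have "\<forall>i\<ge>n. h i = 0" using n by (auto simp: h_def)
    moreover have "dotn n h p = 0" unfolding split by (auto simp: h_def)
    moreover have "dotn n h h > 0"
      unfolding split by (auto simp: h_def sum_squares_gt_zero_iff)
    ultimately obtain e where "\<forall>i\<ge>n. e i = 0" "dotn n e e = 1" "dotn n e p = 0"
      using unit[of h] by blast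
    then show ?thesis using f0 \<open>dotn n f f = 0\<close> by (intro exI[of _ e]) simp
  qed
  then obtain e where e: "\<forall>i\<ge>n. e i = 0" "dotn n e e = 1" "dotn n e p = 0" "\<And>i. f i = sqrt (dotn n f f) * e i"
    by blast
  have "axial_point p \<eta> e (axial n p \<eta> x) = x"
  proof
    fix i
    have "x i - dotn n x p * p i = sqrt (dotn n x x - (dotn n x p)\<^sup>2) * e i"
      using e(4)[of i] fun_cong[OF f_def, of i] f(3) by simp
    then show "axial_point p \<eta> e (axial n p \<eta> x) i = x i"
      by (simp add: axial_point_def axial_def)
  qed
  with that e show thesis by blast
qed

lemma axial_norm: "(cmod (axial n p \<eta> x))\<^sup>2 = (1 + \<eta>)\<^sup>2 - 2 * (1 + \<eta>) * dotn n x p + dotn n x x"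
  unfolding cmod_power2 using dotn_p_le[of x] by (simp add: axial_def power2_eq_square algebra_simps)

section \<open>Gradient lines in the ball, absolute minimality and growth\<close>

context
  fixes \<eta> :: real
  assumes \<eta>: "0 < \<eta>"
begin

lemma axial_quadrant: "x \<in> mspace (ball_metric n) \<Longrightarrow> axial n p \<eta> x \<in> quadrant"
  using dotn_p_ball[of x] dotn_p_le[of x] \<eta> by (auto simp: quadrant_def axial_def)

definition gradient_line :: "(nat \<Rightarrow> real) \<Rightarrow> real \<Rightarrow> real \<Rightarrow> nat \<Rightarrow> real" where
  "gradient_line e k \<tau> = axial_point p \<eta> e (gradient_curve k \<tau>)"

text \<open>The last two claims provide exits in both directions: the line starts on the hyperplane
  through the pole and ends on the axis between ball and pole.\<close>

lemma gradient_line: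
  assumes e: "\<forall>i\<ge>n. e i = 0" "dotn n e e = 1" "dotn n e p = 0" and k: "0 < k"
  shows "gradient_line e k \<tau> \<in> mspace (euclid_metric n)"
    and "0 \<le> \<sigma> \<Longrightarrow> 0 \<le> \<tau> \<Longrightarrow> mdist (euclid_metric n) (gradient_line e k \<sigma>) (gradient_line e k \<tau>) \<le> 3 * k ^ 4 * \<bar>\<sigma> - \<tau>\<bar>"
    and "0 < \<tau> \<Longrightarrow> aronsson (axial n p \<eta> (gradient_line e k \<tau>)) = \<tau>"
    and "gradient_line e k 0 \<notin> mspace (ball_metric n)"
    and "1 / k < \<tau> \<Longrightarrow> 1 < \<tau> \<Longrightarrow> 1 / \<eta> < \<tau> \<Longrightarrow> gradient_line e k \<tau> \<notin> mspace (ball_metric n)"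
proof -
  show "gradient_line e k \<tau> \<in> mspace (euclid_metric n)"
    unfolding gradient_line_def by (rule axial_point_in_space[OF e(1)])
  show "mdist (euclid_metric n) (gradient_line e k \<sigma>) (gradient_line e k \<tau>) \<le> 3 * k ^ 4 * \<bar>\<sigma> - \<tau>\<bar>"
    if "0 \<le> \<sigma>" "0 \<le> \<tau>"
    unfolding gradient_line_def axial_point_dist[OF e(2,3)]
    by (rule gradient_curve_lipschitz[OF k that(2,1)])
  show "aronsson (axial n p \<eta> (gradient_line e k \<tau>)) = \<tau>" if "0 < \<tau>"
    unfolding gradient_line_def using axial_point_axial(1)[OF e(2,3)] aronsson_gradient_curve[OF k that]
    by (simp add: quadrant_def)
  have dot: "dotn n (gradient_line e k \<tau>) p = 1 + \<eta> - Re (gradient_curve k \<tau>)" if "0 \<le> \<tau>" for \<tau>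
    unfolding gradient_line_def using axial_point_axial(2)[OF e(2,3) gradient_curve_Im_nonneg[OF k that]] .
  show "gradient_line e k 0 \<notin> mspace (ball_metric n)"
    using dot[of 0] k \<eta> dotn_p_ball by (force simp: gradient_curve_def)
  show "gradient_line e k \<tau> \<notin> mspace (ball_metric n)" if \<tau>: "1 / k < \<tau>" "1 < \<tau>" "1 / \<eta> < \<tau>"
  proof -
    have "\<tau> ^ 1 \<le> \<tau> ^ 3" using \<tau> by (intro power_increasing) auto
    then have "1 / \<eta> < \<tau> ^ 3" using \<tau> by simp
    then have "1 / \<tau> ^ 3 < \<eta>" using \<tau> \<eta> by (simp add: field_simps)
    then have "dotn n (gradient_line e k \<tau>) p > 1" using dot[of \<tau>] \<tau> by (simp add: gradient_curve_def)
    then show ?thesis using dotn_p_ball by force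
  qed
qed

lemma gradient_line_through:
  assumes n: "1 < n" and x: "x \<in> mspace (ball_metric n)"
  obtains e k where "\<forall>i\<ge>n. e i = 0" "dotn n e e = 1" "dotn n e p = 0" "0 < k"
    "gradient_line e k (aronsson (axial n p \<eta> x)) = x"
    "aronsson_slope (axial n p \<eta> x) * (3 * k ^ 4) = 1" "k ^ 3 \<le> cmod (axial n p \<eta> x)"
proof -
  have "x \<in> mspace (euclid_metric n)" using x by (simp add: mspace_ball_metric)
  then obtain e where e: "\<forall>i\<ge>n. e i = 0" "dotn n e e = 1" "dotn n e p = 0"
    "axial_point p \<eta> e (axial n p \<eta> x) = x"
    using axial_direction[OF n] by blast
  obtain k where k: "0 < k" "gradient_curve k (aronsson (axial n p \<eta> x)) = axial n p \<eta> x"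
    "aronsson_slope (axial n p \<eta> x) * (3 * k ^ 4) = 1" "k ^ 3 \<le> cmod (axial n p \<eta> x)"
    using gradient_curve_through[OF axial_quadrant[OF x]] by blast
  show thesis by (rule that[OF e(1-3) k(1) _ k(3,4)]) (simp_all add: gradient_line_def k(2) e(4))
qed

theorem aronsson_absolutely_minimal:
  assumes n: "1 < n"
  shows "absolutely_minimal (ball_metric n) (unit_sphere n) (\<lambda>x. aronsson (axial n p \<eta> x))"
proof (rule absolutely_minimal_slopeI[OF geodesic_ball_metric, where \<rho> = "\<lambda>x. aronsson_slope (axial n p \<eta> x)"])
  obtain L where L: "0 < L" "\<And>z w. z \<in> quadrant \<Longrightarrow> w \<in> quadrant \<Longrightarrow> \<eta> \<le> Re z \<Longrightarrow> \<eta> \<le> Re w \<Longrightarrow>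
      Im z \<le> 1 \<Longrightarrow> Im w \<le> 1 \<Longrightarrow> \<bar>aronsson z - aronsson w\<bar> \<le> L * cmod (z - w)"
    using aronsson_lipschitz[OF \<eta> zero_le_one] by blast
  have "\<bar>aronsson (axial n p \<eta> x) - aronsson (axial n p \<eta> y)\<bar> \<le> L * mdist (ball_metric n) x y"
    if xy: "x \<in> mspace (ball_metric n)" "y \<in> mspace (ball_metric n)" for x y
  proof -
    have range: "\<eta> \<le> Re (axial n p \<eta> x) \<and> Im (axial n p \<eta> x) \<le> 1" if "x \<in> mspace (ball_metric n)" for x
    proof -
      have "dotn n x x - (dotn n x p)\<^sup>2 \<le> 1"
        using that zero_le_power2[of "dotn n x p"] unfolding mspace_ball_metric mem_Collect_eq by linarith
      then show ?thesis using dotn_p_ball[OF that] by (simp add: axial_def)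
    qed
    have "\<bar>aronsson (axial n p \<eta> x) - aronsson (axial n p \<eta> y)\<bar> \<le> L * cmod (axial n p \<eta> x - axial n p \<eta> y)"
      using range xy axial_quadrant by (intro L(2)) auto
    also have "\<dots> \<le> L * mdist (ball_metric n) x y"
      using axial_contraction[of \<eta> x y] L(1) by simp
    finally show ?thesis .
  qed
  then show "Lipschitz_continuous_map (ball_metric n) euclidean_metric (\<lambda>x. aronsson (axial n p \<eta> x))"
    unfolding Lipschitz_real_iff using L(1) by blast
next
  fix x and e :: real assume x: "x \<in> mspace (ball_metric n) - unit_sphere n" and e: "0 < e"
  let ?z = "axial n p \<eta> x"
  have z: "?z \<in> quadrant" using x axial_quadrant by blast
  have pos: "0 \<le> aronsson_slope ?z + e" using e by (simp add: aronsson_slope_def add_nonneg_nonneg)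
  obtain r where r: "r > 0" "\<And>w. w \<in> quadrant \<Longrightarrow> cmod (w - ?z) < r \<Longrightarrow>
      \<bar>aronsson w - aronsson ?z\<bar> \<le> (aronsson_slope ?z + e) * cmod (w - ?z)"
    using aronsson_local_slope[OF z e] by blast
  have "\<bar>aronsson (axial n p \<eta> y) - aronsson ?z\<bar> \<le> (aronsson_slope ?z + e) * mdist (ball_metric n) x y"
    if y: "y \<in> mspace (ball_metric n)" "mdist (ball_metric n) x y < r" for y
  proof -
    have d: "cmod (axial n p \<eta> y - ?z) \<le> mdist (ball_metric n) x y"
      using axial_contraction[of \<eta> x y] by (simp add: norm_minus_commute)
    have "\<bar>aronsson (axial n p \<eta> y) - aronsson ?z\<bar> \<le> (aronsson_slope ?z + e) * cmod (axial n p \<eta> y - ?z)"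
      using d y axial_quadrant by (intro r(2)) auto
    also have "\<dots> \<le> (aronsson_slope ?z + e) * mdist (ball_metric n) x y"
      using d pos by (rule mult_left_mono)
    finally show ?thesis .
  qed
  then show "\<exists>r>0. \<forall>y\<in>mspace (ball_metric n). mdist (ball_metric n) x y < r \<longrightarrow>
      \<bar>aronsson (axial n p \<eta> y) - aronsson ?z\<bar> \<le> (aronsson_slope ?z + e) * mdist (ball_metric n) x y"
    using r(1) by (intro exI[of _ r]) simp
next
  fix U x
  assume U: "openin (mtopology_of (ball_metric n)) U" "U \<subseteq> mspace (ball_metric n) - unit_sphere n"
    and x: "x \<in> U"
  have xb: "x \<in> mspace (ball_metric n)" using x U by auto
  define \<tau>0 where "\<tau>0 = aronsson (axial n p \<eta> x)"
  have \<tau>0: "0 < \<tau>0" using aronsson_pos[OF axial_quadrant[OF xb]] by (simp add: \<tau>0_def)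
  obtain e k where e: "\<forall>i\<ge>n. e i = 0" "dotn n e e = 1" "dotn n e p = 0" and k: "0 < k"
    and through: "gradient_line e k \<tau>0 = x" and slope: "aronsson_slope (axial n p \<eta> x) * (3 * k ^ 4) = 1"
    using gradient_line_through[OF n xb, folded \<tau>0_def] by blast
  note line = gradient_line[OF e k]
  let ?l = "gradient_line e k"
  note open_e = openin_euclid_of_ball[OF U]
  have UB: "U \<subseteq> mspace (ball_metric n)" using U by auto
  define T where "T = max \<tau>0 (max (1 / k) (max 1 (1 / \<eta>))) + 1"
  have T: "\<tau>0 \<le> T" "1 / k < T" "1 < T" "1 / \<eta> < T" by (auto simp: T_def)
  have lT: "?l T \<notin> U" using line(5)[OF T(2-4)] UB by blast
  obtain \<tau>b where \<tau>b: "\<tau>0 < \<tau>b" "\<tau>b \<le> T" "?l \<tau>b \<in> mtopology_of (euclid_metric n) frontier_of U"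
    by (rule first_exit[OF open_e(1) T(1), of "3 * k ^ 4" ?l])
      (use line(1,2) \<tau>0 x through k lT in auto)
  have "?l 0 \<notin> U" using line(4) UB by blast
  then have l0: "?l (\<tau>0 - \<tau>0) \<notin> U" by simp
  \<comment> \<open>The descent is the same line run backwards. An exit at the value 0 is then
    excluded, since the line starts outside the closed ball.\<close>
  obtain s where s: "0 < s" "s \<le> \<tau>0" "?l (\<tau>0 - s) \<in> mtopology_of (euclid_metric n) frontier_of U"
    by (rule first_exit[OF open_e(1), of 0 \<tau>0 "3 * k ^ 4" "\<lambda>t. ?l (\<tau>0 - t)"])
      (use line(1) line(2)[of "\<tau>0 - _" "\<tau>0 - _"] \<tau>0 x through k l0 in \<open>auto simp: abs_minus_commute\<close>)
  define \<tau>a where "\<tau>a = \<tau>0 - s"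
  have fr: "?l \<tau>a \<in> mtopology_of (ball_metric n) frontier_of U" "?l \<tau>b \<in> mtopology_of (ball_metric n) frontier_of U"
    using s \<tau>b open_e(2) by (auto simp: \<tau>a_def)
  then have "?l \<tau>a \<in> mspace (ball_metric n)" unfolding frontier_of_openin_iff[OF U(1)] by blast
  then have "\<tau>a \<noteq> 0" using line(4) by metis
  then have \<tau>a: "0 < \<tau>a" "\<tau>a < \<tau>b" using s \<tau>b by (auto simp: \<tau>a_def)
  have val: "aronsson (axial n p \<eta> (?l \<tau>a)) = \<tau>a" "aronsson (axial n p \<eta> (?l \<tau>b)) = \<tau>b"
    using line(3) \<tau>a by auto
  \<comment> \<open>The chord is no longer than the line, whose speed is at most 3 k^4, the
    reciprocal of the slope at x.\<close>
  have "aronsson_slope (axial n p \<eta> x) * mdist (ball_metric n) (?l \<tau>a) (?l \<tau>b) \<le>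
      aronsson_slope (axial n p \<eta> x) * (3 * k ^ 4 * (\<tau>b - \<tau>a))"
    using line(2)[of \<tau>a \<tau>b] \<tau>a by (intro mult_left_mono) (auto simp: aronsson_slope_def)
  also have "\<dots> = (aronsson_slope (axial n p \<eta> x) * (3 * k ^ 4)) * (\<tau>b - \<tau>a)" by (simp add: mult_ac)
  also have "\<dots> = \<tau>b - \<tau>a" unfolding slope by simp
  finally show "\<exists>a\<in>mtopology_of (ball_metric n) frontier_of U. \<exists>b\<in>mtopology_of (ball_metric n) frontier_of U.
      a \<noteq> b \<and> aronsson_slope (axial n p \<eta> x) * mdist (ball_metric n) a b
        \<le> aronsson (axial n p \<eta> b) - aronsson (axial n p \<eta> a)"
    using fr val \<tau>a by (intro bexI[of _ "?l \<tau>a"] bexI[of _ "?l \<tau>b"]) auto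
qed

text \<open>Ascending the gradient line for the time \<epsilon> / (3 k^4) stays within \<epsilon> of
  x and gains exactly that amount. On the ball the distance from the pole is at most 3, so k \<le> 3
  and 3 k^4 \<le> 243.\<close>

lemma aronsson_growth:
  assumes n: "1 < n" and \<eta>1: "\<eta> \<le> 1" and x: "x \<in> mspace (ball_metric n)" and \<epsilon>: "0 < \<epsilon>"
    and sub: "\<And>y. y \<in> mspace (ball_metric n) \<Longrightarrow> mdist (ball_metric n) x y \<le> \<epsilon> \<Longrightarrow> y \<notin> unit_sphere n"
  shows "\<exists>y\<in>mspace (ball_metric n). mdist (ball_metric n) x y \<le> \<epsilon> \<and>
    aronsson (axial n p \<eta> x) + \<epsilon> / 243 \<le> aronsson (axial n p \<eta> y)"
proof -
  define \<tau>0 where "\<tau>0 = aronsson (axial n p \<eta> x)"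
  have \<tau>0: "0 < \<tau>0" using aronsson_pos[OF axial_quadrant[OF x]] by (simp add: \<tau>0_def)
  obtain e k where e: "\<forall>i\<ge>n. e i = 0" "dotn n e e = 1" "dotn n e p = 0" and k: "0 < k"
    and through: "gradient_line e k \<tau>0 = x" and k3: "k ^ 3 \<le> cmod (axial n p \<eta> x)"
    using gradient_line_through[OF n x, folded \<tau>0_def] by blast
  note line = gradient_line[OF e k]
  let ?l = "gradient_line e k"
  have "(cmod (axial n p \<eta> x))\<^sup>2 \<le> 3\<^sup>2"
  proof -
    have "- dotn n x p \<le> 1" using dotn_p_ball[OF x] by linarith
    then have "(1 + \<eta>) * (- dotn n x p) \<le> (1 + \<eta>) * 1" using \<eta> by (intro mult_left_mono) auto
    moreover have "(1 + \<eta>)\<^sup>2 \<le> 2\<^sup>2" using \<eta> \<eta>1 by (intro power_mono) auto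
    moreover have "dotn n x x \<le> 1" using x by (simp add: mspace_ball_metric)
    moreover have "(cmod (axial n p \<eta> x))\<^sup>2 = (1 + \<eta>)\<^sup>2 + 2 * ((1 + \<eta>) * (- dotn n x p)) + dotn n x x"
      unfolding axial_norm by simp
    ultimately show ?thesis using \<eta>1 by simp
  qed
  then have "cmod (axial n p \<eta> x) \<le> 3" by (rule power2_le_imp_le) simp
  then have "k ^ 3 \<le> 3 ^ 3" using k3 by simp
  then have "k ^ Suc 2 \<le> 3 ^ Suc 2" by (simp add: eval_nat_numeral)
  then have "k \<le> 3" by (rule power_le_imp_le_base) simp
  then have k4: "3 * k ^ 4 \<le> 243" using power_mono[of k 3 4] k by simp
  define \<tau>1 where "\<tau>1 = \<tau>0 + \<epsilon> / (3 * k ^ 4)"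
  have \<tau>1: "\<tau>0 < \<tau>1" "3 * k ^ 4 * (\<tau>1 - \<tau>0) = \<epsilon>" using \<epsilon> k by (auto simp: \<tau>1_def)
  have near: "mdist (euclid_metric n) x (?l \<tau>) \<le> \<epsilon>" if "\<tau>0 \<le> \<tau>" "\<tau> \<le> \<tau>1" for \<tau>
  proof -
    have "mdist (euclid_metric n) x (?l \<tau>) \<le> 3 * k ^ 4 * (\<tau> - \<tau>0)"
      using line(2)[of \<tau>0 \<tau>] that \<tau>0 through by (simp add: abs_minus_commute)
    also have "\<dots> \<le> 3 * k ^ 4 * (\<tau>1 - \<tau>0)" using that k by (intro mult_left_mono) auto
    finally show ?thesis using \<tau>1 by simp
  qed
  define V where "V = {y \<in> mspace (ball_metric n). y \<notin> unit_sphere n}"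
  have o: "origin \<in> mspace (euclid_metric n)" by simp
  have V: "V = {y \<in> mspace (euclid_metric n). mdist (euclid_metric n) origin y < 1}"
    by (auto simp: V_def mspace_ball_metric unit_sphere_iff euclid_dist_origin less_le)
  have V_open: "openin (mtopology_of (euclid_metric n)) V"
    unfolding openin_mtopology_of_iff
  proof (intro conjI ballI)
    fix y assume "y \<in> V"
    then have y: "y \<in> mspace (euclid_metric n)" "mdist (euclid_metric n) origin y < 1" by (auto simp: V)
    have "z \<in> V" if "z \<in> mspace (euclid_metric n)"
      "mdist (euclid_metric n) y z < 1 - mdist (euclid_metric n) origin y" for z
      using mdist_triangle[OF o y(1) that(1)] that unfolding V mem_Collect_eq by linarith
    then show "\<exists>r>0. \<forall>z\<in>mspace (euclid_metric n). mdist (euclid_metric n) y z < r \<longrightarrow> z \<in> V"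
      using y(2) by (intro exI[of _ "1 - mdist (euclid_metric n) origin y"]) simp
  qed (auto simp: V)
  have xV: "x \<in> V"
  proof -
    have "mdist (ball_metric n) x x = 0" using x mdist_zero[of x "ball_metric n" x] by blast
    then show ?thesis using sub[OF x] \<epsilon> x by (simp add: V_def)
  qed
  have "?l \<tau>1 \<in> V"
  \<comment> \<open>Leaving the open ball would produce a point of the sphere within \<epsilon> of
    x.\<close>
  proof (rule ccontr)
    assume l1: "?l \<tau>1 \<notin> V"
    obtain \<tau> where \<tau>: "\<tau>0 < \<tau>" "\<tau> \<le> \<tau>1" "?l \<tau> \<in> mtopology_of (euclid_metric n) frontier_of V"
      by (rule first_exit[OF V_open, of \<tau>0 \<tau>1 "3 * k ^ 4" ?l])
        (use line(1,2) \<tau>0 \<tau>1 xV through k l1 in auto)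
    have "mdist (euclid_metric n) origin (?l \<tau>) \<le> 1"
      by (rule frontier_dist_le[OF V_open o _ \<tau>(3)]) (simp add: V)
    then have "?l \<tau> \<in> mspace (ball_metric n)"
      using line(1)[of \<tau>] by (simp add: mspace_ball_metric euclid_dist_origin)
    moreover have "?l \<tau> \<notin> V" using \<tau>(3) unfolding frontier_of_openin_iff[OF V_open] by blast
    ultimately show False
      using sub[of "?l \<tau>"] near[of \<tau>] \<tau> unfolding V_def by auto
  qed
  moreover have "aronsson (axial n p \<eta> (?l \<tau>1)) = \<tau>1" using line(3) \<tau>0 \<tau>1 by simp
  moreover have "\<epsilon> / 243 \<le> \<epsilon> / (3 * k ^ 4)" using k4 k \<epsilon> by (intro divide_left_mono) auto
  ultimately show ?thesis
    using near[of \<tau>1] \<tau>1 by (intro bexI[of _ "?l \<tau>1"]) (auto simp: V_def \<tau>0_def \<tau>1_def)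
qed

end

end

section \<open>The harmonic measure of a cap\<close>

lemma root3_scale: "0 \<le> c \<Longrightarrow> 0 \<le> \<delta> \<Longrightarrow> root 3 (c * \<delta>) = root 3 c * \<delta> powr (1/3)"
  by (cases "\<delta> = 0") (simp_all add: real_root_mult root_powr_inverse)

lemma infharm_le:
  assumes "\<And>z. z \<in> mspace m \<Longrightarrow> 0 \<le> u z" "absolutely_minimal m Y u" "\<And>a. a \<in> A \<Longrightarrow> 1 \<le> u a" "x \<in> mspace m"
  shows "infharm x Y m A \<le> u x"
  unfolding infharm_def
  by (rule cInf_lower) (use assms in \<open>auto intro!: bdd_belowI[of _ 0]\<close>)

text \<open>A real infimum is a greatest lower bound only over a nonempty set; the constant 1 is a
  competitor.\<close>

lemma infharm_greatest:
  assumes "\<And>u. (\<And>z. z \<in> mspace m \<Longrightarrow> 0 \<le> u z) \<Longrightarrow> absolutely_minimal m Y u \<Longrightarrow> (\<And>a. a \<in> A \<Longrightarrow> 1 \<le> u a) \<Longrightarrow> c \<le> u x"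
  shows "c \<le> infharm x Y m A"
  unfolding infharm_def
proof (rule cInf_greatest)
  have "1 \<in> {u x |u. (\<forall>z\<in>mspace m. 0 \<le> u z) \<and> absolutely_minimal m Y u \<and> (\<forall>a\<in>A. 1 \<le> u a)}"
    by (intro CollectI exI[of _ "\<lambda>_. 1"]) (simp add: absolutely_minimal_const)
  then show "{u x |u. (\<forall>z\<in>mspace m. 0 \<le> u z) \<and> absolutely_minimal m Y u \<and> (\<forall>a\<in>A. 1 \<le> u a)} \<noteq> {}"
    by (metis empty_iff)
qed (use assms in auto)

lemma spherical_cap_iff:
  assumes "p \<in> unit_sphere n" "0 \<le> \<delta>"
  shows "y \<in> spherical_cap n p \<delta> \<longleftrightarrow> y \<in> unit_sphere n \<and> 1 - dotn n y p \<le> \<delta>\<^sup>2 / 2"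
proof -
  have "mdist (euclid_metric n) y p \<le> \<delta> \<longleftrightarrow> (mdist (euclid_metric n) y p)\<^sup>2 \<le> \<delta>\<^sup>2"
    using assms(2) by (simp add: abs_le_square_iff[symmetric])
  then show ?thesis
    using assms(1) by (auto simp: spherical_cap_def euclid_dist_power2 unit_sphere_iff)
qed

lemma axial_origin: "axial n p \<eta> origin = Complex (1 + \<eta>) 0"
  by (simp add: axial_def)

section \<open>The upper bound\<close>

text \<open>Seen from the pole, cap points have Re between \<delta> and 2 \<delta>, Im at most
  \<delta>, and slope parameter at most 2. Hence the envelope there is at most 2 \<delta> + 2
  \<delta> (2 + 2^3) = 22 \<delta>, against at least 1 at the center.\<close>

lemma infharm_cap_upper:
  assumes n: "1 < n" and \<delta>: "0 < \<delta>" "\<delta> \<le> 2" and p: "p \<in> unit_sphere n"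
  shows "infharm origin (unit_sphere n) (ball_metric n) (spherical_cap n p \<delta>) \<le> 3 * \<delta> powr (1/3)"
proof -
  define l where "l = root 3 (22 * \<delta>)"
  have l: "0 < l" "l ^ 3 = 22 * \<delta>" using \<delta> by (auto simp: l_def)
  \<comment> \<open>The summand 0 gives u the form \<open>c * f + k\<close> of
    \<open>absolutely_minimal_affine\<close>.\<close>
  define u where "u x = l * aronsson (axial n p \<delta> x) + 0" for x
  note quad = axial_quadrant[OF p \<delta>(1)]
  have "infharm origin (unit_sphere n) (ball_metric n) (spherical_cap n p \<delta>) \<le> u origin"
  proof (rule infharm_le)
    show "absolutely_minimal (ball_metric n) (unit_sphere n) u"
      unfolding u_def by (intro absolutely_minimal_affine aronsson_absolutely_minimal p \<delta> n)
  next
    fix z assume "z \<in> mspace (ball_metric n)"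
    then show "0 \<le> u z" using aronsson_pos[OF quad] l by (simp add: u_def less_imp_le)
  next
    fix y assume "y \<in> spherical_cap n p \<delta>"
    then have y: "y \<in> unit_sphere n" "1 - dotn n y p \<le> \<delta>\<^sup>2 / 2"
      using spherical_cap_iff[OF p] \<delta> by auto
    define z where "z = axial n p \<delta> y"
    have yb: "y \<in> mspace (ball_metric n)" using y unit_sphere_subset by blast
    have z: "z \<in> quadrant" unfolding z_def by (rule quad[OF yb])
    have a: "dotn n y p \<le> 1" using dotn_p_ball[OF p yb] by linarith
    have "\<delta>\<^sup>2 / 2 \<le> \<delta>" using \<delta> mult_left_mono[of \<delta> 2 \<delta>] by (simp add: power2_eq_square)
    then have Re: "\<delta> \<le> Re z" "Re z \<le> 2 * \<delta>" using a y(2) by (auto simp: z_def axial_def)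
    have "1 - (dotn n y p)\<^sup>2 = (1 - dotn n y p) * (1 + dotn n y p)" by algebra
    also have "\<dots> \<le> (\<delta>\<^sup>2 / 2) * 2" using a y(2) dotn_p_ball[OF p yb] by (intro mult_mono) auto
    finally have "sqrt (1 - (dotn n y p)\<^sup>2) \<le> \<delta>" using \<delta> by (intro real_le_lsqrt) auto
    then have Im: "0 \<le> Im z" "Im z \<le> \<delta>"
      using y(1) z by (auto simp: z_def axial_def unit_sphere_iff quadrant_def)
    define t where "t = slope_param z"
    \<comment> \<open>At 2 the criterion reads 13 Im z < 16 Re z, and \<delta> separates Im z from
      Re z.\<close>
    have t: "0 \<le> t" "t \<le> 2"
      using slope_param(1)[OF z] slope_param_less_iff[OF z, of 2] Re Im \<delta> by (auto simp: t_def)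
    have "envelope z \<le> Re z + 2 * Im z * (t + t ^ 3)"
      using Re \<delta> t by (simp add: envelope_def support_form_def t_def[symmetric] right_diff_distrib)
    also have "\<dots> \<le> 2 * \<delta> + 2 * \<delta> * (2 + 2 ^ 3)"
      using Re Im \<delta> t by (intro add_mono mult_mono power_mono) auto
    finally have env: "envelope z \<le> 22 * \<delta>" by simp
    have "1 / l \<le> aronsson z"
    proof (rule aronsson_antimono'[OF z])
      have "(1 / l) ^ 3 * envelope z \<le> (1 / l) ^ 3 * (22 * \<delta>)"
        using env l by (intro mult_left_mono) auto
      also have "\<dots> = 1" using l \<delta> by (simp add: power_divide)
      finally show "(1 / l) ^ 3 * envelope z \<le> 1" .
    qed (use l in simp)
    then show "1 \<le> u y" using l by (simp add: u_def z_def field_simps)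
  qed (rule origin_in_ball)
  also have "u origin \<le> l"
  proof -
    have z: "axial n p \<delta> origin \<in> quadrant" by (rule quad[OF origin_in_ball])
    then have "1 \<le> envelope (axial n p \<delta> origin)"
      using envelope_ge_Re[OF z] \<delta> by (simp add: axial_origin)
    then have "aronsson (axial n p \<delta> origin) \<le> 1" by (intro aronsson_antimono[OF z]) auto
    then show ?thesis using l by (simp add: u_def)
  qed
  also have "l = root 3 22 * \<delta> powr (1/3)" unfolding l_def using \<delta> by (intro root3_scale) auto
  also have "\<dots> \<le> 3 * \<delta> powr (1/3)"
  proof (rule mult_right_mono)
    have "root 3 22 \<le> root 3 (3 ^ 3)" by (rule real_root_le_mono) auto
    also have "\<dots> = 3" by (rule real_root_power_cancel) auto
    finally show "root 3 22 \<le> 3" .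
  qed simp
  finally show ?thesis .
qed

section \<open>The lower bound\<close>

text \<open>
  On the unit sphere the choice \<open>t = sqrt ((1 + a) / (1 - a))\<close>, the ratio of the two axial
  coordinates with respect to \<open>p\<close> itself, makes \<open>support_form t\<close> equal to \<open>2 * (1 + t\<^sup>2)\<close> when \<open>\<eta> = 0\<close>.
\<close>

lemma envelope_sphere_ge:
  assumes p: "p \<in> unit_sphere n" and \<eta>: "0 < \<eta>" and y: "y \<in> unit_sphere n"
    and far: "4 * \<eta> \<le> 1 - dotn n y p"
  shows "3 / 2 \<le> envelope (axial n p \<eta> y)"
proof -
  define a where "a = dotn n y p"
  have yb: "y \<in> mspace (ball_metric n)" using y unit_sphere_subset by blast
  have z: "axial n p \<eta> y \<in> quadrant" by (rule axial_quadrant[OF p \<eta> yb])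
  have a: "-1 \<le> a" "0 < 1 - a" using dotn_p_ball[OF p yb] far \<eta> by (auto simp: a_def)
  define t where "t = sqrt ((1 + a) / (1 - a))"
  have t: "0 \<le> t" "(1 - a) * t\<^sup>2 = 1 + a" using a by (auto simp: t_def)
  have "((1 - a) * t)\<^sup>2 = (1 - a) * ((1 - a) * t\<^sup>2)" by algebra
  also have "\<dots> = 1 - a\<^sup>2" unfolding t(2) by algebra
  finally have "sqrt (1 - a\<^sup>2) = (1 - a) * t" using a t(1) by (intro real_sqrt_unique) auto
  then have coord: "Re (axial n p \<eta> y) = \<eta> + (1 - a)" "Im (axial n p \<eta> y) = (1 - a) * t"
    using y by (auto simp: axial_def a_def unit_sphere_iff)
  have "support_form t (axial n p \<eta> y) = (1 + t\<^sup>2) * ((1 - a) * (1 + t\<^sup>2)) + (1 + t\<^sup>2) * (\<eta> * (1 - t\<^sup>2))"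
    unfolding support_form_def coord by algebra
  also have "(1 - a) * (1 + t\<^sup>2) = (1 - a) + (1 - a) * t\<^sup>2" by algebra
  also have "\<dots> = 2" unfolding t(2) by simp
  finally have form: "support_form t (axial n p \<eta> y) = (1 + t\<^sup>2) * (2 + \<eta> * (1 - t\<^sup>2))"
    by (simp add: algebra_simps)
  \<comment> \<open>The displacement of the pole costs at most 1/2 of the value 2.\<close>
  have "\<eta> * t\<^sup>2 \<le> (1 - a) / 4 * t\<^sup>2" using far by (intro mult_right_mono) (auto simp: a_def)
  also have "\<dots> = (1 + a) / 4" using t(2) by simp
  also have "\<dots> \<le> 1 / 2" using a by simp
  finally have "3 / 2 \<le> 2 + \<eta> * (1 - t\<^sup>2)" using \<eta> by (simp add: right_diff_distrib)
  then have "1 * (3 / 2) \<le> (1 + t\<^sup>2) * (2 + \<eta> * (1 - t\<^sup>2))" by (intro mult_mono) auto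
  then show ?thesis using support_form_le_envelope[OF z, of t] form by linarith
qed

text \<open>The forms at t = 0 and t = 1 are Re z and 4 Im z, and |z| is at most Re z + Im
  z.\<close>

lemma envelope_ge_norm:
  assumes z: "z \<in> quadrant"
  shows "4 / 5 * cmod z \<le> envelope z"
proof -
  have "cmod z \<le> Re z + Im z"
    using cmod_le[of z] z by (simp add: quadrant_def)
  moreover have "Re z \<le> envelope z" by (rule envelope_ge_Re[OF z])
  moreover have "4 * Im z \<le> envelope z"
    using support_form_le_envelope[OF z, of 1] by (simp add: support_form_def)
  ultimately show ?thesis by simp
qed

text \<open>Pushing the pole outwards from p along the axis moves it away from every point of the
  ball.\<close>

lemma axial_norm_ge:
  assumes p: "p \<in> unit_sphere n" and \<eta>: "0 < \<eta>" and y: "y \<in> mspace (ball_metric n)"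
  shows "mdist (euclid_metric n) p y \<le> cmod (axial n p \<eta> y)"
proof (rule power2_le_imp_le)
  have "(cmod (axial n p \<eta> y))\<^sup>2 = (mdist (euclid_metric n) p y)\<^sup>2 + \<eta>\<^sup>2 + 2 * (\<eta> * (1 - dotn n y p))"
    unfolding axial_norm[OF p] euclid_dist_power2 dotn_commute[of n p y] dotn_pp[OF p] by algebra
  moreover have "0 \<le> \<eta> * (1 - dotn n y p)" using \<eta> dotn_p_ball[OF p y] by simp
  ultimately show "(mdist (euclid_metric n) p y)\<^sup>2 \<le> (cmod (axial n p \<eta> y))\<^sup>2" by simp
qed simp

lemma openin_ball_interior: "openin (mtopology_of (ball_metric n)) (mspace (ball_metric n) - unit_sphere n)"
proof -
  have "mspace (ball_metric n) - unit_sphere n = mball_of (ball_metric n) origin 1"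
    using origin_in_ball[of n]
    by (auto simp: mspace_ball_metric unit_sphere_iff euclid_dist_origin less_le)
  then show ?thesis using openin_mball_of by metis
qed

text \<open>The cone has vertex p, height 1 and slope 1 / \<delta>. On the sphere within distance
  \<delta> lies the cap, where u is at least 1; at distance \<delta> the cone has come down to 0.
  Its vertex is on the sphere, outside the domain of comparison, as the cone lemma permits.\<close>

lemma absolutely_minimal_near_cap:
  assumes p: "p \<in> unit_sphere n" and \<delta>: "0 < \<delta>" and u: "absolutely_minimal (ball_metric n) (unit_sphere n) u"
    and nonneg: "\<And>z. z \<in> mspace (ball_metric n) \<Longrightarrow> 0 \<le> u z" and cap: "\<And>a. a \<in> spherical_cap n p \<delta> \<Longrightarrow> 1 \<le> u a"
    and x: "x \<in> mspace (ball_metric n)" "mdist (euclid_metric n) p x \<le> \<delta>"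
  shows "1 - mdist (euclid_metric n) p x / \<delta> \<le> u x"
proof -
  let ?m = "ball_metric n"
  have pm: "p \<in> mspace ?m" using p unit_sphere_subset by blast
  have onY: "1 \<le> u y" if "y \<in> unit_sphere n" "mdist (euclid_metric n) p y \<le> \<delta>" for y
    using cap[of y] that by (simp add: spherical_cap_def mdist_commute)
  show ?thesis
  proof (cases "x \<in> unit_sphere n \<or> mdist (euclid_metric n) p x = \<delta>")
    case True
    then show ?thesis
    proof
      assume "x \<in> unit_sphere n"
      then have "1 \<le> u x" using onY x by blast
      moreover have "0 \<le> mdist (euclid_metric n) p x / \<delta>" using \<delta> by simp
      ultimately show ?thesis by linarith
    qed (use nonneg[OF x(1)] \<delta> in simp)
  next
    case False
    define V where "V = {y \<in> mspace ?m. y \<notin> unit_sphere n \<and> mdist ?m p y < \<delta>}"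
    have V: "openin (mtopology_of ?m) V"
    proof -
      have "V = (mspace ?m - unit_sphere n) \<inter> mball_of ?m p \<delta>" using pm by (auto simp: V_def)
      then show ?thesis using openin_ball_interior openin_mball_of by (metis openin_Int)
    qed
    have "1 - 1 / \<delta> * mdist ?m p x \<le> u x"
    proof (rule absolutely_minimal_cone_below[OF geodesic_ball_metric u V])
      show "1 \<le> u p" using onY[OF p] pm \<delta> mdist_zero[of p ?m p] by auto
      show "x \<in> V" using False x by (simp add: V_def less_le)
      fix y assume y: "y \<in> mtopology_of ?m frontier_of V"
      then have ym: "y \<in> mspace ?m" "y \<notin> V" using frontier_of_openin_iff[OF V] by auto
      have d: "mdist ?m p y \<le> \<delta>" by (rule frontier_dist_le[OF V pm _ y]) (simp add: V_def)
      show "1 - 1 / \<delta> * mdist ?m p y \<le> u y"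
      proof (cases "y \<in> unit_sphere n")
        case True
        then have "1 \<le> u y" using onY d by simp
        moreover have "0 \<le> 1 / \<delta> * mdist ?m p y" using \<delta> by simp
        ultimately show ?thesis by linarith
      next
        case False
        then have "mdist ?m p y = \<delta>" using ym d by (simp add: V_def less_le)
        then show ?thesis using nonneg[OF ym(1)] \<delta> by simp
      qed
    qed (use pm \<delta> in \<open>auto simp: V_def\<close>)
    then show ?thesis by simp
  qed
qed

lemma absolutely_minimal_bounded:
  assumes "absolutely_minimal (ball_metric n) Y u"
  obtains B where "\<And>x. x \<in> mspace (ball_metric n) \<Longrightarrow> \<bar>u x\<bar> \<le> B"
proof -
  obtain L where L: "L > 0" "\<And>x y. x \<in> mspace (ball_metric n) \<Longrightarrow> y \<in> mspace (ball_metric n) \<Longrightarrow>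
      \<bar>u x - u y\<bar> \<le> L * mdist (ball_metric n) x y"
    using assms unfolding absolutely_minimal_def Lipschitz_real_iff by blast
  have "\<bar>u x\<bar> \<le> \<bar>u origin\<bar> + L" if x: "x \<in> mspace (ball_metric n)" for x
  proof -
    have "mdist (ball_metric n) origin x \<le> 1"
      using x by (simp add: euclid_dist_origin mspace_ball_metric)
    then have "L * mdist (ball_metric n) origin x \<le> L * 1" using L(1) by (intro mult_left_mono) auto
    then show ?thesis using L(2)[OF origin_in_ball x] by linarith
  qed
  then show thesis using that by blast
qed

text \<open>The comparison takes place in the open ball beyond distance \<delta>/2 from p, a domain
  that contains the center because \<delta> < 2.\<close>

lemma absolutely_minimal_cap_lower:
  assumes n: "1 < n" and \<delta>: "0 < \<delta>" "\<delta> < 2" and p: "p \<in> unit_sphere n"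
    and u: "absolutely_minimal (ball_metric n) (unit_sphere n) u"
    and nonneg: "\<And>z. z \<in> mspace (ball_metric n) \<Longrightarrow> 0 \<le> u z" and cap: "\<And>a. a \<in> spherical_cap n p \<delta> \<Longrightarrow> 1 \<le> u a"
  shows "root 3 (2 / 5 * \<delta>) / 2 * (root 3 (8 / 9) - root 3 (2 / 3)) \<le> u origin"
proof -
  let ?m = "ball_metric n"
  \<comment> \<open>At distance \<delta>/2 from p a point of the sphere has
    \<open>1 - dotn n y p\<close> equal to \<delta>^2/8, which is 4 \<eta>.\<close>
  define \<eta> where "\<eta> = \<delta>\<^sup>2 / 32"
  have "\<delta>\<^sup>2 \<le> 2\<^sup>2" using \<delta> by (intro power_mono) auto
  then have \<eta>: "0 < \<eta>" "\<eta> \<le> 1 / 8" using \<delta> by (auto simp: \<eta>_def)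
  \<comment> \<open>The value of \<open>aronsson\<close> where the envelope is 3/2.\<close>
  define K where "K = root 3 (2 / 3)"
  have K: "0 < K" "K ^ 3 = 2 / 3" by (auto simp: K_def)
  \<comment> \<open>At distance \<delta>/2 from p the envelope is at least 4/5 of \<delta>/2, so
    \<open>aronsson\<close> is at most 1/r and the factor r/2 brings it down to 1/2.\<close>
  define r where "r = root 3 (2 / 5 * \<delta>)"
  have r: "0 < r" "r ^ 3 = 2 / 5 * \<delta>" using \<delta> by (auto simp: r_def)
  define v where "v x = r / 2 * aronsson (axial n p \<eta> x) + - (r / 2 * K)" for x
  have v: "absolutely_minimal ?m (unit_sphere n) v"
    unfolding v_def by (intro absolutely_minimal_affine aronsson_absolutely_minimal p \<eta> n)
  have pm: "p \<in> mspace ?m" using p unit_sphere_subset by blast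
  note quad = axial_quadrant[OF p \<eta>(1)]
  define D where "D = {x \<in> mspace ?m. x \<notin> unit_sphere n \<and> \<delta> / 2 < mdist ?m p x}"
  have D: "openin (mtopology_of ?m) D"
  proof -
    have "D = (mspace ?m - unit_sphere n) - mcball_of ?m p (\<delta> / 2)" using pm by (auto simp: D_def)
    then show ?thesis using openin_ball_interior closedin_mcball_of by (metis openin_diff)
  qed
  have far: "4 * \<eta> \<le> 1 - dotn n y p" if y: "y \<in> unit_sphere n" "\<delta> / 2 \<le> mdist ?m p y" for y
  proof -
    have "2 * (1 - dotn n y p) = (mdist ?m p y)\<^sup>2"
      using y(1) p by (simp add: euclid_dist_power2 unit_sphere_iff dotn_commute[of n p y])
    moreover have "(\<delta> / 2)\<^sup>2 \<le> (mdist ?m p y)\<^sup>2" using y(2) \<delta> by (intro power_mono) auto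
    ultimately show ?thesis by (simp add: \<eta>_def power_divide)
  qed
  have sphere: "v y \<le> 0" if y: "y \<in> unit_sphere n" "\<delta> / 2 \<le> mdist ?m p y" for y
  proof -
    have z: "axial n p \<eta> y \<in> quadrant" using y unit_sphere_subset quad by blast
    have "K ^ 3 * (3 / 2) \<le> K ^ 3 * envelope (axial n p \<eta> y)"
      using K(1) envelope_sphere_ge[OF p \<eta>(1) y(1) far[OF y]] by (intro mult_left_mono) auto
    then have "aronsson (axial n p \<eta> y) \<le> K"
      by (intro aronsson_antimono[OF z K(1)]) (simp add: K(2))
    then have "r / 2 * aronsson (axial n p \<eta> y) \<le> r / 2 * K" using r by (intro mult_left_mono) auto
    then show ?thesis by (simp add: v_def)
  qed
  have near: "v y \<le> 1 / 2" if y: "y \<in> mspace ?m" "mdist ?m p y = \<delta> / 2" for y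
  proof -
    have "2 / 5 * \<delta> \<le> envelope (axial n p \<eta> y)"
      using envelope_ge_norm[OF quad[OF y(1)]] axial_norm_ge[OF p \<eta>(1) y(1)] y(2) by simp
    then have "(1 / r) ^ 3 * (r ^ 3) \<le> (1 / r) ^ 3 * envelope (axial n p \<eta> y)"
      unfolding r(2) using r(1) by (intro mult_left_mono) auto
    then have "aronsson (axial n p \<eta> y) \<le> 1 / r"
      using quad[OF y(1)] r(1) by (intro aronsson_antimono) (auto simp: power_divide)
    then have "r / 2 * aronsson (axial n p \<eta> y) \<le> 1 / 2" using r(1) by (simp add: field_simps)
    moreover have "0 \<le> r / 2 * K" using r K by simp
    ultimately show ?thesis unfolding v_def by linarith
  qed
  obtain B1 where B1: "\<And>x. x \<in> mspace ?m \<Longrightarrow> \<bar>u x\<bar> \<le> B1"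
    using absolutely_minimal_bounded[OF u] by blast
  obtain B2 where B2: "\<And>x. x \<in> mspace ?m \<Longrightarrow> \<bar>v x\<bar> \<le> B2"
    using absolutely_minimal_bounded[OF v] by blast
  have "v origin \<le> u origin"
  \<comment> \<open>The rate is the growth 1/243 of \<open>aronsson\<close> scaled by r/2.\<close>
  proof (rule absolutely_minimal_comparison[OF geodesic_ball_metric u v D, where B = "max B1 B2" and \<kappa> = "r / 486"])
    show "D \<subseteq> mspace ?m - unit_sphere n" by (auto simp: D_def)
    show "\<bar>u x\<bar> \<le> max B1 B2" "\<bar>v x\<bar> \<le> max B1 B2" if "x \<in> mspace ?m" for x
      using B1[OF that] B2[OF that] by auto
    show "0 < r / 486" using r by simp
    have "mdist ?m p origin = 1"
      using p mdist_commute[of "euclid_metric n" p origin] by (simp add: euclid_dist_origin unit_sphere_iff)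
    then show "origin \<in> D" using \<delta> origin_in_ball by (simp add: D_def unit_sphere_iff)
  next
    fix y assume y: "y \<in> mtopology_of ?m frontier_of D"
    then have ym: "y \<in> mspace ?m" "y \<notin> D" using frontier_of_openin_iff[OF D] by auto
    have d: "\<delta> / 2 \<le> mdist ?m p y" by (rule frontier_dist_ge[OF D pm _ y]) (simp add: D_def)
    show "v y \<le> u y"
    proof (cases "y \<in> unit_sphere n")
      case True
      then show ?thesis using sphere[OF _ d] nonneg[OF ym(1)] by force
    next
      case False
      then have eq: "mdist ?m p y = \<delta> / 2" using ym d by (simp add: D_def)
      then have "1 - mdist (euclid_metric n) p y / \<delta> \<le> u y"
        using \<delta> by (intro absolutely_minimal_near_cap[OF p \<delta>(1) u nonneg cap ym(1)]) auto
      moreover have "mdist (euclid_metric n) p y / \<delta> = 1 / 2" using eq \<delta> by simp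
      ultimately show ?thesis using near[OF ym(1) eq] by simp
    qed
  next
    fix x and \<epsilon> :: real assume x: "x \<in> D" and \<epsilon>: "0 < \<epsilon>"
      and sub: "\<And>y. y \<in> mspace ?m \<Longrightarrow> mdist ?m x y \<le> \<epsilon> \<Longrightarrow> y \<in> D"
    have xm: "x \<in> mspace ?m" using x by (simp add: D_def)
    have \<eta>1: "\<eta> \<le> 1" using \<eta> by simp
    have "y \<notin> unit_sphere n" if "y \<in> mspace ?m" "mdist ?m x y \<le> \<epsilon>" for y
      using sub[OF that] by (simp add: D_def)
    then obtain y where y: "y \<in> mspace ?m" "mdist ?m x y \<le> \<epsilon>"
      "aronsson (axial n p \<eta> x) + \<epsilon> / 243 \<le> aronsson (axial n p \<eta> y)"
      using aronsson_growth[OF p \<eta>(1) n \<eta>1 xm \<epsilon>] by blast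
    have "r / 2 * (aronsson (axial n p \<eta> x) + \<epsilon> / 243) \<le> r / 2 * aronsson (axial n p \<eta> y)"
      using y(3) r by (intro mult_left_mono) auto
    then have "v x + r / 486 * \<epsilon> \<le> v y" by (simp add: v_def algebra_simps)
    then show "\<exists>y\<in>mspace ?m. mdist ?m x y \<le> \<epsilon> \<and> v x + r / 486 * \<epsilon> \<le> v y" using y by blast
  qed
  moreover have "root 3 (8 / 9) \<le> aronsson (axial n p \<eta> origin)"
  proof (rule aronsson_antimono'[OF quad[OF origin_in_ball]])
    \<comment> \<open>The center is on the axis, so its envelope is Re = 1 + \<eta>, at most
      9/8.\<close>
    have "slope_param (axial n p \<eta> origin) = 0"
      using \<eta> by (intro slope_param_eqI quad[OF origin_in_ball]) (auto simp: axial_origin)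
    then have "envelope (axial n p \<eta> origin) = 1 + \<eta>"
      using \<eta> by (simp add: envelope_def support_form_def axial_origin)
    then show "root 3 (8 / 9) ^ 3 * envelope (axial n p \<eta> origin) \<le> 1" using \<eta> by simp
  qed simp
  then have "r / 2 * (root 3 (8 / 9) - K) \<le> r / 2 * (aronsson (axial n p \<eta> origin) - K)"
    using r by (intro mult_left_mono) auto
  ultimately show ?thesis unfolding v_def r_def[symmetric] K_def[symmetric] by (simp add: right_diff_distrib)
qed

text \<open>For \<delta> = 2 the center lies at distance exactly \<delta>/2 from p, and the cone
  bound alone gives 1/2. The minimum with 1/4 lets one constant serve both cases, the cube root of 2
  being at most 2.\<close>

lemma infharm_cap_lower:
  assumes n: "1 < n" and \<delta>: "0 < \<delta>" "\<delta> \<le> 2" and p: "p \<in> unit_sphere n"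
  shows "min (1 / 4) (root 3 (2 / 5) / 2 * (root 3 (8 / 9) - root 3 (2 / 3))) * \<delta> powr (1/3)
    \<le> infharm origin (unit_sphere n) (ball_metric n) (spherical_cap n p \<delta>)" (is "min _ ?c * _ \<le> _")
proof (rule infharm_greatest)
  fix u
  assume nonneg: "\<And>z. z \<in> mspace (ball_metric n) \<Longrightarrow> 0 \<le> u z"
    and u: "absolutely_minimal (ball_metric n) (unit_sphere n) u"
    and cap: "\<And>a. a \<in> spherical_cap n p \<delta> \<Longrightarrow> 1 \<le> u a"
  show "min (1 / 4) ?c * \<delta> powr (1/3) \<le> u origin"
  proof (cases "\<delta> = 2")
    case True
    have "mdist (euclid_metric n) p origin = 1"
      using p mdist_commute[of "euclid_metric n" p origin] by (simp add: euclid_dist_origin unit_sphere_iff)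
    then have "1 / 2 \<le> u origin"
      using absolutely_minimal_near_cap[OF p \<delta>(1) u nonneg cap origin_in_ball] True by simp
    moreover have "min (1 / 4) ?c * \<delta> powr (1/3) \<le> 1 / 4 * 2"
      using True powr_mono[of "1/3" 1 "2 :: real"] by (intro mult_mono) auto
    ultimately show ?thesis by simp
  next
    case False
    have "min (1 / 4) ?c * \<delta> powr (1/3) \<le> ?c * \<delta> powr (1/3)" by (intro mult_right_mono) auto
    also have "\<dots> = root 3 (2 / 5 * \<delta>) / 2 * (root 3 (8 / 9) - root 3 (2 / 3))"
      using \<delta> root3_scale[of "2 / 5" \<delta>] by simp
    also have "\<dots> \<le> u origin"
      by (rule absolutely_minimal_cap_lower[OF n \<delta>(1) _ p u nonneg cap]) (use False \<delta> in auto)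
    finally show ?thesis .
  qed
qed

theorem theorem1p5:
  shows "\<exists>c C :: real. c > 0 \<and> C > 0 \<and>
    (\<forall>(n::nat) > 1. \<forall>\<delta>::real. 0 < \<delta> \<and> \<delta> \<le> 2 \<longrightarrow>
      (\<forall>p \<in> unit_sphere n.
         c * \<delta> powr (1/3)
           \<le> infharm origin (unit_sphere n) (ball_metric n) (spherical_cap n p \<delta>) \<and>
         infharm origin (unit_sphere n) (ball_metric n) (spherical_cap n p \<delta>)
           \<le> C * \<delta> powr (1/3)))"
proof (intro exI conjI allI impI ballI)
  \<comment> \<open>Positive because 8/9 exceeds 2/3.\<close>
  show "0 < min (1 / 4) (root 3 (2 / 5) / 2 * (root 3 (8 / 9) - root 3 (2 / 3)))"
    by simp
  show "(0 :: real) < 3" by simp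
qed (use infharm_cap_lower infharm_cap_upper in auto)

end
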